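(* Let $E\subset\partial\mathbb{D}$ be a Lebesgue measurable set of positive Lebesgue measure satisfying $$\int_0^1 |(E+t)\,\triangle\,E|\,\frac{dt}{t}<\infty .$$ Then $E$ almost contains a compact subset which is not removable for $W^1_a$, and $E$ is a set of rigidity for $\mathcal{B}_0$.
   Context: $\mathbb{D}$ is the open unit disc, $\partial\mathbb{D}$ the unit circle, $|\cdot|$ Lebesgue measure on $\partial\mathbb{D}$, $dA$ area measure. $E+t=\{e^{i(s+t)}:e^{is}\in E\}$ and $\triangle$ is the symmetric difference. $K$ is almost contained in $E$ if $K\setminus E$ has Lebesgue measure zero. For open $\Omega\subseteq\mathbb{C}$, $W^1_a(\Omega)$ is the space of holomorphic $f$ in $\Omega$ with $\int_\Omega|f'|\,dA<\infty$. A compact set $K\subset\mathbb{C}$ is removable for $W^1_a$ if $W^1_a(\mathbb{C}\setminus K)$ consists only of constants. The little Bloch space $\mathcal{B}_0$ is the Banach space of holomorphic $f$ in $\mathbb{D}$ with $\lim_{|z|\to1-}(1-|z|)f'(z)=0$, with norm $\|f\|_{\mathcal{B}}=|f(0)|+\sup_{z\in\mathbb{D}}(1-|z|)|f'(z)|$. For a measurable set $E\subseteq\partial\mathbb{D}$, $\mathcal{P}_E(\mathcal{B}_0)$ is the closure of $\{(Q,Q):Q\text{ analytic polynomial}\}$ in $\mathcal{B}_0\oplus L^\infty(E)$, with the norm topology on $\mathcal{B}_0$ and the weak-star topology on $L^\infty(E)$. $E$ is a set of rigidity for $\mathcal{B}_0$ if the projection $\mathcal{B}_0\oplus L^\infty(E)\to\mathcal{B}_0$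 restricted to $\mathcal{P}_E(\mathcal{B}_0)$ is injective. *)

theory Defs
  imports "HOL-Complex_Analysis.Complex_Analysis"
begin

text \<open>Lebesgue (arc length) measure on the unit circle. The completion makes
  \<^term>\<open>sets\<close> the Lebesgue measurable, rather than just the Borel, subsets of the circle.
  The total mass is \<open>2 * pi\<close>.\<close>

definition circle_lebesgue :: "complex measure" where
  "circle_lebesgue = completion
     (distr (restrict_space lborel {0..<2*pi}) (restrict_space borel (sphere 0 1)) cis)"

abbreviation circle_lebesgue_on :: "complex set \<Rightarrow> complex measure" where
  "circle_lebesgue_on E \<equiv> restrict_space circle_lebesgue E"

definition circle_translate :: "complex set \<Rightarrow> real \<Rightarrow> complex set" where
  "circle_translate E t = {cis (s + t) | s. cis s \<in> E}"

definition almost_contained :: "complex set \<Rightarrow> complex set \<Rightarrow> bool" where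
  "almost_contained K E \<longleftrightarrow> K - E \<in> null_sets circle_lebesgue"


definition W1a :: "complex set \<Rightarrow> (complex \<Rightarrow> complex) set" where
  "W1a \<Omega> = {f. f holomorphic_on \<Omega> \<and>
     (\<integral>\<^sup>+z\<in>\<Omega>. ennreal (cmod (deriv f z)) \<partial>lborel) < \<infinity>}"

text \<open>To be applied to compact sets only.\<close>

definition removable_W1a :: "complex set \<Rightarrow> bool" where
  "removable_W1a K \<longleftrightarrow> (\<forall>f\<in>W1a (- K). f constant_on (- K))"


text \<open>
  Elements of the little Bloch space and of \<open>L\<^sup>\<infinity>(E)\<close> are represented by total functions on the
  complex plane. Two functions represent the same element if they agree on the open unit disc,
  respectively almost everywhere on \<open>E\<close>. Both topologies below are pulled back from
  the quotients by these relations: neither can separate two representatives of one element.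
\<close>

definition little_bloch :: "(complex \<Rightarrow> complex) set" where
  "little_bloch = {f. f holomorphic_on ball 0 1 \<and>
     ((\<lambda>z. (1 - cmod z) *\<^sub>R deriv f z) \<longlongrightarrow> 0) (filtercomap cmod (at_left 1))}"

text \<open>Only meaningful where the supremum is finite, which includes \<^const>\<open>little_bloch\<close>.\<close>

definition bloch_norm :: "(complex \<Rightarrow> complex) \<Rightarrow> real" where
  "bloch_norm f = cmod (f 0) + (SUP z\<in>ball 0 1. (1 - cmod z) * cmod (deriv f z))"

definition little_bloch_topology :: "(complex \<Rightarrow> complex) topology" where
  "little_bloch_topology = topology_generated_by
     {{g \<in> little_bloch. bloch_norm (\<lambda>z. g z - f z) < r} | f r. f \<in> little_bloch \<and> r > 0}"

definition Linfty :: "complex set \<Rightarrow> (complex \<Rightarrow> complex) set" where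
  "Linfty E = {g \<in> borel_measurable (circle_lebesgue_on E).
     \<exists>C. AE \<zeta> in circle_lebesgue_on E. cmod (g \<zeta>) \<le> C}"

text \<open>The weak-star topology of \<open>L\<^sup>\<infinity>(E)\<close> as the dual of \<open>L\<^sup>1(E)\<close>: the coarsest topology for
  which the pairing with every \<open>h \<in> L\<^sup>1(E)\<close> is continuous.\<close>

definition weak_star_topology :: "complex set \<Rightarrow> (complex \<Rightarrow> complex) topology" where
  "weak_star_topology E = topology_generated_by
     {{g \<in> Linfty E. (LINT \<zeta>|circle_lebesgue_on E. g \<zeta> * h \<zeta>) \<in> U} | h U.
        integrable (circle_lebesgue_on E) h \<and> open U}"

definition P_little_bloch :: "complex set \<Rightarrow> ((complex \<Rightarrow> complex) \<times> (complex \<Rightarrow> complex)) set" where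
  "P_little_bloch E = prod_topology little_bloch_topology (weak_star_topology E) closure_of
     {(poly Q, poly Q) | Q. True}"

text \<open>Injectivity of the first projection on \<^term>\<open>P_little_bloch E\<close>, with equality in domain and
  codomain read through representatives.\<close>

definition rigidity_little_bloch :: "complex set \<Rightarrow> bool" where
  "rigidity_little_bloch E \<longleftrightarrow>
     (\<forall>(f\<^sub>1, g\<^sub>1) \<in> P_little_bloch E. \<forall>(f\<^sub>2, g\<^sub>2) \<in> P_little_bloch E.
        (\<forall>z\<in>ball 0 1. f\<^sub>1 z = f\<^sub>2 z) \<longrightarrow> (AE \<zeta> in circle_lebesgue_on E. g\<^sub>1 \<zeta> = g\<^sub>2 \<zeta>))"

end

theory Submission
  imports Defs
begin

text \<open>
  On the circle put \<open>osc v \<xi> = \<integral>|v(\<xi> \<zeta>) - v(\<zeta>)| |d\<zeta>|\<close> and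
  \<open>dini v = \<integral>osc v \<xi> / |\<xi> - 1| |d\<xi>|\<close>; the hypothesis says that the indicator of \<open>E\<close> has finite
  Dini integral. Since the Cauchy kernel \<open>\<eta> / (\<eta> - z)\<^sup>2\<close> has mean zero over the circle,
  finiteness of \<open>dini v\<close> makes \<open>\<integral>v(\<eta>) \<eta> / (\<eta> - z)\<^sup>2 |d\<eta>|\<close> integrable in \<open>z\<close> near the circle.

  Truncation: mollify the indicator of \<open>E\<close> to a continuous \<open>u\<close>. By dominated convergence the Dini
  integral of \<open>1\<^sub>E (1 - u)\<close> is small, so by the coarea formula some closed superlevel set \<open>A\<close> of \<open>u\<close>
  is close to \<open>E\<close> in measure while \<open>E - A\<close> has small Dini integral. The intersection \<open>K\<close> of a
  sequence of such sets is almost contained in \<open>E\<close> and has finite Dini integral. For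
  suitable constants \<open>a\<close>, \<open>b\<close> the Cauchy transform of \<open>(a \<zeta> + b) 1\<^sub>K\<close> decays like \<open>|z|\<^sup>-\<^sup>2\<close> at
  infinity, lies in \<open>W1a\<close> and does not vanish at \<open>0\<close>.

  Rigidity: by the same kernel estimate \<open>\<integral>Q w |d\<zeta>|\<close> is bounded by the Bloch norm of the polynomial
  \<open>Q\<close> whenever \<open>dini w\<close> is finite. Hence two elements of the closure with the same first component
  have equal integrals against every \<open>g 1\<^sub>E\<close> with \<open>g\<close> Lipschitz.
\<close>

section \<open>Arc length measure and polar coordinates\<close>

text \<open>Inner regularity gives compact subsets of \<open>E\<close> without any control of their
  Dini integral, hence the level sets. The controlled quantity is the Dini integral of
  \<open>E - A\<close>, not of \<open>A\<close>: intersecting the sets \<open>A\<close> unites the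
  sets \<open>E - A\<close>, and on unions the Dini integral is countably subadditive.

  The constants \<open>a\<close> and \<open>b\<close> answer a problem at infinity. The derivative
  of the Cauchy transform of \<open>w\<close> is of order |z|^-2 unless \<open>w\<close> has total
  mass zero, and |z|^-2 is not integrable there. With M the measure of \<open>K\<close> and m its
  first moment, a = M and b = -m make the mass vanish, while the value at 0 is M^2 - |m|^2, positive
  because no single point carries \<open>K\<close>.

  In the rigidity part Q' may grow like 1 / (1 - |z|), which is not integrable along a radius. A
  second-order Taylor remainder supplies a factor vanishing at radius 1, and writing the radius as s
  * s leaves one dilation by s for Q' and one for the Cauchy kernel.

  The estimates use a Borel subset of \<open>E\<close> of full measure and arc length on the Borel
  sets of the whole plane; the completed measure enters only at the end.\<close>

definition circ :: "complex measure" where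
  "circ = distr (restrict_space lborel {0..<2*pi}) borel cis"

lemma sets_arc [simp, measurable_cong]: "sets circ = sets borel"
  by (simp add: circ_def)

lemma space_arc [simp]: "space circ = UNIV"
  by (simp add: circ_def)

lemma measurable_cis [measurable]: "cis \<in> borel_measurable borel"
  by (intro borel_measurable_continuous_onI continuous_intros)

lemma nn_integral_arc:
  assumes [measurable]: "f \<in> borel_measurable borel"
  shows "(\<integral>\<^sup>+\<zeta>. f \<zeta> \<partial>circ) = (\<integral>\<^sup>+\<theta>\<in>{0..<2*pi}. f (cis \<theta>) \<partial>lborel)"
  by (simp add: circ_def nn_integral_distr nn_integral_restrict_space measurable_restrict_space1)

lemma emeasure_arc_UNIV: "emeasure circ UNIV = ennreal (2 * pi)"
  using nn_integral_arc[of "\<lambda>_. 1"] by (simp add: nn_integral_cmult_indicator)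

interpretation circ: finite_measure circ
  by (rule finite_measureI) (simp add: emeasure_arc_UNIV)

lemma AE_arc_norm: "AE \<zeta> in circ. norm \<zeta> = 1"
  unfolding circ_def by (subst AE_distr_iff) (auto simp: measurable_restrict_space1)

lemma nn_integral_arc_cong:
  "(\<And>\<zeta>. norm \<zeta> = 1 \<Longrightarrow> f \<zeta> = g \<zeta>) \<Longrightarrow> (\<integral>\<^sup>+\<zeta>. f \<zeta> \<partial>circ) = (\<integral>\<^sup>+\<zeta>. g \<zeta> \<partial>circ)"
  by (rule nn_integral_cong_AE) (use AE_arc_norm in auto)

lemma nn_integral_arc_mono:
  "(\<And>\<zeta>. norm \<zeta> = 1 \<Longrightarrow> f \<zeta> \<le> g \<zeta>) \<Longrightarrow> (\<integral>\<^sup>+\<zeta>. f \<zeta> \<partial>circ) \<le> (\<integral>\<^sup>+\<zeta>. g \<zeta> \<partial>circ)"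
  by (rule nn_integral_mono_AE) (use AE_arc_norm in auto)

lemma nn_integral_shift:
  fixes f :: "real \<Rightarrow> ennreal"
  assumes [measurable]: "f \<in> borel_measurable borel"
  shows "(\<integral>\<^sup>+x\<in>{a..<b}. f (x + t) \<partial>lborel) = (\<integral>\<^sup>+x\<in>{a+t..<b+t}. f x \<partial>lborel)"
  by (subst (2) nn_integral_real_affine[where c=1 and t=t])
     (auto intro!: nn_integral_cong split: split_indicator simp: add.commute)

text \<open>Angles from 2 pi on are moved back by one period of \<open>cis\<close>, where they fill
  the missing piece \<open>{0..<t}\<close>.\<close>

lemma nn_integral_arc_from:
  assumes [measurable]: "f \<in> borel_measurable borel" and t: "0 \<le> t" "t \<le> 2 * pi"
  shows "(\<integral>\<^sup>+\<theta>\<in>{t..<t+2*pi}. f (cis \<theta>) \<partial>lborel) = (\<integral>\<^sup>+\<zeta>. f \<zeta> \<partial>circ)"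
proof -
  have "(\<integral>\<^sup>+\<theta>\<in>{t..<t+2*pi}. f (cis \<theta>) \<partial>lborel)
      = (\<integral>\<^sup>+\<theta>. f (cis \<theta>) * indicator {t..<2*pi} \<theta> + f (cis \<theta>) * indicator {2*pi..<t+2*pi} \<theta> \<partial>lborel)"
    using t by (intro nn_integral_cong) (auto split: split_indicator)
  also have "\<dots> = (\<integral>\<^sup>+\<theta>\<in>{t..<2*pi}. f (cis \<theta>) \<partial>lborel) + (\<integral>\<^sup>+\<theta>\<in>{0+2*pi..<t+2*pi}. f (cis \<theta>) \<partial>lborel)"
    by (subst nn_integral_add) auto
  also have "(\<integral>\<^sup>+\<theta>\<in>{0+2*pi..<t+2*pi}. f (cis \<theta>) \<partial>lborel) = (\<integral>\<^sup>+\<theta>\<in>{0..<t}. f (cis (\<theta> + 2*pi)) \<partial>lborel)"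
    by (rule nn_integral_shift[symmetric]) simp
  also have "\<dots> = (\<integral>\<^sup>+\<theta>\<in>{0..<t}. f (cis \<theta>) \<partial>lborel)"
    by (simp flip: cis_mult)
  also have "(\<integral>\<^sup>+\<theta>\<in>{t..<2*pi}. f (cis \<theta>) \<partial>lborel) + \<dots>
      = (\<integral>\<^sup>+\<theta>. f (cis \<theta>) * indicator {t..<2*pi} \<theta> + f (cis \<theta>) * indicator {0..<t} \<theta> \<partial>lborel)"
    by (subst nn_integral_add) auto
  also have "\<dots> = (\<integral>\<^sup>+\<theta>\<in>{0..<2*pi}. f (cis \<theta>) \<partial>lborel)"
    using t by (intro nn_integral_cong) (auto split: split_indicator)
  finally show ?thesis by (simp add: nn_integral_arc)
qed

lemma nn_integral_arc_rotate:
  assumes [measurable]: "f \<in> borel_measurable borel" and c: "norm c = 1"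
  shows "(\<integral>\<^sup>+\<zeta>. f (c * \<zeta>) \<partial>circ) = (\<integral>\<^sup>+\<zeta>. f \<zeta> \<partial>circ)"
proof -
  obtain t where t: "0 \<le> t" "t < 2*pi" "c = cis t"
    using complex_unimodular_polar[OF c] by (metis cis.code Complex_eq)
  have "(\<integral>\<^sup>+\<zeta>. f (c * \<zeta>) \<partial>circ) = (\<integral>\<^sup>+\<theta>\<in>{0..<2*pi}. f (cis (\<theta> + t)) \<partial>lborel)"
    using t by (subst nn_integral_arc) (auto simp: cis_mult add.commute)
  also have "\<dots> = (\<integral>\<^sup>+\<theta>\<in>{0+t..<2*pi+t}. f (cis \<theta>) \<partial>lborel)"
    by (rule nn_integral_shift) simp
  also have "\<dots> = (\<integral>\<^sup>+\<zeta>. f \<zeta> \<partial>circ)"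
    using nn_integral_arc_from[of f t] t by (simp add: add.commute)
  finally show ?thesis .
qed

lemma distr_arc_rotate:
  assumes c: "norm c = 1"
  shows "distr circ borel ((*) c) = circ"
proof (rule measure_eqI)
  fix A assume "A \<in> sets (distr circ borel ((*) c))"
  then have A[measurable]: "A \<in> sets borel" by simp
  have "emeasure (distr circ borel ((*) c)) A = (\<integral>\<^sup>+\<zeta>. indicator A \<zeta> \<partial>distr circ borel ((*) c))"
    by simp
  also have "\<dots> = (\<integral>\<^sup>+\<zeta>. indicator A (c * \<zeta>) \<partial>circ)"
    by (rule nn_integral_distr) auto
  also have "\<dots> = emeasure circ A"
    by (subst nn_integral_arc_rotate[OF _ c]) auto
  finally show "emeasure (distr circ borel ((*) c)) A = emeasure circ A" .
qed simp

lemma integral_arc_rotate: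
  fixes f :: "complex \<Rightarrow> 'a :: {banach, second_countable_topology}"
  assumes [measurable]: "f \<in> borel_measurable borel" and c: "norm c = 1"
  shows "(\<integral>\<zeta>. f (c * \<zeta>) \<partial>circ) = (\<integral>\<zeta>. f \<zeta> \<partial>circ)"
  using integral_distr[of "(*) c" circ borel f] distr_arc_rotate[OF c] by simp

lemma integral_arc_cong:
  fixes f g :: "complex \<Rightarrow> 'a :: {banach, second_countable_topology}"
  assumes [measurable]: "f \<in> borel_measurable borel" "g \<in> borel_measurable borel"
    and "\<And>\<zeta>. norm \<zeta> = 1 \<Longrightarrow> f \<zeta> = g \<zeta>"
  shows "(\<integral>\<zeta>. f \<zeta> \<partial>circ) = (\<integral>\<zeta>. g \<zeta> \<partial>circ)"
  by (rule integral_cong_AE) (use assms AE_arc_norm in auto)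

lemma integrable_arc_bounded:
  fixes f :: "complex \<Rightarrow> 'a :: {banach, second_countable_topology}"
  assumes "f \<in> borel_measurable borel" "\<And>\<zeta>. norm \<zeta> = 1 \<Longrightarrow> norm (f \<zeta>) \<le> B"
  shows "integrable circ f"
  by (rule circ.integrable_const_bound[of _ B]) (use assms AE_arc_norm in auto)

lemma integral_arc:
  fixes f :: "complex \<Rightarrow> 'a :: {banach, second_countable_topology}"
  assumes [measurable]: "f \<in> borel_measurable borel"
  shows "(\<integral>\<zeta>. f \<zeta> \<partial>circ) = (LINT \<theta>:{0..<2*pi}|lborel. f (cis \<theta>))"
  by (simp add: circ_def integral_distr integral_restrict_space measurable_restrict_space1
       set_lebesgue_integral_def)

text \<open>Boundedness makes the integrand Lebesgue integrable, so the Bochner and gauge integrals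
  agree. The endpoint 2 pi, absent from the half-open parametrization, is negligible.\<close>

lemma has_integral_arc:
  fixes f :: "complex \<Rightarrow> complex"
  assumes [measurable]: "f \<in> borel_measurable borel"
    and B: "\<And>\<zeta>. norm \<zeta> = 1 \<Longrightarrow> norm (f \<zeta>) \<le> B"
    and I: "((\<lambda>\<theta>. f (cis \<theta>)) has_integral I) {0..2*pi}"
  shows "(\<integral>\<zeta>. f \<zeta> \<partial>circ) = I"
proof -
  have "set_integrable lborel {0..<2*pi} (\<lambda>\<theta>. f (cis \<theta>))"
    unfolding set_integrable_def
    by (rule integrableI_bounded_set_indicator[where B=B]) (use B in auto)
  then have "(LINT \<theta>:{0..<2*pi}|lborel. f (cis \<theta>)) = integral {0..<2*pi} (\<lambda>\<theta>. f (cis \<theta>))"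
    by (rule set_borel_integral_eq_integral)
  also have "\<dots> = integral {0..2*pi} (\<lambda>\<theta>. f (cis \<theta>))"
    by (rule integral_spike_set) (auto intro: negligible_subset[of "{2*pi}"])
  finally show ?thesis
    using I by (simp add: integral_arc integral_unique)
qed

section \<open>Integration over the plane in polar coordinates\<close>

lemma lborel_complex: "(lborel :: complex measure) = distr (lborel \<Otimes>\<^sub>M lborel) borel (\<lambda>(x, y). Complex x y)"
proof (rule lborel_eqI)
  fix l u :: complex
  assume le: "\<And>b. b \<in> Basis \<Longrightarrow> l \<bullet> b \<le> u \<bullet> b"
  have [measurable]: "(\<lambda>(x, y). Complex x y) \<in> lborel \<Otimes>\<^sub>M lborel \<rightarrow>\<^sub>M borel"
    by (simp add: Complex_eq split_beta')
  have "(\<lambda>(x, y). Complex x y) -` box l u \<inter> space (lborel \<Otimes>\<^sub>M lborel) = {Re l<..<Re u} \<times> {Im l<..<Im u}"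
    by (auto simp: box_def Basis_complex_def space_pair_measure)
  then show "emeasure (distr (lborel \<Otimes>\<^sub>M lborel) borel (\<lambda>(x, y). Complex x y)) (box l u) = (\<Prod>b\<in>Basis. (u - l) \<bullet> b)"
    using le[of 1] le[of \<i>]
    by (simp add: emeasure_distr lborel.emeasure_pair_measure_Times Basis_complex_def ennreal_mult)
qed simp

text \<open>Substitution is done on the compact intervals [-n-1, n+1] and passed to the limit by
  monotone convergence; the images under \<open>arctan\<close> stay inside (-pi/2, pi/2). The added
  1 keeps the interval nondegenerate for n = 0.\<close>

lemma nn_integral_arctan:
  fixes H :: "real \<Rightarrow> ennreal"
  assumes [measurable]: "H \<in> borel_measurable borel"
  shows "(\<integral>\<^sup>+s. H (arctan s) * ennreal (inverse (1 + s\<^sup>2)) \<partial>lborel) \<le> (\<integral>\<^sup>+\<theta>\<in>{-pi/2<..<pi/2}. H \<theta> \<partial>lborel)"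
proof -
  define h where "h s = H (arctan s) * ennreal (inverse (1 + s\<^sup>2))" for s
  have [measurable]: "arctan \<in> borel_measurable borel"
    by (intro borel_measurable_continuous_onI continuous_intros)
  have [measurable]: "h \<in> borel_measurable borel"
    unfolding h_def by measurable
  have "(\<integral>\<^sup>+s. h s \<partial>lborel) = (\<integral>\<^sup>+s. (SUP n. h s * indicator {-real n-1..real n+1} s) \<partial>lborel)"
  proof (intro nn_integral_cong antisym)
    fix s :: real
    obtain n :: nat where "\<bar>s\<bar> \<le> real n" using real_arch_simple[of "\<bar>s\<bar>"] ..
    then show "h s \<le> (SUP n. h s * indicator {-real n-1..real n+1} s)"
      by (intro SUP_upper2[of n]) (auto simp: indicator_def abs_le_iff)
  qed (auto intro!: SUP_least simp: indicator_def)
  also have "\<dots> = (SUP n. \<integral>\<^sup>+s. h s * indicator {-real n-1..real n+1} s \<partial>lborel)"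
    by (intro nn_integral_monotone_convergence_SUP)
       (auto simp: incseq_def le_fun_def intro!: mult_mono split: split_indicator)
  also have "\<dots> \<le> (\<integral>\<^sup>+\<theta>\<in>{-pi/2<..<pi/2}. H \<theta> \<partial>lborel)"
  proof (rule SUP_least)
    fix n
    have "(\<integral>\<^sup>+s. h s * indicator {-real n-1..real n+1} s \<partial>lborel)
        = (\<integral>\<^sup>+\<theta>. H \<theta> * indicator {arctan (-real n-1)..arctan (real n+1)} \<theta> \<partial>lborel)"
      unfolding h_def
      by (subst nn_integral_substitution_aux[where g' = "\<lambda>s. inverse (1 + s\<^sup>2)"])
         (auto intro!: DERIV_arctan continuous_intros simp: add_nonneg_eq_0_iff)
    also have "\<dots> \<le> (\<integral>\<^sup>+\<theta>\<in>{-pi/2<..<pi/2}. H \<theta> \<partial>lborel)"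
      using arctan_lbound[of "-real n - 1"] arctan_ubound[of "real n + 1"]
      by (intro nn_integral_mono) (auto split: split_indicator)
    finally show "(\<integral>\<^sup>+s. h s * indicator {-real n-1..real n+1} s \<partial>lborel) \<le> (\<integral>\<^sup>+\<theta>\<in>{-pi/2<..<pi/2}. H \<theta> \<partial>lborel)" .
  qed
  finally show ?thesis unfolding h_def .
qed

lemma nn_integral_half_circle_le:
  assumes [measurable]: "f \<in> borel_measurable borel"
  shows "(\<integral>\<^sup>+\<theta>\<in>{-pi/2<..<pi/2}. f (cis \<theta>) \<partial>lborel) \<le> (\<integral>\<^sup>+\<zeta>. f \<zeta> \<partial>circ)"
proof -
  have "(\<integral>\<^sup>+\<theta>\<in>{-pi/2<..<pi/2}. f (cis \<theta>) \<partial>lborel) \<le> (\<integral>\<^sup>+\<theta>\<in>{0+(-pi/2)..<pi+(-pi/2)}. f (cis \<theta>) \<partial>lborel)"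
    by (intro nn_integral_mono) (auto split: split_indicator)
  also have "\<dots> = (\<integral>\<^sup>+\<theta>\<in>{0..<pi}. f (cis (\<theta> + (-pi/2))) \<partial>lborel)"
    by (rule nn_integral_shift[symmetric]) simp
  also have "\<dots> \<le> (\<integral>\<^sup>+\<theta>\<in>{0..<2*pi}. f (cis (-pi/2) * cis \<theta>) \<partial>lborel)"
    by (intro nn_integral_mono) (auto split: split_indicator simp: cis_mult simp del: cis_minus_pi_half)
  also have "\<dots> = (\<integral>\<^sup>+\<zeta>. f (cis (-pi/2) * \<zeta>) \<partial>circ)"
    by (rule nn_integral_arc[symmetric]) simp
  also have "\<dots> = (\<integral>\<^sup>+\<zeta>. f \<zeta> \<partial>circ)"
    by (rule nn_integral_arc_rotate) auto
  finally show ?thesis .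
qed

text \<open>Two one-dimensional substitutions replace a planar Jacobian. Passing to the slope, y = x
  * s, gives dx dy = x dx ds; then x = r * cos \<theta> and s = tan \<theta> turn this into r dr
  d\<theta>.\<close>

lemma nn_integral_right_half_plane_le_polar:
  assumes [measurable]: "G \<in> borel_measurable borel"
  shows "(\<integral>\<^sup>+x\<in>{0<..}. (\<integral>\<^sup>+y. G (Complex x y) \<partial>lborel) \<partial>lborel)
    \<le> (\<integral>\<^sup>+r\<in>{0<..}. (\<integral>\<^sup>+\<zeta>. G (of_real r * \<zeta>) \<partial>circ) * ennreal r \<partial>lborel)"
proof -
  have Complex_measurable [measurable (raw)]: "(\<lambda>x. Complex (f x) (g x)) \<in> borel_measurable M"
    if [measurable]: "f \<in> borel_measurable M" "g \<in> borel_measurable M" for f g and M :: "'x measure"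
    by (simp add: Complex_eq)
  let ?G = "\<lambda>r \<theta>. G (of_real r * cis \<theta>) * ennreal r * indicator {0<..} r"
  define H where "H \<theta> = (\<integral>\<^sup>+r. ?G r \<theta> \<partial>lborel)" for \<theta>
  have [measurable]: "H \<in> borel_measurable borel"
    unfolding H_def by measurable
  let ?c = "\<lambda>x s. ennreal x * G (Complex x (x * s)) * indicator {0<..} x"
  have "(\<integral>\<^sup>+x\<in>{0<..}. (\<integral>\<^sup>+y. G (Complex x y) \<partial>lborel) \<partial>lborel)
      = (\<integral>\<^sup>+x. (\<integral>\<^sup>+s. ?c x s \<partial>lborel) \<partial>lborel)"
  proof (intro nn_integral_cong)
    fix x :: real
    show "(\<integral>\<^sup>+y. G (Complex x y) \<partial>lborel) * indicator {0<..} x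
        = (\<integral>\<^sup>+s. ?c x s \<partial>lborel)"
    proof (cases "x > 0")
      case True
      then show ?thesis
        by (subst nn_integral_real_affine[where c=x and t=0]) (auto simp: nn_integral_cmult)
    qed simp
  qed
  also have "\<dots> = (\<integral>\<^sup>+s. (\<integral>\<^sup>+x. ?c x s \<partial>lborel) \<partial>lborel)"
    by (rule lborel_pair.Fubini') measurable
  also have "\<dots> = (\<integral>\<^sup>+s. H (arctan s) * ennreal (inverse (1 + s\<^sup>2)) \<partial>lborel)"
  proof (intro nn_integral_cong)
    fix s :: real
    \<comment> \<open>For x = c * r one factor c comes from x and one from dx. Their product c * c =
      1 / (1 + s^2) is the derivative of \<open>arctan\<close>, which converts ds into
      d\<theta>.\<close>
    define c where "c = cos (arctan s)"
    have s: "1 + s\<^sup>2 > 0"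
      by (simp add: add_pos_nonneg)
    have c: "c > 0" "c * s = sin (arctan s)" "c * c = inverse (1 + s\<^sup>2)"
      unfolding c_def using s by (auto simp: cos_arctan sin_arctan field_simps simp flip: power2_eq_square)
    have "(\<integral>\<^sup>+x. ?c x s \<partial>lborel)
        = ennreal c * (\<integral>\<^sup>+r. ennreal (c * r) * G (Complex (c * r) (c * r * s)) * indicator {0<..} (c * r) \<partial>lborel)"
      using c by (subst nn_integral_real_affine[where c=c and t=0]) auto
    also have "\<dots> = ennreal c * (\<integral>\<^sup>+r. ennreal c * (G (of_real r * cis (arctan s)) * ennreal r * indicator {0<..} r) \<partial>lborel)"
    proof (rule arg_cong2[where f="(*)", OF refl nn_integral_cong])
      fix r
      have "Complex (c * r) (c * r * s) = of_real r * cis (arctan s)"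
        using c(2) by (simp add: complex_eq_iff c_def algebra_simps)
      then show "ennreal (c * r) * G (Complex (c * r) (c * r * s)) * indicator {0<..} (c * r)
        = ennreal c * (G (of_real r * cis (arctan s)) * ennreal r * indicator {0<..} r)"
        using c(1) by (auto simp: indicator_def zero_less_mult_iff ennreal_mult mult_ac)
    qed
    also have "\<dots> = ennreal (c * c) * H (arctan s)"
      unfolding H_def using c(1) by (subst nn_integral_cmult) (auto simp: ennreal_mult mult_ac)
    finally show "(\<integral>\<^sup>+x. ?c x s \<partial>lborel)
        = H (arctan s) * ennreal (inverse (1 + s\<^sup>2))"
      by (simp add: c(3) mult.commute)
  qed
  also have "\<dots> \<le> (\<integral>\<^sup>+\<theta>\<in>{-pi/2<..<pi/2}. H \<theta> \<partial>lborel)"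
    by (rule nn_integral_arctan) simp
  also have "\<dots> = (\<integral>\<^sup>+\<theta>. (\<integral>\<^sup>+r. ?G r \<theta> * indicator {-pi/2<..<pi/2} \<theta> \<partial>lborel) \<partial>lborel)"
    unfolding H_def by (subst nn_integral_multc) auto
  also have "\<dots> = (\<integral>\<^sup>+r. (\<integral>\<^sup>+\<theta>. ?G r \<theta> * indicator {-pi/2<..<pi/2} \<theta> \<partial>lborel) \<partial>lborel)"
    by (rule lborel_pair.Fubini') measurable
  also have "\<dots> = (\<integral>\<^sup>+r\<in>{0<..}. (\<integral>\<^sup>+\<theta>\<in>{-pi/2<..<pi/2}. G (of_real r * cis \<theta>) \<partial>lborel) * ennreal r \<partial>lborel)"
    by (subst nn_integral_multc[symmetric], measurable)+ (auto intro!: nn_integral_cong simp: mult_ac)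
  also have "\<dots> \<le> (\<integral>\<^sup>+r\<in>{0<..}. (\<integral>\<^sup>+\<zeta>. G (of_real r * \<zeta>) \<partial>circ) * ennreal r \<partial>lborel)"
    by (intro nn_integral_mono mult_right_mono nn_integral_half_circle_le) auto
  finally show ?thesis .
qed

text \<open>The integral over each open half plane is bounded by the full polar integral, which
  accounts for the factor 2; the imaginary axis between them is null.\<close>

lemma nn_integral_complex_le_polar:
  assumes [measurable]: "G \<in> borel_measurable borel"
  shows "(\<integral>\<^sup>+z. G z \<partial>lborel) \<le> 2 * (\<integral>\<^sup>+r\<in>{0<..}. (\<integral>\<^sup>+\<zeta>. G (of_real r * \<zeta>) \<partial>circ) * ennreal r \<partial>lborel)"
proof -
  have Complex_measurable [measurable (raw)]: "(\<lambda>x. Complex (f x) (g x)) \<in> borel_measurable M"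
    if [measurable]: "f \<in> borel_measurable M" "g \<in> borel_measurable M" for f g and M :: "'x measure"
    by (simp add: Complex_eq)
  let ?R = "\<integral>\<^sup>+r\<in>{0<..}. (\<integral>\<^sup>+\<zeta>. G (of_real r * \<zeta>) \<partial>circ) * ennreal r \<partial>lborel"
  define F where "F x = (\<integral>\<^sup>+y. G (Complex x y) \<partial>lborel)" for x
  have [measurable]: "F \<in> borel_measurable borel"
    unfolding F_def by measurable
  have "(\<integral>\<^sup>+z. G z \<partial>lborel) = (\<integral>\<^sup>+p. G (Complex (fst p) (snd p)) \<partial>(lborel \<Otimes>\<^sub>M lborel))"
    by (subst lborel_complex) (simp add: nn_integral_distr split_beta')
  also have "\<dots> = (\<integral>\<^sup>+x. F x \<partial>lborel)"
    unfolding F_def by (subst lborel.nn_integral_fst[symmetric]) auto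
  also have "\<dots> = (\<integral>\<^sup>+x. F x * indicator {0<..} x + F x * indicator {..<0} x \<partial>lborel)"
    by (rule nn_integral_cong_AE) (use AE_lborel_singleton[of 0] in \<open>auto split: split_indicator\<close>)
  also have "\<dots> = (\<integral>\<^sup>+x\<in>{0<..}. F x \<partial>lborel) + (\<integral>\<^sup>+x\<in>{..<0}. F x \<partial>lborel)"
    by (rule nn_integral_add) auto
  also have "(\<integral>\<^sup>+x\<in>{..<0}. F x \<partial>lborel) = (\<integral>\<^sup>+x\<in>{0<..}. F (-x) \<partial>lborel)"
    by (subst nn_integral_real_affine[where c="-1" and t=0]) (auto intro!: nn_integral_cong split: split_indicator)
  also have "\<dots> = (\<integral>\<^sup>+x\<in>{0<..}. (\<integral>\<^sup>+y. G (- Complex x y) \<partial>lborel) \<partial>lborel)"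
    unfolding F_def
    by (subst nn_integral_real_affine[where c="-1" and t=0]) (auto simp: Complex_eq)
  also have "\<dots> \<le> (\<integral>\<^sup>+r\<in>{0<..}. (\<integral>\<^sup>+\<zeta>. G (- (of_real r * \<zeta>)) \<partial>circ) * ennreal r \<partial>lborel)"
    by (rule nn_integral_right_half_plane_le_polar) simp
  also have "\<dots> = ?R"
  proof (intro nn_integral_cong)
    fix r :: real
    have "(\<integral>\<^sup>+\<zeta>. G (- (of_real r * \<zeta>)) \<partial>circ) = (\<integral>\<^sup>+\<zeta>. G (of_real r * \<zeta>) \<partial>circ)"
      using nn_integral_arc_rotate[of "\<lambda>\<zeta>. G (of_real r * \<zeta>)" "-1"] by simp
    then show "(\<integral>\<^sup>+\<zeta>. G (- (of_real r * \<zeta>)) \<partial>circ) * ennreal r * indicator {0<..} r =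
        (\<integral>\<^sup>+\<zeta>. G (of_real r * \<zeta>) \<partial>circ) * ennreal r * indicator {0<..} r" by simp
  qed
  also have "(\<integral>\<^sup>+x\<in>{0<..}. F x \<partial>lborel) \<le> ?R"
    unfolding F_def by (rule nn_integral_right_half_plane_le_polar) simp
  finally show ?thesis by (simp add: mult_2)
qed

section \<open>The Dini integral\<close>

text \<open>For an indicator this is the arc length of the symmetric difference of a set and a
  rotated copy of it, the quantity in the hypothesis of the theorem.\<close>

definition osc :: "(complex \<Rightarrow> 'a :: {real_normed_vector, second_countable_topology}) \<Rightarrow> complex \<Rightarrow> ennreal" where
  "osc v \<xi> = (\<integral>\<^sup>+\<zeta>. ennreal (norm (v (\<xi> * \<zeta>) - v \<zeta>)) \<partial>circ)"

text \<open>The chord \<open>norm (\<xi> - 1)\<close> stands in for the angle, to which it is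
  comparable. At \<xi> = 1 the quotient is 0 / 0, which is 0 in \<open>ennreal\<close>.\<close>

definition dini :: "(complex \<Rightarrow> 'a :: {real_normed_vector, second_countable_topology}) \<Rightarrow> ennreal" where
  "dini v = (\<integral>\<^sup>+\<xi>. osc v \<xi> / ennreal (norm (\<xi> - 1)) \<partial>circ)"

abbreviation "osc_quot v \<xi> \<equiv> osc v \<xi> / ennreal (norm (\<xi> - 1))"

interpretation arc_pair: pair_sigma_finite circ circ ..
interpretation lborel_arc: pair_sigma_finite "lborel :: real measure" circ ..

lemma measure_arc_UNIV: "measure circ UNIV = 2 * pi"
  by (simp add: measure_def emeasure_arc_UNIV)

lemma norm_integral_arc_le:
  fixes f :: "complex \<Rightarrow> 'a :: {banach, second_countable_topology}"
  assumes f[measurable]: "f \<in> borel_measurable borel" and B: "\<And>\<zeta>. norm \<zeta> = 1 \<Longrightarrow> norm (f \<zeta>) \<le> B"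
  shows "norm (\<integral>\<zeta>. f \<zeta> \<partial>circ) \<le> 2 * pi * B"
proof -
  have "norm (\<integral>\<zeta>. f \<zeta> \<partial>circ) \<le> (\<integral>\<zeta>. norm (f \<zeta>) \<partial>circ)"
    by (rule integral_norm_bound)
  also have "\<dots> \<le> (\<integral>\<zeta>. B \<partial>circ)"
    by (rule integral_mono_AE) (use B AE_arc_norm in \<open>auto intro!: integrable_norm integrable_arc_bounded[OF f]\<close>)
  finally show ?thesis by (simp add: measure_arc_UNIV)
qed

lemma measurable_osc [measurable]:
  assumes [measurable]: "v \<in> borel_measurable borel"
  shows "osc v \<in> borel_measurable borel"
  unfolding osc_def by measurable

lemma osc_1 [simp]: "osc v 1 = 0"
  by (simp add: osc_def)

text \<open>Functions small in L1 oscillate little under every rotation. This yields pointwise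
  convergence for the dominated convergence argument and shows that null sets do not
  contribute.\<close>

lemma osc_le_norm:
  assumes [measurable]: "v \<in> borel_measurable borel" and \<xi>: "norm \<xi> = 1"
  shows "osc v \<xi> \<le> 2 * (\<integral>\<^sup>+\<zeta>. ennreal (norm (v \<zeta>)) \<partial>circ)"
proof -
  have "osc v \<xi> \<le> (\<integral>\<^sup>+\<zeta>. ennreal (norm (v (\<xi> * \<zeta>))) + ennreal (norm (v \<zeta>)) \<partial>circ)"
    unfolding osc_def
    by (intro nn_integral_mono) (auto simp: norm_triangle_ineq4 simp flip: ennreal_plus intro!: ennreal_leI)
  also have "\<dots> = 2 * (\<integral>\<^sup>+\<zeta>. ennreal (norm (v \<zeta>)) \<partial>circ)"
    using nn_integral_arc_rotate[OF _ \<xi>, of "\<lambda>\<zeta>. ennreal (norm (v \<zeta>))"]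
    by (simp add: nn_integral_add mult_2)
  finally show ?thesis .
qed

text \<open>The pointwise hypothesis, weaker than \<open>v = w + u\<close>, also covers truncated
  products and indicators of intersections and differences.\<close>

lemma osc_add_le:
  assumes [measurable]: "w \<in> borel_measurable borel" "u \<in> borel_measurable borel"
    and \<xi>: "norm \<xi> = 1"
    and le: "\<And>x y. norm x = 1 \<Longrightarrow> norm y = 1 \<Longrightarrow> norm (v x - v y) \<le> norm (w x - w y) + norm (u x - u y)"
  shows "osc v \<xi> \<le> osc w \<xi> + osc u \<xi>"
proof -
  have "osc v \<xi> \<le> (\<integral>\<^sup>+\<zeta>. ennreal (norm (w (\<xi> * \<zeta>) - w \<zeta>)) + ennreal (norm (u (\<xi> * \<zeta>) - u \<zeta>)) \<partial>circ)"
    unfolding osc_def using \<xi>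
    by (intro nn_integral_arc_mono) (auto simp: norm_mult simp flip: ennreal_plus intro!: ennreal_leI le)
  also have "\<dots> = osc w \<xi> + osc u \<xi>"
    unfolding osc_def by (rule nn_integral_add) auto
  finally show ?thesis .
qed

lemma dini_add_le:
  assumes [measurable]: "w \<in> borel_measurable borel" "u \<in> borel_measurable borel"
    and le: "\<And>\<xi>. norm \<xi> = 1 \<Longrightarrow> osc v \<xi> \<le> osc w \<xi> + osc u \<xi>"
  shows "dini v \<le> dini w + dini u"
proof -
  have "dini v \<le> (\<integral>\<^sup>+\<xi>. osc_quot w \<xi> + osc_quot u \<xi> \<partial>circ)"
    unfolding dini_def
    by (intro nn_integral_arc_mono) (auto simp: divide_ennreal_def le simp flip: distrib_right intro!: mult_right_mono)
  also have "\<dots> = dini w + dini u"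
    unfolding dini_def by (rule nn_integral_add) auto
  finally show ?thesis .
qed

text \<open>If exactly one of two points lies in the union, then some single \<open>B k\<close>
  already contains exactly one of them.\<close>

lemma osc_indicator_UN_le:
  fixes B :: "nat \<Rightarrow> complex set"
  assumes [measurable]: "\<And>k. B k \<in> sets borel"
  shows "osc (indicat_real (\<Union>k. B k)) \<xi> \<le> (\<Sum>k. osc (indicat_real (B k)) \<xi>)"
proof -
  have *: "ennreal (norm (indicator (\<Union>k. B k) x - indicator (\<Union>k. B k) y :: real))
      \<le> (\<Sum>k. ennreal (norm (indicator (B k) x - indicator (B k) y :: real)))" for x y
  proof (cases "x \<in> (\<Union>k. B k) \<longleftrightarrow> y \<in> (\<Union>k. B k)")
    case False
    then obtain k where "(x \<in> B k) \<noteq> (y \<in> B k)" by auto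
    then have "(1::ennreal) = (\<Sum>j\<in>{k}. ennreal (norm (indicator (B j) x - indicator (B j) y :: real)))"
      by (auto simp: indicator_def)
    also have "\<dots> \<le> (\<Sum>k. ennreal (norm (indicator (B k) x - indicator (B k) y :: real)))"
      by (rule sum_le_suminf) auto
    finally have "1 \<le> (\<Sum>k. ennreal (norm (indicator (B k) x - indicator (B k) y :: real)))" .
    moreover have "ennreal (norm (indicator (\<Union>k. B k) x - indicator (\<Union>k. B k) y :: real)) \<le> 1"
      by (simp add: indicator_def)
    ultimately show ?thesis by (rule order_trans[rotated])
  qed (auto simp: indicator_def)
  have "osc (indicat_real (\<Union>k. B k)) \<xi>
      \<le> (\<integral>\<^sup>+\<zeta>. (\<Sum>k. ennreal (norm (indicator (B k) (\<xi> * \<zeta>) - indicator (B k) \<zeta> :: real))) \<partial>circ)"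
    unfolding osc_def by (rule nn_integral_mono, rule *)
  also have "\<dots> = (\<Sum>k. osc (indicat_real (B k)) \<xi>)"
    unfolding osc_def by (rule nn_integral_suminf) auto
  finally show ?thesis .
qed

lemma dini_indicator_UN_le:
  fixes B :: "nat \<Rightarrow> complex set"
  assumes [measurable]: "\<And>k. B k \<in> sets borel"
  shows "dini (indicat_real (\<Union>k. B k)) \<le> (\<Sum>k. dini (indicat_real (B k)))"
proof -
  have "dini (indicat_real (\<Union>k. B k))
      \<le> (\<integral>\<^sup>+\<xi>. (\<Sum>k. osc_quot (indicat_real (B k)) \<xi>) \<partial>circ)"
    unfolding dini_def
    by (intro nn_integral_mono) (simp add: divide_ennreal_def osc_indicator_UN_le mult_right_mono)
  also have "\<dots> = (\<Sum>k. dini (indicat_real (B k)))"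
    unfolding dini_def by (rule nn_integral_suminf) auto
  finally show ?thesis .
qed

section \<open>Mollification by a tent kernel\<close>

lemma norm_cis_minus_1: "norm (cis t - 1) = 2 * \<bar>sin (t / 2)\<bar>"
  using dist_exp_i_1[of t] by (simp add: cis_conv_exp)

text \<open>A chord is no longer than its arc, so the arc of angles in [0, \<delta>] lies in the
  ball. The bound keeps the total mass of the mollifying kernel away from 0.\<close>

lemma emeasure_arc_near_1:
  assumes "0 \<le> \<delta>" "\<delta> \<le> 1"
  shows "ennreal \<delta> \<le> emeasure circ (cball 1 \<delta>)"
proof -
  have "norm (cis t - 1) \<le> t" if "t \<ge> 0" for t
    using abs_sin_x_le_abs_x[of "t / 2"] that by (simp add: norm_cis_minus_1)
  then have "(\<integral>\<^sup>+\<theta>. indicator {0..\<delta>} \<theta> \<partial>lborel) \<le> (\<integral>\<^sup>+\<theta>\<in>{0..<2*pi}. indicator (cball 1 \<delta>) (cis \<theta>) \<partial>lborel)"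
    using assms pi_gt3
    by (intro nn_integral_mono) (force simp: indicator_def dist_norm norm_minus_commute)
  also have "\<dots> = (\<integral>\<^sup>+\<zeta>. indicator (cball 1 \<delta>) \<zeta> \<partial>circ)"
    by (rule nn_integral_arc[symmetric]) (simp add: borel_measurable_indicator)
  finally show ?thesis using assms by simp
qed

text \<open>The function u averages \<open>h\<close> over rotations by \<eta> with a tent density p
  supported within distance \<delta> of 1. The height of p is at most 4 / \<delta>, hence at most 4
  / |\<eta> - 1| on its support; this turns the L1 error into four times the part of the Dini
  integral near \<xi> = 1.\<close>

lemma mollify_indicator:
  fixes E :: "complex set"
  assumes [measurable]: "E \<in> sets borel" and \<delta>: "0 < \<delta>" "\<delta> \<le> 1"
  defines "h \<equiv> indicat_real E"
  obtains u :: "complex \<Rightarrow> real" where "continuous_on UNIV u"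
    "\<And>\<zeta>. norm \<zeta> = 1 \<Longrightarrow> 0 \<le> u \<zeta>" "\<And>\<zeta>. norm \<zeta> = 1 \<Longrightarrow> u \<zeta> \<le> 1"
    "(\<integral>\<^sup>+\<zeta>. ennreal \<bar>u \<zeta> - h \<zeta>\<bar> \<partial>circ) \<le> 4 * (\<integral>\<^sup>+\<xi>. osc_quot h \<xi> * indicator (ball 1 \<delta>) \<xi> \<partial>circ)"
    "\<And>\<xi>. norm \<xi> = 1 \<Longrightarrow> osc u \<xi> \<le> osc h \<xi>"
proof -
  have [measurable]: "h \<in> borel_measurable borel"
    unfolding h_def by measurable
  define k where "k z = max 0 (1 - norm z / \<delta>)" for z :: complex
  have [measurable]: "k \<in> borel_measurable borel"
    unfolding k_def by measurable
  have k: "0 \<le> k z" "k z \<le> 1" for z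
    using \<delta> by (auto simp: k_def)
  have k_lip: "\<bar>k z - k w\<bar> \<le> norm (z - w) / \<delta>" for z w
  proof -
    have "\<bar>k z - k w\<bar> \<le> \<bar>norm w / \<delta> - norm z / \<delta>\<bar>"
      by (auto simp: k_def max_def abs_if)
    also have "\<dots> = \<bar>norm w - norm z\<bar> / \<delta>"
      using \<delta> by (simp add: abs_divide flip: diff_divide_distrib)
    also have "\<dots> \<le> norm (z - w) / \<delta>"
      using \<delta> norm_triangle_ineq3[of w z] by (intro divide_right_mono) (auto simp: norm_minus_commute)
    finally show ?thesis .
  qed
  define c where "c = (\<integral>\<eta>. k (\<eta> - 1) \<partial>circ)"
  have int_k: "integrable circ (\<lambda>\<eta>. k (\<eta> - z))" for z
    by (rule integrable_arc_bounded[where B=1]) (use k in auto)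
  \<comment> \<open>Within distance \<delta> / 2 of 1 the tent is at least 1/2, and that part of the
    circle has length at least \<delta> / 2.\<close>
  have c: "c \<ge> \<delta> / 4"
  proof -
    have "ennreal (\<delta> / 2) * ennreal (1/2) \<le> emeasure circ (cball 1 (\<delta>/2)) * ennreal (1/2)"
      using \<delta> by (intro mult_right_mono emeasure_arc_near_1) auto
    also have "\<dots> = (\<integral>\<^sup>+\<eta>. ennreal (1/2) * indicator (cball 1 (\<delta>/2)) \<eta> \<partial>circ)"
      by (subst nn_integral_cmult) (auto simp: mult.commute borel_measurable_indicator)
    also have "\<dots> \<le> (\<integral>\<^sup>+\<eta>. ennreal (k (\<eta> - 1)) \<partial>circ)"
    proof (intro nn_integral_mono)
      fix \<eta> :: complex
      have "1/2 \<le> k (\<eta> - 1)" if "\<eta> \<in> cball 1 (\<delta>/2)"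
        using that \<delta> by (auto simp: k_def dist_norm norm_minus_commute field_simps)
      then show "ennreal (1/2) * indicator (cball 1 (\<delta>/2)) \<eta> \<le> ennreal (k (\<eta> - 1))"
        using ennreal_leI[of "1/2" "k (\<eta> - 1)"] by (cases "\<eta> \<in> cball 1 (\<delta>/2)") simp_all
    qed
    also have "\<dots> = ennreal c"
      unfolding c_def by (rule nn_integral_eq_integral[OF int_k]) (use k in auto)
    also have "ennreal (\<delta> / 2) * ennreal (1/2) = ennreal (\<delta>/4)"
      using \<delta> by (subst ennreal_mult[symmetric]) auto
    finally show ?thesis
      using \<delta> k by (subst (asm) ennreal_le_iff) (auto simp: c_def)
  qed
  have c0: "c > 0" using c \<delta> by linarith
  \<comment> \<open>In this form u inherits a Lipschitz bound from \<open>k\<close> on the whole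
    plane, since \<zeta> enters only through \<open>k\<close>. On the circle \<open>u_eq\<close>
    rewrites it as an average of rotated copies of \<open>h\<close>.\<close>
  define u where "u \<zeta> = (\<integral>\<eta>. h \<eta> * k (\<eta> - \<zeta>) \<partial>circ) / c" for \<zeta>
  define p where "p \<eta> = k (\<eta> - 1) / c" for \<eta>
  have [measurable]: "p \<in> borel_measurable borel"
    unfolding p_def by measurable
  have p0: "p \<eta> \<ge> 0" for \<eta>
    using k c0 by (auto simp: p_def)
  have int_p: "integrable circ (\<lambda>\<eta>. p \<eta>)" "(\<integral>\<eta>. p \<eta> \<partial>circ) = 1"
    unfolding p_def using int_k[of 1] c0 by (auto simp: c_def)
  have h01: "0 \<le> h z" "h z \<le> 1" for z
    by (auto simp: h_def indicator_def)
  have int_hp: "integrable circ (\<lambda>\<eta>. h (z * \<eta>) * p \<eta>)" for z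
    by (rule Bochner_Integration.integrable_bound[OF int_p(1)])
       (use p0 h01 in \<open>auto simp: abs_mult intro!: mult_left_le_one_le\<close>)
  have int_hk: "integrable circ (\<lambda>\<eta>. h \<eta> * k (\<eta> - z))" for z
    by (rule integrable_arc_bounded[where B=1])
       (use k h01 in \<open>auto simp: abs_mult intro!: mult_le_one\<close>)
  have nn_p: "(\<integral>\<^sup>+\<eta>. ennreal (p \<eta>) \<partial>circ) = 1"
    using nn_integral_eq_integral[OF int_p(1)] p0 int_p(2) by simp
  have u_eq: "u \<zeta> = (\<integral>\<eta>. h (\<zeta> * \<eta>) * p \<eta> \<partial>circ)" if \<zeta>: "norm \<zeta> = 1" for \<zeta>
  proof -
    have "(\<integral>\<eta>. h \<eta> * k (\<eta> - \<zeta>) \<partial>circ) = (\<integral>\<eta>. h (\<zeta> * \<eta>) * k (\<zeta> * \<eta> - \<zeta>) \<partial>circ)"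
      by (rule integral_arc_rotate[symmetric]) (use \<zeta> in auto)
    also have "\<dots> = (\<integral>\<eta>. c * (h (\<zeta> * \<eta>) * p \<eta>) \<partial>circ)"
    proof (rule Bochner_Integration.integral_cong[OF refl])
      fix \<eta>
      have "k (\<zeta> * \<eta> - \<zeta>) = k (\<eta> - 1)"
        using \<zeta> norm_mult[of \<zeta> "\<eta> - 1"] by (simp add: k_def algebra_simps)
      then show "h (\<zeta> * \<eta>) * k (\<zeta> * \<eta> - \<zeta>) = c * (h (\<zeta> * \<eta>) * p \<eta>)"
        using c0 by (simp add: p_def)
    qed
    finally show ?thesis using c0 by (simp add: u_def)
  qed
  have u_cont: "continuous_on UNIV u"
  proof -
    have "\<bar>u z - u w\<bar> \<le> (2 * pi / (\<delta> * c)) * norm (z - w)" for z w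
    proof -
      have "\<bar>\<integral>\<eta>. h \<eta> * k (\<eta> - z) - h \<eta> * k (\<eta> - w) \<partial>circ\<bar> \<le> 2 * pi * (norm (z - w) / \<delta>)"
        unfolding real_norm_def[symmetric]
      proof (rule norm_integral_arc_le)
        show "norm (h \<eta> * k (\<eta> - z) - h \<eta> * k (\<eta> - w)) \<le> norm (z - w) / \<delta>" for \<eta>
        proof -
          have "norm (h \<eta> * k (\<eta> - z) - h \<eta> * k (\<eta> - w)) = h \<eta> * \<bar>k (\<eta> - z) - k (\<eta> - w)\<bar>"
            using h01[of \<eta>] by (simp add: abs_mult flip: right_diff_distrib)
          also have "\<dots> \<le> 1 * (norm ((\<eta> - z) - (\<eta> - w)) / \<delta>)"
            using h01[of \<eta>] k_lip[of "\<eta> - z" "\<eta> - w"] by (intro mult_mono) auto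
          finally show ?thesis by (simp add: norm_minus_commute)
        qed
      qed measurable
      also have "(\<integral>\<eta>. h \<eta> * k (\<eta> - z) - h \<eta> * k (\<eta> - w) \<partial>circ) = c * (u z - u w)"
        using c0 by (subst Bochner_Integration.integral_diff) (auto intro!: int_hk simp: u_def right_diff_distrib)
      finally have "c * \<bar>u z - u w\<bar> \<le> 2 * pi * (norm (z - w) / \<delta>)"
        using c0 by (simp add: abs_mult)
      then show ?thesis
        using c0 \<delta> by (simp add: field_simps)
    qed
    then have "(2 * pi / (\<delta> * c))-lipschitz_on UNIV u"
      using c0 \<delta> by (intro lipschitz_onI) (auto simp: dist_norm)
    then show ?thesis by (rule lipschitz_on_continuous_on)
  qed
  then have [measurable]: "u \<in> borel_measurable borel"
    by (rule borel_measurable_continuous_onI)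
  have u_ge: "0 \<le> u \<zeta>" if "norm \<zeta> = 1" for \<zeta>
    unfolding u_eq[OF that] using h01 p0 by (intro Bochner_Integration.integral_nonneg) auto
  have u_le: "u \<zeta> \<le> 1" if "norm \<zeta> = 1" for \<zeta>
    unfolding u_eq[OF that] int_p(2)[symmetric] using h01 p0
    by (intro integral_mono int_hp int_p) (auto intro!: mult_left_le_one_le)
  \<comment> \<open>If the integrand is not integrable, the left-hand integral is 0 by
    default.\<close>
  have diff_le: "ennreal \<bar>\<integral>\<eta>. f \<eta> * p \<eta> \<partial>circ\<bar> \<le> (\<integral>\<^sup>+\<eta>. ennreal \<bar>f \<eta>\<bar> * ennreal (p \<eta>) \<partial>circ)" for f
  proof (cases "integrable circ (\<lambda>\<eta>. f \<eta> * p \<eta>)")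
    case True
    have "ennreal \<bar>\<integral>\<eta>. f \<eta> * p \<eta> \<partial>circ\<bar> \<le> (\<integral>\<^sup>+\<eta>. ennreal \<bar>f \<eta> * p \<eta>\<bar> \<partial>circ)"
      using integral_norm_bound_ennreal[OF True] by simp
    then show ?thesis using p0 by (simp add: abs_mult ennreal_mult)
  qed (simp add: not_integrable_integral_eq)
  have [measurable]: "ball (1::complex) \<delta> \<in> sets borel"
    by simp
  have u_L1: "(\<integral>\<^sup>+\<zeta>. ennreal \<bar>u \<zeta> - h \<zeta>\<bar> \<partial>circ) \<le> 4 * (\<integral>\<^sup>+\<xi>. osc_quot h \<xi> * indicator (ball 1 \<delta>) \<xi> \<partial>circ)"
  proof -
    have "(\<integral>\<^sup>+\<zeta>. ennreal \<bar>u \<zeta> - h \<zeta>\<bar> \<partial>circ) \<le> (\<integral>\<^sup>+\<zeta>. \<integral>\<^sup>+\<eta>. ennreal \<bar>h (\<eta> * \<zeta>) - h \<zeta>\<bar> * ennreal (p \<eta>) \<partial>circ \<partial>circ)"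
    proof (rule nn_integral_arc_mono)
      fix \<zeta> :: complex assume \<zeta>: "norm \<zeta> = 1"
      have "u \<zeta> - h \<zeta> = (\<integral>\<eta>. h (\<zeta> * \<eta>) * p \<eta> - h \<zeta> * p \<eta> \<partial>circ)"
        using int_p by (simp add: u_eq[OF \<zeta>] Bochner_Integration.integral_diff int_hp)
      then have "u \<zeta> - h \<zeta> = (\<integral>\<eta>. (h (\<zeta> * \<eta>) - h \<zeta>) * p \<eta> \<partial>circ)"
        by (simp add: left_diff_distrib)
      then show "ennreal \<bar>u \<zeta> - h \<zeta>\<bar> \<le> (\<integral>\<^sup>+\<eta>. ennreal \<bar>h (\<eta> * \<zeta>) - h \<zeta>\<bar> * ennreal (p \<eta>) \<partial>circ)"
        using diff_le[of "\<lambda>\<eta>. h (\<zeta> * \<eta>) - h \<zeta>"] by (simp add: mult.commute)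
    qed
    also have "\<dots> = (\<integral>\<^sup>+\<eta>. \<integral>\<^sup>+\<zeta>. ennreal \<bar>h (\<eta> * \<zeta>) - h \<zeta>\<bar> * ennreal (p \<eta>) \<partial>circ \<partial>circ)"
      by (rule arc_pair.Fubini') measurable
    also have "\<dots> = (\<integral>\<^sup>+\<eta>. osc h \<eta> * ennreal (p \<eta>) \<partial>circ)"
      unfolding osc_def by (subst nn_integral_multc) auto
    also have "\<dots> \<le> (\<integral>\<^sup>+\<xi>. 4 * (osc_quot h \<xi> * indicator (ball 1 \<delta>) \<xi>) \<partial>circ)"
    proof (rule nn_integral_mono)
      fix \<eta>
      show "osc h \<eta> * ennreal (p \<eta>) \<le> 4 * (osc_quot h \<eta> * indicator (ball 1 \<delta>) \<eta>)"
      proof (cases "\<eta> = 1 \<or> \<eta> \<notin> ball 1 \<delta>")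
        case True
        then show ?thesis using \<delta> by (auto simp: p_def k_def dist_norm norm_minus_commute field_simps)
      next
        case False
        then have *: "0 < norm (\<eta> - 1)" "norm (\<eta> - 1) < \<delta>" by (auto simp: dist_norm norm_minus_commute)
        have "p \<eta> \<le> 1 / (\<delta> / 4)"
          unfolding p_def using k c \<delta> by (intro frac_le) auto
        also have "\<dots> = 4 * (1 / \<delta>)"
          by simp
        also have "\<dots> \<le> 4 * (1 / norm (\<eta> - 1))"
          using * \<delta> by (intro mult_left_mono divide_left_mono) auto
        finally have "osc h \<eta> * ennreal (p \<eta>) \<le> osc h \<eta> * ennreal (4 * (1 / norm (\<eta> - 1)))"
          by (intro mult_left_mono ennreal_leI) auto
        also have "\<dots> = 4 * (osc_quot h \<eta>)"
          using * ennreal_mult[of 4 "1 / norm (\<eta> - 1)"]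
          by (simp add: divide_ennreal_def inverse_ennreal mult_ac inverse_eq_divide)
        finally show ?thesis using False by simp
      qed
    qed
    also have "\<dots> = 4 * (\<integral>\<^sup>+\<xi>. osc_quot h \<xi> * indicator (ball 1 \<delta>) \<xi> \<partial>circ)"
      by (rule nn_integral_cmult) simp
    finally show ?thesis .
  qed
  \<comment> \<open>Every rotated copy of \<open>h\<close> has the oscillation of \<open>h\<close>,
    so an average with total weight 1 cannot have more.\<close>
  have u_osc: "osc u \<xi> \<le> osc h \<xi>" if \<xi>: "norm \<xi> = 1" for \<xi>
  proof -
    have "osc u \<xi> \<le> (\<integral>\<^sup>+\<zeta>. \<integral>\<^sup>+\<eta>. ennreal \<bar>h (\<xi> * (\<eta> * \<zeta>)) - h (\<eta> * \<zeta>)\<bar> * ennreal (p \<eta>) \<partial>circ \<partial>circ)"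
      unfolding osc_def
    proof (rule nn_integral_arc_mono)
      fix \<zeta> :: complex assume \<zeta>: "norm \<zeta> = 1"
      have \<xi>\<zeta>: "norm (\<xi> * \<zeta>) = 1" using \<zeta> \<xi> by (simp add: norm_mult)
      have "u (\<xi> * \<zeta>) - u \<zeta> = (\<integral>\<eta>. h (\<xi> * \<zeta> * \<eta>) * p \<eta> - h (\<zeta> * \<eta>) * p \<eta> \<partial>circ)"
        by (simp add: u_eq[OF \<zeta>] u_eq[OF \<xi>\<zeta>] Bochner_Integration.integral_diff int_hp)
      then have "u (\<xi> * \<zeta>) - u \<zeta> = (\<integral>\<eta>. (h (\<xi> * \<zeta> * \<eta>) - h (\<zeta> * \<eta>)) * p \<eta> \<partial>circ)"
        by (simp add: left_diff_distrib)
      then show "ennreal (norm (u (\<xi> * \<zeta>) - u \<zeta>)) \<le> (\<integral>\<^sup>+\<eta>. ennreal \<bar>h (\<xi> * (\<eta> * \<zeta>)) - h (\<eta> * \<zeta>)\<bar> * ennreal (p \<eta>) \<partial>circ)"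
        using diff_le[of "\<lambda>\<eta>. h (\<xi> * \<zeta> * \<eta>) - h (\<zeta> * \<eta>)"] by (simp add: mult_ac)
    qed
    also have "\<dots> = (\<integral>\<^sup>+\<eta>. \<integral>\<^sup>+\<zeta>. ennreal \<bar>h (\<xi> * (\<eta> * \<zeta>)) - h (\<eta> * \<zeta>)\<bar> * ennreal (p \<eta>) \<partial>circ \<partial>circ)"
      by (rule arc_pair.Fubini') measurable
    also have "\<dots> = (\<integral>\<^sup>+\<eta>. osc h \<xi> * ennreal (p \<eta>) \<partial>circ)"
    proof (rule nn_integral_arc_cong)
      fix \<eta> :: complex assume \<eta>: "norm \<eta> = 1"
      show "(\<integral>\<^sup>+\<zeta>. ennreal \<bar>h (\<xi> * (\<eta> * \<zeta>)) - h (\<eta> * \<zeta>)\<bar> * ennreal (p \<eta>) \<partial>circ) = osc h \<xi> * ennreal (p \<eta>)"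
        using nn_integral_arc_rotate[OF _ \<eta>, of "\<lambda>\<zeta>. ennreal \<bar>h (\<xi> * \<zeta>) - h \<zeta>\<bar>"]
        by (simp add: nn_integral_multc osc_def)
    qed
    also have "\<dots> = osc h \<xi>"
      by (simp add: nn_integral_cmult nn_p)
    finally show ?thesis .
  qed
  show thesis
    by (rule that[OF u_cont u_ge u_le u_L1 u_osc])
qed

section \<open>Compact subsets with finite Dini integral\<close>

text \<open>Both summands are integrals of layers: 1_E (1 - u) is the integral over t in (0, 1) of
  the indicators of \<open>E - A t\<close>, and |u - 1_E| that of the symmetric differences. Keeping
  the sum in one estimate lets a single level t serve both.\<close>

lemma coarea_diff_superlevel:
  fixes u :: "complex \<Rightarrow> real"
  assumes [measurable]: "E \<in> sets borel" "u \<in> borel_measurable borel"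
    and E: "E \<subseteq> sphere 0 1" and u01: "\<And>\<zeta>. norm \<zeta> = 1 \<Longrightarrow> 0 \<le> u \<zeta>" "\<And>\<zeta>. norm \<zeta> = 1 \<Longrightarrow> u \<zeta> \<le> 1"
  defines "A \<equiv> \<lambda>t. {\<zeta> \<in> sphere 0 1. t \<le> u \<zeta>}"
  shows "(\<integral>\<^sup>+t\<in>{0<..<1}. (dini (indicat_real (E - A t)) + emeasure circ (sym_diff (A t) E)) \<partial>lborel)
    \<le> dini (\<lambda>\<zeta>. indicator E \<zeta> * (1 - u \<zeta>)) + (\<integral>\<^sup>+\<zeta>. ennreal \<bar>u \<zeta> - indicator E \<zeta>\<bar> \<partial>circ)"
proof -
  define v where "v \<zeta> = indicator E \<zeta> * (1 - u \<zeta>)" for \<zeta>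
  define b where "b t \<zeta> = (if \<zeta> \<in> E \<and> u \<zeta> < t then 1 else 0 :: real)" for t \<zeta>
  define a where "a t \<zeta> = (if (\<zeta> \<in> E \<and> u \<zeta> < t) \<or> (\<zeta> \<notin> E \<and> t \<le> u \<zeta>) then 1 else 0 :: ennreal)" for t \<zeta>
  have [measurable]: "v \<in> borel_measurable borel"
    unfolding v_def by measurable
  have sph [measurable]: "sphere (0::complex) 1 \<in> sets borel"
    by simp
  have [measurable]: "A t \<in> sets borel" for t
    unfolding A_def by measurable
  have [measurable]: "(\<lambda>x. b (f x) (g x)) \<in> borel_measurable M"
    "(\<lambda>x. a (f x) (g x)) \<in> borel_measurable M"
    if [measurable]: "f \<in> borel_measurable M" "g \<in> borel_measurable M" for f g and M :: "'x measure"
    unfolding a_def b_def by measurable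
  have interval_le: "(\<integral>\<^sup>+t\<in>{0<..<1}. f t \<partial>lborel) \<le> ennreal (r - l)"
    if "l \<le> r" "\<And>t. 0 < t \<Longrightarrow> t < 1 \<Longrightarrow> f t \<le> indicator {l..r} t" for f :: "real \<Rightarrow> ennreal" and l r
  proof -
    have "(\<integral>\<^sup>+t\<in>{0<..<1}. f t \<partial>lborel) \<le> (\<integral>\<^sup>+t. indicator {l..r} t \<partial>lborel)"
    proof (rule nn_integral_mono)
      fix t :: real
      show "f t * indicator {0<..<1} t \<le> indicator {l..r} t"
        using that(2)[of t] by (cases "t \<in> {0<..<1}") auto
    qed
    also have "\<dots> = ennreal (r - l)"
      using that(1) by simp
    finally show ?thesis .
  qed
  \<comment> \<open>The levels t that tell x from y form an interval: between u x and u y if both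
    points lie in \<open>E\<close>, and from u x up to 1 if only x does. Its length is |v x - v
    y|.\<close>
  have b_le: "(\<integral>\<^sup>+t\<in>{0<..<1}. ennreal (norm (b t x - b t y)) \<partial>lborel) \<le> ennreal (norm (v x - v y))"
    if "norm x = 1" "norm y = 1" for x y
  proof -
    note u01 = u01[OF that(1)] u01[OF that(2)]
    consider "x \<in> E" "y \<in> E" "u x \<le> u y" | "x \<in> E" "y \<in> E" "u y \<le> u x" | "x \<in> E" "y \<notin> E" | "x \<notin> E" "y \<in> E" | "x \<notin> E" "y \<notin> E"
      by linarith
    then show ?thesis
    proof cases
      case 1
      then have "norm (v x - v y) = u y - u x" by (simp add: v_def)
      with 1 u01 show ?thesis by (auto intro!: interval_le simp: b_def)
    next
      case 2
      then have "norm (v x - v y) = u x - u y" by (simp add: v_def)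
      with 2 u01 show ?thesis by (auto intro!: interval_le simp: b_def)
    next
      case 3
      then have "norm (v x - v y) = 1 - u x" using u01 by (simp add: v_def)
      with 3 u01 show ?thesis by (auto intro!: interval_le simp: b_def)
    next
      case 4
      then have "norm (v x - v y) = 1 - u y" using u01 by (simp add: v_def)
      with 4 u01 show ?thesis by (auto intro!: interval_le simp: b_def)
    qed (simp add: b_def)
  qed
  have a_le: "(\<integral>\<^sup>+t\<in>{0<..<1}. a t x \<partial>lborel) \<le> ennreal \<bar>u x - indicator E x\<bar>" if "norm x = 1" for x
  proof (cases "x \<in> E")
    case True
    then have "\<bar>u x - indicator E x\<bar> = 1 - u x" using u01[OF that] by simp
    with True u01[OF that] show ?thesis by (auto intro!: interval_le simp: a_def)
  next
    case False
    then have "\<bar>u x - indicator E x\<bar> = u x - 0" using u01[OF that] by simp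
    with False u01[OF that] interval_le[of 0 "u x" "\<lambda>t. a t x"] show ?thesis by (auto simp: a_def)
  qed
  have dini_eq: "dini (indicat_real (E - A t))
      = (\<integral>\<^sup>+\<xi>. (\<integral>\<^sup>+\<zeta>. ennreal (norm (b t (\<xi> * \<zeta>) - b t \<zeta>)) / ennreal (norm (\<xi> - 1)) \<partial>circ) \<partial>circ)" for t
    unfolding dini_def osc_def divide_ennreal_def
  proof (rule nn_integral_arc_cong)
    fix \<xi> :: complex assume \<xi>: "norm \<xi> = 1"
    have "(\<integral>\<^sup>+\<zeta>. ennreal (norm (indicator (E - A t) (\<xi> * \<zeta>) - indicator (E - A t) \<zeta> :: real)) \<partial>circ)
        = (\<integral>\<^sup>+\<zeta>. ennreal (norm (b t (\<xi> * \<zeta>) - b t \<zeta>)) \<partial>circ)"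
      using \<xi> by (intro nn_integral_arc_cong) (auto simp: b_def A_def indicator_def norm_mult)
    then show "(\<integral>\<^sup>+\<zeta>. ennreal (norm (indicator (E - A t) (\<xi> * \<zeta>) - indicator (E - A t) \<zeta> :: real)) \<partial>circ) * inverse (ennreal (norm (\<xi> - 1)))
        = (\<integral>\<^sup>+\<zeta>. ennreal (norm (b t (\<xi> * \<zeta>) - b t \<zeta>)) * inverse (ennreal (norm (\<xi> - 1))) \<partial>circ)"
      by (simp add: nn_integral_multc)
  qed
  have emeasure_eq: "emeasure circ (sym_diff (A t) E) = (\<integral>\<^sup>+\<zeta>. a t \<zeta> \<partial>circ)" for t
  proof -
    have "emeasure circ (sym_diff (A t) E) = (\<integral>\<^sup>+\<zeta>. indicator (sym_diff (A t) E) \<zeta> \<partial>circ)"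
      by simp
    also have "\<dots> = (\<integral>\<^sup>+\<zeta>. a t \<zeta> \<partial>circ)"
      using E by (intro nn_integral_arc_cong) (auto simp: a_def A_def indicator_def)
    finally show ?thesis .
  qed
  let ?b = "\<lambda>t \<xi> \<zeta>. ennreal (norm (b t (\<xi> * \<zeta>) - b t \<zeta>)) / ennreal (norm (\<xi> - 1)) * indicator {0<..<1} t"
  have "(\<integral>\<^sup>+t\<in>{0<..<1}. (dini (indicat_real (E - A t)) + emeasure circ (sym_diff (A t) E)) \<partial>lborel)
      = (\<integral>\<^sup>+t. (\<integral>\<^sup>+\<xi>. (\<integral>\<^sup>+\<zeta>. ?b t \<xi> \<zeta> \<partial>circ) \<partial>circ) \<partial>lborel)
      + (\<integral>\<^sup>+t. (\<integral>\<^sup>+\<zeta>. a t \<zeta> * indicator {0<..<1} t \<partial>circ) \<partial>lborel)"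
    unfolding dini_eq emeasure_eq
    by (subst nn_integral_add[symmetric], measurable) (simp add: nn_integral_multc distrib_right)
  also have "(\<integral>\<^sup>+t. (\<integral>\<^sup>+\<xi>. (\<integral>\<^sup>+\<zeta>. ?b t \<xi> \<zeta> \<partial>circ) \<partial>circ) \<partial>lborel)
      = (\<integral>\<^sup>+\<xi>. (\<integral>\<^sup>+t. (\<integral>\<^sup>+\<zeta>. ?b t \<xi> \<zeta> \<partial>circ) \<partial>lborel) \<partial>circ)"
    by (rule lborel_arc.Fubini'[symmetric]) measurable
  also have "\<dots> = (\<integral>\<^sup>+\<xi>. (\<integral>\<^sup>+\<zeta>. (\<integral>\<^sup>+t. ?b t \<xi> \<zeta> \<partial>lborel) \<partial>circ) \<partial>circ)"
    by (intro nn_integral_cong lborel_arc.Fubini'[symmetric]) measurable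
  also have "\<dots> \<le> (\<integral>\<^sup>+\<xi>. (\<integral>\<^sup>+\<zeta>. ennreal (norm (v (\<xi> * \<zeta>) - v \<zeta>)) * inverse (ennreal (norm (\<xi> - 1))) \<partial>circ) \<partial>circ)"
  proof (intro nn_integral_arc_mono)
    fix \<xi> \<zeta> :: complex assume *: "norm \<xi> = 1" "norm \<zeta> = 1"
    have "(\<integral>\<^sup>+t. ?b t \<xi> \<zeta> \<partial>lborel)
        = (\<integral>\<^sup>+t\<in>{0<..<1}. ennreal (norm (b t (\<xi> * \<zeta>) - b t \<zeta>)) \<partial>lborel) * inverse (ennreal (norm (\<xi> - 1)))"
      by (subst nn_integral_multc[symmetric]) (auto simp: divide_ennreal_def mult_ac)
    also have "\<dots> \<le> ennreal (norm (v (\<xi> * \<zeta>) - v \<zeta>)) * inverse (ennreal (norm (\<xi> - 1)))"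
      using * by (intro mult_right_mono b_le) (auto simp: norm_mult)
    finally show "(\<integral>\<^sup>+t. ?b t \<xi> \<zeta> \<partial>lborel)
        \<le> ennreal (norm (v (\<xi> * \<zeta>) - v \<zeta>)) * inverse (ennreal (norm (\<xi> - 1)))" .
  qed
  also have "\<dots> = dini v"
    unfolding dini_def osc_def divide_ennreal_def by (simp add: nn_integral_multc)
  also have "(\<integral>\<^sup>+t. (\<integral>\<^sup>+\<zeta>. a t \<zeta> * indicator {0<..<1} t \<partial>circ) \<partial>lborel)
      = (\<integral>\<^sup>+\<zeta>. (\<integral>\<^sup>+t. a t \<zeta> * indicator {0<..<1} t \<partial>lborel) \<partial>circ)"
    by (rule lborel_arc.Fubini'[symmetric]) measurable
  also have "\<dots> \<le> (\<integral>\<^sup>+\<zeta>. ennreal \<bar>u \<zeta> - indicator E \<zeta>\<bar> \<partial>circ)"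
    by (intro nn_integral_arc_mono a_le)
  finally show ?thesis
    unfolding v_def by simp
qed

text \<open>Mollifying at scale 1 / (n + 1) makes the L1 error a tail of a convergent integral. The
  Dini integrals of v = 1_E (1 - u) tend to 0 by dominated convergence: the oscillation of v is at
  most twice that of 1_E, and for each \<xi> it is bounded by a multiple of the L1 error.\<close>

lemma compact_approx_dini:
  assumes [measurable]: "E \<in> sets borel" and E: "E \<subseteq> sphere 0 1"
    and dini: "dini (indicat_real E) < \<infinity>" and "\<epsilon> > 0"
  obtains A where "compact A" "A \<subseteq> sphere 0 1"
    "dini (indicat_real (E - A)) + emeasure circ (sym_diff A E) \<le> \<epsilon>"
proof -
  define h where "h = (indicat_real E)"
  have [measurable]: "h \<in> borel_measurable borel"
    unfolding h_def by measurable
  define d where "d n = 1 / real (Suc n)" for n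
  have d: "0 < d n" "d n \<le> 1" for n
    by (auto simp: d_def)
  define tail where "tail n = (\<integral>\<^sup>+\<xi>. osc_quot h \<xi> * indicator (ball 1 (d n)) \<xi> \<partial>circ)" for n
  have "\<exists>u :: complex \<Rightarrow> real. continuous_on UNIV u \<and> (\<forall>\<zeta>. norm \<zeta> = 1 \<longrightarrow> 0 \<le> u \<zeta>) \<and> (\<forall>\<zeta>. norm \<zeta> = 1 \<longrightarrow> u \<zeta> \<le> 1) \<and>
    (\<integral>\<^sup>+\<zeta>. ennreal \<bar>u \<zeta> - h \<zeta>\<bar> \<partial>circ) \<le> 4 * tail n \<and> (\<forall>\<xi>. norm \<xi> = 1 \<longrightarrow> osc u \<xi> \<le> osc h \<xi>)" for n
    unfolding h_def tail_def by (rule mollify_indicator[OF assms(1) d]) blast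
  then obtain u :: "nat \<Rightarrow> complex \<Rightarrow> real" where u: "\<And>n. continuous_on UNIV (u n)"
    "\<And>n \<zeta>. norm \<zeta> = 1 \<Longrightarrow> 0 \<le> u n \<zeta>" "\<And>n \<zeta>. norm \<zeta> = 1 \<Longrightarrow> u n \<zeta> \<le> 1"
    "\<And>n. (\<integral>\<^sup>+\<zeta>. ennreal \<bar>u n \<zeta> - h \<zeta>\<bar> \<partial>circ) \<le> 4 * tail n"
    "\<And>n \<xi>. norm \<xi> = 1 \<Longrightarrow> osc (u n) \<xi> \<le> osc h \<xi>"
    by metis
  have [measurable]: "u n \<in> borel_measurable borel" for n
    by (rule borel_measurable_continuous_onI[OF u(1)])
  have [measurable]: "ball (1::complex) r \<in> sets borel" for r
    by simp
  have "tail \<longlonglongrightarrow> (\<integral>\<^sup>+\<xi>. 0 \<partial>circ)"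
    unfolding tail_def
  proof (rule nn_integral_dominated_convergence[where w="\<lambda>\<xi>. osc_quot h \<xi>"])
    show "AE \<xi> in circ. (\<lambda>n. osc_quot h \<xi> * indicator (ball 1 (d n)) \<xi>) \<longlonglongrightarrow> 0"
    proof (rule AE_I2)
      fix \<xi> :: complex
      show "(\<lambda>n. osc_quot h \<xi> * indicator (ball 1 (d n)) \<xi>) \<longlonglongrightarrow> 0"
      proof (cases "\<xi> = 1")
        case False
        have "d \<longlonglongrightarrow> 0"
          unfolding d_def using LIMSEQ_inverse_real_of_nat by (simp add: inverse_eq_divide)
        then have "eventually (\<lambda>n. d n < norm (\<xi> - 1)) sequentially"
          using False by (intro order_tendstoD) auto
        then have "eventually (\<lambda>n. osc_quot h \<xi> * indicator (ball 1 (d n)) \<xi> = 0) sequentially"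
          by eventually_elim (auto simp: dist_norm norm_minus_commute)
        then show ?thesis by (rule tendsto_eventually)
      qed simp
    qed
  qed (use dini in \<open>auto simp: dini_def h_def indicator_def\<close>)
  then have tail: "tail \<longlonglongrightarrow> 0" by simp
  then have tail4: "(\<lambda>n. 4 * tail n) \<longlonglongrightarrow> 0"
    using ennreal_tendsto_cmult[of 4 tail 0] by simp
  define v where "v n \<zeta> = h \<zeta> * (1 - u n \<zeta>)" for n \<zeta>
  have [measurable]: "v n \<in> borel_measurable borel" for n
    unfolding v_def by measurable
  \<comment> \<open>Both \<open>h\<close> and 1 - u take values in [0, 1], so the product varies by
    at most the sum of the variations; mollifying has not increased that of u beyond that of
    \<open>h\<close>.\<close>
  have osc_v: "osc (v n) \<xi> \<le> osc h \<xi> + osc h \<xi>" if \<xi>: "norm \<xi> = 1" for n \<xi>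
  proof -
    have "osc (v n) \<xi> \<le> osc h \<xi> + osc (u n) \<xi>"
    proof (rule osc_add_le[OF _ _ \<xi>])
      fix x y :: complex assume *: "norm x = 1" "norm y = 1"
      then show "norm (v n x - v n y) \<le> norm (h x - h y) + norm (u n x - u n y)"
        using u(2,3)[OF *(1), of n] u(2,3)[OF *(2), of n] by (auto simp: v_def h_def indicator_def)
    qed measurable
    also have "\<dots> \<le> osc h \<xi> + osc h \<xi>"
      by (intro add_left_mono u(5) \<xi>)
    finally show ?thesis .
  qed
  \<comment> \<open>On \<open>E\<close> the value of v is |u - h|, and off \<open>E\<close> it is 0,
    so v is dominated by the mollification error.\<close>
  have osc_v': "osc (v n) \<xi> \<le> 2 * (4 * tail n)" if \<xi>: "norm \<xi> = 1" for n \<xi>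
  proof -
    have "osc (v n) \<xi> \<le> 2 * (\<integral>\<^sup>+\<zeta>. ennreal (norm (v n \<zeta>)) \<partial>circ)"
      by (rule osc_le_norm[OF _ \<xi>]) simp
    also have "\<dots> \<le> 2 * (\<integral>\<^sup>+\<zeta>. ennreal \<bar>u n \<zeta> - h \<zeta>\<bar> \<partial>circ)"
      by (intro mult_left_mono nn_integral_arc_mono ennreal_leI)
         (auto simp: v_def h_def indicator_def)
    also have "\<dots> \<le> 2 * (4 * tail n)"
      by (intro mult_left_mono u) auto
    finally show ?thesis .
  qed
  have "(\<lambda>n. dini (v n)) \<longlonglongrightarrow> (\<integral>\<^sup>+\<xi>. 0 \<partial>circ)"
    unfolding dini_def
  proof (rule nn_integral_dominated_convergence[where w="\<lambda>\<xi>. 2 * (osc_quot h \<xi>)"])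
    show "AE \<xi> in circ. osc_quot (v n) \<xi> \<le> 2 * (osc_quot h \<xi>)" for n
      using AE_arc_norm
    proof eventually_elim
      case (elim \<xi>)
      then show ?case
        using mult_right_mono[OF osc_v[of \<xi> n], of "inverse (ennreal (norm (\<xi> - 1)))"]
        by (simp add: divide_ennreal_def mult_2 distrib_right)
    qed
    show "(\<integral>\<^sup>+\<xi>. 2 * (osc_quot h \<xi>) \<partial>circ) < \<infinity>"
      using dini by (subst nn_integral_cmult) (auto simp: dini_def h_def ennreal_mult_less_top)
    show "AE \<xi> in circ. (\<lambda>n. osc_quot (v n) \<xi>) \<longlonglongrightarrow> 0"
      using AE_arc_norm
    proof eventually_elim
      case (elim \<xi>)
      show ?case
      proof (cases "\<xi> = 1")
        case False
        have "(\<lambda>n. inverse (ennreal (norm (\<xi> - 1))) * (2 * (4 * tail n))) \<longlonglongrightarrow> inverse (ennreal (norm (\<xi> - 1))) * (2 * 0)"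
          using False tail4 by (intro ennreal_tendsto_cmult) (auto simp: inverse_ennreal)
        then have "(\<lambda>n. inverse (ennreal (norm (\<xi> - 1))) * (2 * (4 * tail n))) \<longlonglongrightarrow> 0"
          by simp
        then show ?thesis
        proof (rule tendsto_sandwich[OF _ _ tendsto_const, rotated 2])
          show "eventually (\<lambda>n. osc_quot (v n) \<xi> \<le> inverse (ennreal (norm (\<xi> - 1))) * (2 * (4 * tail n))) sequentially"
            unfolding divide_ennreal_def
            by (subst mult.commute) (intro always_eventually allI mult_left_mono osc_v' elim, simp)
        qed simp
      qed simp
    qed
  qed simp_all
  then have dini_v: "(\<lambda>n. dini (v n)) \<longlonglongrightarrow> 0" by simp
  have "(\<lambda>n. dini (v n) + 4 * tail n) \<longlonglongrightarrow> 0 + 0"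
    by (intro tendsto_add dini_v tail4)
  then have "eventually (\<lambda>n. dini (v n) + 4 * tail n < \<epsilon>) sequentially"
    using \<open>\<epsilon> > 0\<close> by (intro order_tendstoD) auto
  then obtain n where n: "dini (v n) + 4 * tail n < \<epsilon>"
    by (auto simp: eventually_sequentially)
  define A where "A t = {\<zeta> \<in> sphere 0 1. t \<le> u n \<zeta>}" for t
  let ?F = "\<lambda>t. dini (indicat_real (E - A t)) + emeasure circ (sym_diff (A t) E)"
  have small: "(\<integral>\<^sup>+t\<in>{0<..<1}. ?F t \<partial>lborel) < \<epsilon>"
  proof -
    have "(\<integral>\<^sup>+t\<in>{0<..<1}. ?F t \<partial>lborel) \<le> dini (v n) + (\<integral>\<^sup>+\<zeta>. ennreal \<bar>u n \<zeta> - h \<zeta>\<bar> \<partial>circ)"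
      unfolding A_def v_def h_def by (rule coarea_diff_superlevel) (use E u in auto)
    also have "\<dots> \<le> dini (v n) + 4 * tail n"
      by (intro add_left_mono u)
    finally show ?thesis using n by simp
  qed
  \<comment> \<open>The interval of levels has length 1, so some level does not exceed the bound on
    the mean.\<close>
  have "\<exists>t\<in>{0<..<1}. ?F t \<le> \<epsilon>"
  proof (rule ccontr)
    assume "\<not> ?thesis"
    then have "\<epsilon> \<le> ?F t" if "t \<in> {0<..<1}" for t
      using that by (meson le_cases)
    then have "(\<integral>\<^sup>+t\<in>{0<..<1::real}. \<epsilon> \<partial>lborel) \<le> (\<integral>\<^sup>+t\<in>{0<..<1}. ?F t \<partial>lborel)"
      by (intro nn_integral_mono) (simp split: split_indicator)
    also have "(\<integral>\<^sup>+t\<in>{0<..<1::real}. \<epsilon> \<partial>lborel) = \<epsilon>"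
      by (subst nn_integral_cmult_indicator) auto
    finally show False using small by simp
  qed
  then obtain t where t: "?F t \<le> \<epsilon>" by blast
  have "closed (A t)"
    unfolding A_def Collect_conj_eq using u(1)[of n]
    by (intro closed_Int closed_Collect_le continuous_intros) (auto simp: sphere_def intro!: closed_Collect_eq continuous_intros)
  moreover have "bounded (A t)"
    by (rule bounded_subset[OF bounded_sphere[of 0 1]]) (auto simp: A_def)
  ultimately have "compact (A t)"
    by (simp add: compact_eq_bounded_closed)
  then show thesis
    using t by (intro that[of "A t"]) (auto simp: A_def)
qed

text \<open>Intersecting approximants with errors e k makes \<open>K - E\<close> null, as it sits in
  each \<open>A k - E\<close>, while \<open>E - K\<close> is the union of the sets
  \<open>E - A k\<close>, whose lengths and Dini integrals are summable. Up to a null set 1_K is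
  then 1_E minus the indicator of \<open>E - K\<close>.\<close>

lemma compact_almost_subset_dini:
  assumes [measurable]: "E \<in> sets borel" and E: "E \<subseteq> sphere 0 1"
    and dini: "dini (indicat_real E) < \<infinity>" and "\<epsilon> > 0"
  obtains K where "compact K" "K \<subseteq> sphere 0 1" "emeasure circ (K - E) = 0" "emeasure circ (E - K) \<le> ennreal \<epsilon>"
    "dini (indicat_real K) < \<infinity>"
proof -
  define e where "e k = \<epsilon> * (1/2) ^ Suc k" for k
  have e: "e k > 0" for k using \<open>\<epsilon> > 0\<close> by (simp add: e_def)
  have "e sums (\<epsilon> * 1)"
    unfolding e_def by (intro sums_mult power_half_series)
  then have e_sum: "(\<Sum>k. ennreal (e k)) = ennreal \<epsilon>"
    using e by (subst suminf_ennreal_eq) (auto intro: less_imp_le)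
  have e_lim: "(\<lambda>k. ennreal (e k)) \<longlonglongrightarrow> 0"
    using summable_LIMSEQ_zero[OF sums_summable[OF \<open>e sums (\<epsilon> * 1)\<close>]] tendsto_ennrealI by fastforce
  have "\<exists>A. compact A \<and> A \<subseteq> sphere 0 1 \<and>
    dini (indicat_real (E - A)) + emeasure circ (sym_diff A E) \<le> ennreal (e k)" for k
    by (rule compact_approx_dini[OF assms(1) E dini, of "ennreal (e k)"]) (use e in auto)
  then obtain A where A: "\<And>k. compact (A k)" "\<And>k. A k \<subseteq> sphere 0 1"
    "\<And>k. dini (indicat_real (E - A k)) + emeasure circ (sym_diff (A k) E) \<le> ennreal (e k)"
    by metis
  have [measurable]: "A k \<in> sets borel" for k
    using A(1) by (simp add: borel_compact)
  have A_dini: "dini (indicat_real (E - A k)) \<le> ennreal (e k)" for k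
    using A(3)[of k] by (rule order_trans[rotated]) simp
  have A_diff: "emeasure circ (sym_diff (A k) E) \<le> ennreal (e k)" for k
    using A(3)[of k] by (rule order_trans[rotated]) simp
  define K where "K = (\<Inter>k. A k)"
  have [measurable]: "K \<in> sets borel" unfolding K_def by measurable
  have E_K_eq: "E - K = (\<Union>k. E - A k)" by (auto simp: K_def)
  have "compact K" unfolding K_def using A(1) by (intro compact_Inter) auto
  moreover have "K \<subseteq> sphere 0 1" using A(2) by (auto simp: K_def)
  moreover have K_E: "emeasure circ (K - E) = 0"
  proof -
    have "emeasure circ (K - E) \<le> ennreal (e k)" for k
      using A_diff[of k] by (rule order_trans[rotated]) (auto intro!: emeasure_mono simp: K_def)
    then have "emeasure circ (K - E) \<le> 0"
      by (intro tendsto_lowerbound[OF e_lim]) auto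
    then show ?thesis by simp
  qed
  moreover have "emeasure circ (E - K) \<le> ennreal \<epsilon>"
  proof -
    have "emeasure circ (E - K) \<le> (\<Sum>k. emeasure circ (E - A k))"
      unfolding E_K_eq by (rule emeasure_subadditive_countably) auto
    also have "\<dots> \<le> (\<Sum>k. ennreal (e k))"
      using A_diff by (intro suminf_le order_trans[OF _ A_diff] emeasure_mono) auto
    finally show ?thesis by (simp add: e_sum)
  qed
  moreover have "dini (indicat_real K) < \<infinity>"
  proof -
    have "dini (indicat_real (E - K)) \<le> (\<Sum>k. dini (indicat_real (E - A k)))"
      unfolding E_K_eq by (rule dini_indicator_UN_le) auto
    also have "\<dots> \<le> (\<Sum>k. ennreal (e k))"
      by (intro suminf_le A_dini) auto
    finally have fin: "dini (indicat_real (E - K)) < \<infinity>"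
      by (simp add: e_sum le_less_trans)
    \<comment> \<open>\<open>K\<close> is split into \<open>E \<inter> K\<close> and
      \<open>K - E\<close>; the second part is null and has zero oscillation.\<close>
    have "dini (indicat_real K) \<le> dini (indicat_real E) + dini (indicat_real (E - K))"
    proof (rule dini_add_le)
      fix \<xi> :: complex assume \<xi>: "norm \<xi> = 1"
      have "osc (indicat_real (E \<inter> K)) \<xi> \<le> osc (indicat_real E) \<xi> + osc (indicat_real (E - K)) \<xi>"
        by (rule osc_add_le[OF _ _ \<xi>]) (auto simp: indicator_def)
      moreover have "osc (indicat_real K) \<xi> \<le> osc (indicat_real (E \<inter> K)) \<xi> + osc (indicat_real (K - E)) \<xi>"
        by (rule osc_add_le[OF _ _ \<xi>]) (auto simp: indicator_def)
      moreover have "osc (indicat_real (K - E)) \<xi> = 0"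
      proof -
        have "(\<integral>\<^sup>+\<zeta>. ennreal (norm (indicator (K - E) \<zeta> :: real)) \<partial>circ) = 0"
          using K_E by (simp add: ennreal_indicator)
        then show ?thesis
          using osc_le_norm[OF _ \<xi>, of "indicat_real (K - E)"] by simp
      qed
      ultimately show "osc (indicat_real K) \<xi> \<le> osc (indicat_real E) \<xi> + osc (indicat_real (E - K)) \<xi>"
        by simp
    qed auto
    also have "\<dots> < \<infinity>"
      using dini fin by (simp add: less_top[symmetric] ennreal_add_eq_top)
    finally show ?thesis .
  qed
  ultimately show thesis by (rule that)
qed

section \<open>The Cauchy kernel\<close>

lemma has_vector_derivative_cis: "(cis has_vector_derivative \<i> * cis t) (at t within S)"
proof -
  have "((\<lambda>t. of_real (cos t) + \<i> * of_real (sin t)) has_vector_derivative of_real (- sin t) + \<i> * of_real (cos t)) (at t within S)"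
    by (auto intro!: derivative_eq_intros has_vector_derivative_of_real simp: has_real_derivative_iff_has_vector_derivative[symmetric])
  moreover have "(\<lambda>t. of_real (cos t) + \<i> * of_real (sin t)) = cis"
    by (auto simp: complex_eq_iff)
  moreover have "of_real (- sin t) + \<i> * of_real (cos t) = \<i> * cis t"
    by (auto simp: complex_eq_iff)
  ultimately show ?thesis by simp
qed

lemma Arg2pi_cis: "0 \<le> a \<Longrightarrow> a < 2 * pi \<Longrightarrow> Arg2pi (cis a) = a"
  by (rule Arg2pi_unique[of 1]) (auto simp: cis_conv_exp)

lemma norm_cauchy_kernel_le:
  fixes \<eta> z :: complex
  assumes "norm \<eta> = 1" "norm z \<noteq> 1"
  shows "norm (\<eta> / (\<eta> - z)\<^sup>2) \<le> 1 / (norm z - 1)\<^sup>2"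
proof -
  have "\<bar>norm z - 1\<bar> \<le> norm (\<eta> - z)"
    using norm_triangle_ineq3[of z \<eta>] assms(1) by (simp add: norm_minus_commute)
  then have "(norm z - 1)\<^sup>2 \<le> (norm (\<eta> - z))\<^sup>2"
    using power_mono[of "\<bar>norm z - 1\<bar>" _ 2] by simp
  moreover have "norm (\<eta> / (\<eta> - z)\<^sup>2) = 1 / (norm (\<eta> - z))\<^sup>2"
    using assms(1) by (simp add: norm_divide norm_power)
  ultimately show ?thesis
    using assms(2) by (simp add: frac_le)
qed

text \<open>Along the circle the integrand has the 2 pi-periodic primitive \<i> / (cis \<theta> -
  z). This works for z inside and outside alike.\<close>

lemma integral_cauchy_kernel:
  fixes z :: complex
  assumes z: "norm z \<noteq> 1"
  shows "(\<integral>\<eta>. \<eta> / (\<eta> - z)\<^sup>2 \<partial>circ) = 0"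
proof (rule has_integral_arc)
  show "norm (\<eta> / (\<eta> - z)\<^sup>2) \<le> 1 / (norm z - 1)\<^sup>2" if "norm \<eta> = 1" for \<eta>
    by (rule norm_cauchy_kernel_le[OF that z])
  have nz: "cis t \<noteq> z" for t
    using z by auto
  have "((\<lambda>\<theta>. cis \<theta> / (cis \<theta> - z)\<^sup>2) has_integral
      ((\<lambda>w. \<i> / (w - z)) \<circ> cis) (2*pi) - ((\<lambda>w. \<i> / (w - z)) \<circ> cis) 0) {0..2*pi}"
  proof (rule fundamental_theorem_of_calculus)
    fix t :: real
    have "((\<lambda>w. \<i> / (w - z)) has_field_derivative - \<i> / (cis t - z)\<^sup>2) (at (cis t))"
      using nz[of t] by (auto intro!: derivative_eq_intros simp: power2_eq_square)
    from field_vector_diff_chain_at[OF has_vector_derivative_cis this]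
    have "((\<lambda>w. \<i> / (w - z)) \<circ> cis has_vector_derivative (\<i> * cis t * (- \<i> / (cis t - z)\<^sup>2))) (at t)" .
    moreover have "\<i> * c * (- \<i> / d) = - (\<i> * \<i>) * (c / d)" for c d
      by (simp only: divide_inverse mult_minus_left mult_minus_right mult_ac)
    ultimately have "((\<lambda>w. \<i> / (w - z)) \<circ> cis has_vector_derivative cis t / (cis t - z)\<^sup>2) (at t)"
      by (simp only:) simp
    then show "((\<lambda>w. \<i> / (w - z)) \<circ> cis has_vector_derivative cis t / (cis t - z)\<^sup>2) (at t within {0..2*pi})"
      by (auto intro: has_vector_derivative_at_within)
  qed simp
  then show "((\<lambda>\<theta>. cis \<theta> / (cis \<theta> - z)\<^sup>2) has_integral 0) {0..2*pi}"
    by simp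
qed measurable

text \<open>Since |\<xi> - 1| \<le> |\<xi> - s| + |s - 1| and |s - 1| \<le> |\<xi> - s|, the
  distance |\<xi> - s| dominates both |s - 1| and a = |\<xi> - 1| / 2. Its square therefore
  dominates the mean of their squares, and the resulting integrand has the primitive (2 / a) arctan
  ((s - 1) / a), whose increments stay below 2 pi / a. The range [0, 2] treats both sides of the
  circle at once.\<close>

lemma nn_integral_kernel_le:
  fixes \<xi> :: complex
  assumes \<xi>: "norm \<xi> = 1" "\<xi> \<noteq> 1"
  shows "(\<integral>\<^sup>+s\<in>{0..2}. ennreal (1 / (norm (\<xi> - of_real s))\<^sup>2) \<partial>lborel) \<le> ennreal (4 * pi / norm (\<xi> - 1))"
proof -
  define a where "a = norm (\<xi> - 1) / 2"
  have a: "a > 0" using \<xi> by (simp add: a_def)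
  have "(\<integral>\<^sup>+s\<in>{0..2}. ennreal (1 / (norm (\<xi> - of_real s))\<^sup>2) \<partial>lborel)
      \<le> (\<integral>\<^sup>+s. ennreal (2 / ((s - 1)\<^sup>2 + a\<^sup>2)) * indicator {0..2} s \<partial>lborel)"
  proof (rule nn_integral_mono)
    fix s :: real
    have "1 / (norm (\<xi> - of_real s))\<^sup>2 \<le> 2 / ((s - 1)\<^sup>2 + a\<^sup>2)" if s: "0 \<le> s"
    proof -
      have 1: "\<bar>s - 1\<bar> \<le> norm (\<xi> - of_real s)"
        using norm_triangle_ineq3[of "of_real s" \<xi>] \<xi>(1) s by (simp add: norm_minus_commute)
      have "norm (\<xi> - 1) \<le> norm (\<xi> - of_real s) + norm (of_real s - 1 :: complex)"
        using norm_triangle_ineq[of "\<xi> - of_real s" "of_real s - 1"] by simp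
      also have "norm (of_real s - 1 :: complex) = \<bar>s - 1\<bar>"
        by (metis norm_of_real of_real_1 of_real_diff)
      finally have 2: "a \<le> norm (\<xi> - of_real s)" using 1 by (simp add: a_def)
      have "(s - 1)\<^sup>2 \<le> (norm (\<xi> - of_real s))\<^sup>2" "a\<^sup>2 \<le> (norm (\<xi> - of_real s))\<^sup>2"
        using power_mono[OF 1, of 2] power_mono[OF 2, of 2] a by auto
      then have "((s - 1)\<^sup>2 + a\<^sup>2) / 2 \<le> (norm (\<xi> - of_real s))\<^sup>2" by simp
      moreover have "0 < ((s - 1)\<^sup>2 + a\<^sup>2) / 2"
        using a by (simp add: add_nonneg_pos)
      ultimately have "1 / (norm (\<xi> - of_real s))\<^sup>2 \<le> 1 / (((s - 1)\<^sup>2 + a\<^sup>2) / 2)"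
        by (intro frac_le) auto
      then show ?thesis by simp
    qed
    then show "ennreal (1 / (norm (\<xi> - of_real s))\<^sup>2) * indicator {0..2} s
        \<le> ennreal (2 / ((s - 1)\<^sup>2 + a\<^sup>2)) * indicator {0..2} s"
      by (auto split: split_indicator intro!: ennreal_leI)
  qed
  also have "\<dots> = ennreal (2 / a * arctan ((2 - 1) / a) - 2 / a * arctan ((0 - 1) / a))"
  proof (rule nn_integral_FTC_Icc)
    fix s :: real
    have *: "(s - 1)\<^sup>2 + a\<^sup>2 > 0" using a by (simp add: add_nonneg_pos)
    have "((\<lambda>s. 2 / a * arctan ((s - 1) / a)) has_real_derivative 2 / a * (inverse (1 + ((s - 1) / a)\<^sup>2) * (1 / a))) (at s)"
      using a by (auto intro!: derivative_eq_intros)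
    also have "2 / a * (inverse (1 + ((s - 1) / a)\<^sup>2) * (1 / a)) = 2 / ((s - 1)\<^sup>2 + a\<^sup>2)"
    proof -
      have "1 + ((s - 1) / a)\<^sup>2 = ((s - 1)\<^sup>2 + a\<^sup>2) / a\<^sup>2"
        using a by (simp add: power_divide add_divide_distrib)
      then show ?thesis using a by (simp add: power2_eq_square)
    qed
    finally show "((\<lambda>s. 2 / a * arctan ((s - 1) / a)) has_real_derivative 2 / ((s - 1)\<^sup>2 + a\<^sup>2)) (at s)" .
    show "0 \<le> 2 / ((s - 1)\<^sup>2 + a\<^sup>2)" using * by simp
  qed simp_all
  also have "\<dots> \<le> ennreal (4 * pi / norm (\<xi> - 1))"
  proof (rule ennreal_leI)
    have "2 / a * arctan ((2 - 1) / a) - 2 / a * arctan ((0 - 1) / a) = 2 / a * (arctan (1 / a) - arctan (- 1 / a))"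
      by (simp add: right_diff_distrib)
    also have "\<dots> \<le> 2 / a * pi"
      using a arctan_ubound[of "1 / a"] arctan_lbound[of "- 1 / a"] by (intro mult_left_mono) auto
    also have "\<dots> = 4 * pi / norm (\<xi> - 1)" by (simp add: a_def)
    finally show "2 / a * arctan ((2 - 1) / a) - 2 / a * arctan ((0 - 1) / a) \<le> 4 * pi / norm (\<xi> - 1)" .
  qed
  finally show ?thesis .
qed

text \<open>Rotating by \<zeta> extracts a factor of modulus 1 and leaves a kernel depending on s
  alone. Its mean is zero, so the constant v \<zeta> may be subtracted, and differences of v
  appear.\<close>

lemma cauchy_derivative_rotate:
  fixes v :: "complex \<Rightarrow> complex"
  assumes v[measurable]: "v \<in> borel_measurable borel" and B: "\<And>\<zeta>. norm \<zeta> = 1 \<Longrightarrow> norm (v \<zeta>) \<le> B"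
    and s: "0 \<le> s" "s \<noteq> 1" and \<zeta>: "norm \<zeta> = 1"
  shows "ennreal (norm (\<integral>\<eta>. v \<eta> * (\<eta> / (\<eta> - of_real s * \<zeta>)\<^sup>2) \<partial>circ))
    \<le> (\<integral>\<^sup>+\<xi>. ennreal (norm (v (\<xi> * \<zeta>) - v \<zeta>)) * ennreal (1 / (norm (\<xi> - of_real s))\<^sup>2) \<partial>circ)"
proof -
  have \<zeta>0: "\<zeta> \<noteq> 0" using \<zeta> by auto
  have B0: "B \<ge> 0" using B[OF \<zeta>] norm_ge_zero order_trans by blast
  have s': "norm (complex_of_real s) \<noteq> 1" using s by auto
  define k where "k \<xi> = \<xi> / (\<xi> - complex_of_real s)\<^sup>2" for \<xi>
  have [measurable]: "k \<in> borel_measurable borel"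
    unfolding k_def by measurable
  have k: "norm (k \<xi>) \<le> 1 / (norm (complex_of_real s) - 1)\<^sup>2" if "norm \<xi> = 1" for \<xi>
    unfolding k_def by (rule norm_cauchy_kernel_le[OF that s'])
  have int: "integrable circ k" "integrable circ (\<lambda>\<xi>. v (\<zeta> * \<xi>) * k \<xi>)"
  proof -
    show "integrable circ k"
      by (rule integrable_arc_bounded[OF _ k]) auto
    show "integrable circ (\<lambda>\<xi>. v (\<zeta> * \<xi>) * k \<xi>)"
    proof (rule integrable_arc_bounded)
      fix \<xi> :: complex assume \<xi>: "norm \<xi> = 1"
      show "norm (v (\<zeta> * \<xi>) * k \<xi>) \<le> B * (1 / (norm (complex_of_real s) - 1)\<^sup>2)"
        unfolding norm_mult using \<zeta> \<xi>
        by (intro mult_mono B k B0) (auto simp: norm_mult)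
    qed simp
  qed
  have "(\<integral>\<eta>. v \<eta> * (\<eta> / (\<eta> - of_real s * \<zeta>)\<^sup>2) \<partial>circ)
      = (\<integral>\<xi>. v (\<zeta> * \<xi>) * (\<zeta> * \<xi> / (\<zeta> * \<xi> - of_real s * \<zeta>)\<^sup>2) \<partial>circ)"
    by (rule integral_arc_rotate[symmetric]) (use \<zeta> in auto)
  also have "\<dots> = (\<integral>\<xi>. inverse \<zeta> * (v (\<zeta> * \<xi>) * k \<xi>) \<partial>circ)"
  proof (rule Bochner_Integration.integral_cong[OF refl])
    fix \<xi>
    have "(\<zeta> * \<xi> - of_real s * \<zeta>)\<^sup>2 = \<zeta>\<^sup>2 * (\<xi> - of_real s)\<^sup>2"
      by (simp add: algebra_simps flip: power_mult_distrib)
    then show "v (\<zeta> * \<xi>) * (\<zeta> * \<xi> / (\<zeta> * \<xi> - of_real s * \<zeta>)\<^sup>2) = inverse \<zeta> * (v (\<zeta> * \<xi>) * k \<xi>)"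
      using \<zeta>0 by (simp add: power2_eq_square divide_simps k_def)
  qed
  also have "\<dots> = inverse \<zeta> * (\<integral>\<xi>. v (\<zeta> * \<xi>) * k \<xi> \<partial>circ)"
    by simp
  also have "(\<integral>\<xi>. v (\<zeta> * \<xi>) * k \<xi> \<partial>circ) = (\<integral>\<xi>. v (\<zeta> * \<xi>) * k \<xi> - v \<zeta> * k \<xi> \<partial>circ)"
    using int integral_cauchy_kernel[OF s'] by (subst Bochner_Integration.integral_diff) (auto simp flip: k_def)
  also have "\<dots> = (\<integral>\<xi>. (v (\<xi> * \<zeta>) - v \<zeta>) * k \<xi> \<partial>circ)"
    by (simp add: left_diff_distrib mult.commute[of _ \<zeta>])
  finally have eq: "norm (\<integral>\<eta>. v \<eta> * (\<eta> / (\<eta> - of_real s * \<zeta>)\<^sup>2) \<partial>circ)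
      = norm (\<integral>\<xi>. (v (\<xi> * \<zeta>) - v \<zeta>) * k \<xi> \<partial>circ)"
    using \<zeta> by (simp add: norm_mult norm_inverse)
  have "integrable circ (\<lambda>\<xi>. (v (\<xi> * \<zeta>) - v \<zeta>) * k \<xi>)"
    using Bochner_Integration.integrable_diff[OF int(2) integrable_mult_right[OF int(1), of "v \<zeta>"]]
    by (simp add: left_diff_distrib mult.commute[of _ \<zeta>])
  from integral_norm_bound_ennreal[OF this]
  have "ennreal (norm (\<integral>\<xi>. (v (\<xi> * \<zeta>) - v \<zeta>) * k \<xi> \<partial>circ))
      \<le> (\<integral>\<^sup>+\<xi>. ennreal (norm ((v (\<xi> * \<zeta>) - v \<zeta>) * k \<xi>)) \<partial>circ)" .
  also have "\<dots> = (\<integral>\<^sup>+\<xi>. ennreal (norm (v (\<xi> * \<zeta>) - v \<zeta>)) * ennreal (1 / (norm (\<xi> - of_real s))\<^sup>2) \<partial>circ)"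
    unfolding k_def
    by (rule nn_integral_arc_cong) (simp add: norm_mult norm_divide norm_power flip: ennreal_mult)
  finally show ?thesis unfolding eq .
qed

lemma nn_integral_cauchy_derivative_le_dini:
  fixes v :: "complex \<Rightarrow> complex"
  assumes v[measurable]: "v \<in> borel_measurable borel" and B: "\<And>\<zeta>. norm \<zeta> = 1 \<Longrightarrow> norm (v \<zeta>) \<le> B"
  shows "(\<integral>\<^sup>+s\<in>{0..2}. (\<integral>\<^sup>+\<zeta>. ennreal (norm (\<integral>\<eta>. v \<eta> * (\<eta> / (\<eta> - of_real s * \<zeta>)\<^sup>2) \<partial>circ)) \<partial>circ) \<partial>lborel)
    \<le> ennreal (4 * pi) * dini v"
proof -
  let ?k = "\<lambda>s \<xi> \<zeta>. ennreal (norm (v (\<xi> * \<zeta>) - v \<zeta>)) * ennreal (1 / (norm (\<xi> - of_real s))\<^sup>2)"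
  have "(\<integral>\<^sup>+s\<in>{0..2}. (\<integral>\<^sup>+\<zeta>. ennreal (norm (\<integral>\<eta>. v \<eta> * (\<eta> / (\<eta> - of_real s * \<zeta>)\<^sup>2) \<partial>circ)) \<partial>circ) \<partial>lborel)
      \<le> (\<integral>\<^sup>+s\<in>{0..2}. (\<integral>\<^sup>+\<zeta>. (\<integral>\<^sup>+\<xi>. ?k s \<xi> \<zeta> \<partial>circ) \<partial>circ) \<partial>lborel)"
  proof (rule nn_integral_mono_AE, use AE_lborel_singleton[of "1::real"] in eventually_elim)
    case (elim s)
    have "(\<integral>\<^sup>+\<zeta>. ennreal (norm (\<integral>\<eta>. v \<eta> * (\<eta> / (\<eta> - of_real s * \<zeta>)\<^sup>2) \<partial>circ)) \<partial>circ)
        \<le> (\<integral>\<^sup>+\<zeta>. (\<integral>\<^sup>+\<xi>. ?k s \<xi> \<zeta> \<partial>circ) \<partial>circ)" if "s \<in> {0..2}"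
      by (intro nn_integral_arc_mono cauchy_derivative_rotate[OF v B]) (use that elim in auto)
    then show ?case
      by (cases "s \<in> {0..2}") auto
  qed
  also have "\<dots> = (\<integral>\<^sup>+s. (\<integral>\<^sup>+\<xi>. (\<integral>\<^sup>+\<zeta>. ?k s \<xi> \<zeta> * indicator {0..2} s \<partial>circ) \<partial>circ) \<partial>lborel)"
  proof (rule nn_integral_cong)
    fix s :: real
    have "(\<integral>\<^sup>+\<zeta>. (\<integral>\<^sup>+\<xi>. ?k s \<xi> \<zeta> \<partial>circ) \<partial>circ) = (\<integral>\<^sup>+\<xi>. (\<integral>\<^sup>+\<zeta>. ?k s \<xi> \<zeta> \<partial>circ) \<partial>circ)"
      by (rule arc_pair.Fubini') measurable
    then show "(\<integral>\<^sup>+\<zeta>. (\<integral>\<^sup>+\<xi>. ?k s \<xi> \<zeta> \<partial>circ) \<partial>circ) * indicator {0..2} s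
        = (\<integral>\<^sup>+\<xi>. (\<integral>\<^sup>+\<zeta>. ?k s \<xi> \<zeta> * indicator {0..2} s \<partial>circ) \<partial>circ)"
      by (simp add: nn_integral_multc)
  qed
  also have "\<dots> = (\<integral>\<^sup>+\<xi>. (\<integral>\<^sup>+s. (\<integral>\<^sup>+\<zeta>. ?k s \<xi> \<zeta> * indicator {0..2} s \<partial>circ) \<partial>lborel) \<partial>circ)"
    by (rule lborel_arc.Fubini'[symmetric]) measurable
  also have "\<dots> = (\<integral>\<^sup>+\<xi>. osc v \<xi> * (\<integral>\<^sup>+s\<in>{0..2}. ennreal (1 / (norm (\<xi> - of_real s))\<^sup>2) \<partial>lborel) \<partial>circ)"
    unfolding osc_def
    by (intro nn_integral_cong) (simp add: nn_integral_multc nn_integral_cmult mult.assoc)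
  also have "\<dots> \<le> (\<integral>\<^sup>+\<xi>. ennreal (4 * pi) * (osc_quot v \<xi>) \<partial>circ)"
  proof (rule nn_integral_arc_mono)
    fix \<xi> :: complex assume \<xi>: "norm \<xi> = 1"
    show "osc v \<xi> * (\<integral>\<^sup>+s\<in>{0..2}. ennreal (1 / (norm (\<xi> - of_real s))\<^sup>2) \<partial>lborel) \<le> ennreal (4 * pi) * (osc_quot v \<xi>)"
    proof (cases "\<xi> = 1")
      case False
      have "osc v \<xi> * (\<integral>\<^sup>+s\<in>{0..2}. ennreal (1 / (norm (\<xi> - of_real s))\<^sup>2) \<partial>lborel) \<le> osc v \<xi> * ennreal (4 * pi * inverse (norm (\<xi> - 1)))"
        using nn_integral_kernel_le[OF \<xi> False] by (intro mult_left_mono) (auto simp: divide_inverse)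
      also have "\<dots> = ennreal (4 * pi) * (osc_quot v \<xi>)"
        using False by (subst ennreal_mult) (auto simp: divide_ennreal_def inverse_ennreal mult_ac)
      finally show ?thesis .
    qed simp
  qed
  also have "\<dots> = ennreal (4 * pi) * dini v"
    unfolding dini_def by (rule nn_integral_cmult) simp
  finally show ?thesis .
qed

text \<open>In the product rule for differences, the term with the difference of g is at most L
  |\<xi> - 1|. This cancels the denominator of the Dini integral and leaves a bounded
  contribution.\<close>

lemma dini_mult_lipschitz_finite:
  fixes g :: "complex \<Rightarrow> complex" and h :: "complex \<Rightarrow> real"
  assumes [measurable]: "g \<in> borel_measurable borel" "h \<in> borel_measurable borel"
    and B: "\<And>x. norm x = 1 \<Longrightarrow> norm (g x) \<le> B"
    and L: "\<And>x y. norm x = 1 \<Longrightarrow> norm y = 1 \<Longrightarrow> norm (g x - g y) \<le> L * norm (x - y)"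
    and h: "\<And>x. norm x = 1 \<Longrightarrow> \<bar>h x\<bar> \<le> 1" and dini: "dini h < \<infinity>"
  shows "dini (\<lambda>x. g x * of_real (h x)) < \<infinity>"
proof -
  have B0: "B \<ge> 0" using B[of 1] norm_ge_zero[of "g 1"] by (simp del: norm_ge_zero)
  have L0: "L \<ge> 0"
    using L[of 1 "-1"] norm_ge_zero[of "g 1 - g (-1)"] by (simp del: norm_ge_zero)
  have "dini (\<lambda>x. g x * of_real (h x)) \<le> (\<integral>\<^sup>+\<xi>. ennreal B * (osc_quot h \<xi>) + ennreal (2 * pi * L) \<partial>circ)"
    unfolding dini_def
  proof (rule nn_integral_arc_mono)
    fix \<xi> :: complex assume \<xi>: "norm \<xi> = 1"
    show "osc (\<lambda>x. g x * of_real (h x)) \<xi> / ennreal (norm (\<xi> - 1)) \<le> ennreal B * (osc_quot h \<xi>) + ennreal (2 * pi * L)"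
    proof (cases "\<xi> = 1")
      case False
      have "osc (\<lambda>x. g x * of_real (h x)) \<xi>
          \<le> (\<integral>\<^sup>+\<zeta>. ennreal B * ennreal (norm (h (\<xi> * \<zeta>) - h \<zeta>)) + ennreal (L * norm (\<xi> - 1)) \<partial>circ)"
        unfolding osc_def
      proof (rule nn_integral_arc_mono)
        fix \<zeta> :: complex assume \<zeta>: "norm \<zeta> = 1"
        then have \<xi>\<zeta>: "norm (\<xi> * \<zeta>) = 1" using \<xi> by (simp add: norm_mult)
        have "norm (g (\<xi> * \<zeta>) * of_real (h (\<xi> * \<zeta>)) - g \<zeta> * of_real (h \<zeta>))
            = norm (g (\<xi> * \<zeta>) * of_real (h (\<xi> * \<zeta>) - h \<zeta>) + (g (\<xi> * \<zeta>) - g \<zeta>) * of_real (h \<zeta>))"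
          by (simp add: algebra_simps)
        also have "\<dots> \<le> norm (g (\<xi> * \<zeta>)) * \<bar>h (\<xi> * \<zeta>) - h \<zeta>\<bar> + norm (g (\<xi> * \<zeta>) - g \<zeta>) * \<bar>h \<zeta>\<bar>"
          by (rule order_trans[OF norm_triangle_ineq]) (simp add: norm_mult del: of_real_diff)
        also have "\<dots> \<le> B * \<bar>h (\<xi> * \<zeta>) - h \<zeta>\<bar> + (L * norm (\<xi> * \<zeta> - \<zeta>)) * 1"
          using B[OF \<xi>\<zeta>] L[OF \<xi>\<zeta> \<zeta>] h[OF \<zeta>] L0 B0 by (intro add_mono mult_mono) auto
        also have "norm (\<xi> * \<zeta> - \<zeta>) = norm (\<xi> - 1)"
          using \<zeta> norm_mult[of "\<xi> - 1" \<zeta>] by (simp add: algebra_simps)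
        finally show "ennreal (norm (g (\<xi> * \<zeta>) * of_real (h (\<xi> * \<zeta>)) - g \<zeta> * of_real (h \<zeta>)))
            \<le> ennreal B * ennreal (norm (h (\<xi> * \<zeta>) - h \<zeta>)) + ennreal (L * norm (\<xi> - 1))"
          using B0 L0 by (simp flip: ennreal_mult ennreal_plus add: ennreal_leI)
      qed
      also have "\<dots> = ennreal B * osc h \<xi> + ennreal (L * norm (\<xi> - 1)) * ennreal (2 * pi)"
        unfolding osc_def by (subst nn_integral_add) (auto simp: nn_integral_cmult emeasure_arc_UNIV)
      finally have "osc (\<lambda>x. g x * of_real (h x)) \<xi> / ennreal (norm (\<xi> - 1))
          \<le> (ennreal B * osc h \<xi> + ennreal (L * norm (\<xi> - 1)) * ennreal (2 * pi)) / ennreal (norm (\<xi> - 1))"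
        unfolding divide_ennreal_def by (rule mult_right_mono) simp
      also have "\<dots> = ennreal B * (osc_quot h \<xi>) + ennreal (L * norm (\<xi> - 1) * (2 * pi)) * ennreal (inverse (norm (\<xi> - 1)))"
        using False L0 by (simp add: divide_ennreal_def distrib_right inverse_ennreal mult.assoc flip: ennreal_mult)
      also have "ennreal (L * norm (\<xi> - 1) * (2 * pi)) * ennreal (inverse (norm (\<xi> - 1))) = ennreal (2 * pi * L)"
        using False L0 by (simp add: field_simps flip: ennreal_mult)
      finally show ?thesis .
    qed simp
  qed
  also have "\<dots> = ennreal B * dini h + ennreal (2 * pi * L) * ennreal (2 * pi)"
    unfolding dini_def by (subst nn_integral_add) (auto simp: nn_integral_cmult emeasure_arc_UNIV)
  also have "\<dots> < \<infinity>"
    using dini by (simp add: ennreal_mult_less_top less_top[symmetric] ennreal_add_eq_top ennreal_mult_eq_top_iff)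
  finally show ?thesis .
qed

section \<open>Non-removability\<close>

lemma measurable_cnj [measurable]: "cnj \<in> borel_measurable borel"
  by (intro borel_measurable_continuous_onI continuous_intros)

text \<open>At most one angle in [0, 2 pi) is mapped to c, namely \<open>Arg2pi c\<close>.\<close>

lemma AE_arc_neq: "AE \<zeta> in circ. \<zeta> \<noteq> c"
proof -
  have "emeasure circ {c} = (\<integral>\<^sup>+\<zeta>. indicator {c} \<zeta> \<partial>circ)"
    by simp
  also have "\<dots> = (\<integral>\<^sup>+\<theta>\<in>{0..<2*pi}. indicator {c} (cis \<theta>) \<partial>lborel)"
    by (rule nn_integral_arc) simp
  also have "\<dots> \<le> (\<integral>\<^sup>+\<theta>. indicator {Arg2pi c} \<theta> \<partial>lborel)"
    using Arg2pi_cis by (intro nn_integral_mono) (auto split: split_indicator)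
  also have "\<dots> = 0" by simp
  finally show ?thesis
    by (intro AE_I[where N="{c}"]) auto
qed

text \<open>Equality in the triangle inequality would force almost all points of \<open>K\<close>
  into the single direction c = m / M, but points have no length.\<close>

lemma norm_first_moment_neq:
  assumes [measurable]: "K \<in> sets borel" and pos: "measure circ K > 0"
  shows "norm (\<integral>\<eta>. of_real (indicator K \<eta>) * \<eta> \<partial>circ :: complex) \<noteq> measure circ K"
proof
  define m where "m = (\<integral>\<eta>. of_real (indicator K \<eta>) * \<eta> \<partial>circ :: complex)"
  define M where "M = measure circ K"
  assume "norm (\<integral>\<eta>. of_real (indicator K \<eta>) * \<eta> \<partial>circ :: complex) = measure circ K"
  then have eq: "norm m = M" by (simp add: m_def M_def)
  have M0: "M > 0" using pos by (simp add: M_def)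
  define c where "c = m / of_real M"
  have c: "norm c = 1" using eq M0 by (simp add: c_def norm_divide)
  have int_m: "integrable circ (\<lambda>\<eta>. of_real (indicator K \<eta>) * \<eta> :: complex)"
    by (rule integrable_arc_bounded[where B=1]) (auto simp: norm_mult indicator_def)
  have int_h: "integrable circ (indicat_real K)"
    by (rule integrable_arc_bounded[where B=1]) (auto simp: indicator_def)
  have Re_le: "Re (cnj c * \<eta>) \<le> 1" if "norm \<eta> = 1" for \<eta>
    using complex_Re_le_cmod[of "cnj c * \<eta>"] that c by (simp add: norm_mult)
  \<comment> \<open>On \<open>K\<close> this is 1 - Re (cnj c * \<eta>), nonnegative on the circle
    and zero there only at \<eta> = c; the assumed equality makes its integral 0.\<close>
  let ?d = "\<lambda>\<eta>. indicator K \<eta> - Re (cnj c * (of_real (indicator K \<eta>) * \<eta>))"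
  have int: "integrable circ (\<lambda>\<eta>. ?d \<eta>)"
    by (intro Bochner_Integration.integrable_diff int_h integrable_Re integrable_mult_right int_m)
  have "(\<integral>\<eta>. ?d \<eta> \<partial>circ) = M - Re (cnj c * m)"
    using int_h int_m
    by (subst Bochner_Integration.integral_diff) (auto simp: m_def M_def simp del: times_complex.simps)
  also have "cnj c * m = of_real M"
    using eq M0 complex_norm_square[of m]
    by (simp add: c_def field_simps power2_eq_square)
  finally have "(\<integral>\<eta>. ?d \<eta> \<partial>circ) = 0"
    by simp
  moreover have "AE \<eta> in circ. 0 \<le> ?d \<eta>"
    using AE_arc_norm by eventually_elim (use Re_le in \<open>auto split: split_indicator\<close>)
  ultimately have "AE \<eta> in circ. ?d \<eta> = 0"
    using int integral_nonneg_eq_0_iff_AE by blast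
  then have "AE \<eta> in circ. \<eta> \<notin> K"
    using AE_arc_norm AE_arc_neq[of c]
  proof eventually_elim
    case (elim \<eta>)
    show ?case
    proof
      assume "\<eta> \<in> K"
      then have Re: "Re (cnj c * \<eta>) = 1" using elim(1) by simp
      have "norm (cnj c * \<eta>) = 1" using c elim(2) by (simp add: norm_mult)
      then have "Im (cnj c * \<eta>) = 0"
        using Re cmod_power2[of "cnj c * \<eta>"] by simp
      then have "cnj c * \<eta> = 1"
        using Re by (simp add: complex_eq_iff)
      then have "c * cnj c * \<eta> = c" by (simp add: mult.assoc)
      then have "\<eta> = c" using c by (simp add: complex_norm_square[symmetric])
      then show False using elim(3) by simp
    qed
  qed
  then have "emeasure circ K = 0"
    by (subst (asm) AE_iff_measurable[OF _ refl]) auto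
  then show False using pos by (simp add: measure_def)
qed

text \<open>The difference quotient misses the claimed derivative by h times the integral of w /
  ((\<eta> - z - h) (\<eta> - z)^2). On \<open>K\<close>, which keeps distance d from z, the
  denominator is at least (d / 2) d^2 once |h| < d / 2.\<close>

lemma cauchy_transform_has_field_derivative:
  fixes w :: "complex \<Rightarrow> complex"
  assumes [measurable]: "w \<in> borel_measurable borel" and B: "\<And>\<eta>. norm \<eta> = 1 \<Longrightarrow> norm (w \<eta>) \<le> B"
    and K: "closed K" "\<And>\<eta>. norm \<eta> = 1 \<Longrightarrow> \<eta> \<notin> K \<Longrightarrow> w \<eta> = 0" and z: "z \<notin> K"
  shows "((\<lambda>z. \<integral>\<eta>. w \<eta> / (\<eta> - z) \<partial>circ) has_field_derivative (\<integral>\<eta>. w \<eta> / (\<eta> - z)\<^sup>2 \<partial>circ)) (at z)"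
proof -
  have "open (- K)" "z \<in> - K"
    using K(1) z by auto
  then obtain d where d: "d > 0" "ball z d \<subseteq> - K"
    by (rule openE)
  have B0: "B \<ge> 0" using B[of 1] norm_ge_zero[of "w 1"] by (simp del: norm_ge_zero)
  have far: "d \<le> norm (\<eta> - z)" if "\<eta> \<in> K" for \<eta>
    using d(2) that by - (rule ccontr, auto simp: subset_iff dist_norm norm_minus_commute)
  have int1: "integrable circ (\<lambda>\<eta>. w \<eta> / (\<eta> - (z + h)))" if h: "norm h < d / 2" for h
  proof (rule integrable_arc_bounded)
    fix \<eta> :: complex assume \<eta>: "norm \<eta> = 1"
    show "norm (w \<eta> / (\<eta> - (z + h))) \<le> B / (d / 2)"
    proof (cases "\<eta> \<in> K")
      case True
      have "d / 2 \<le> norm (\<eta> - (z + h))"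
        using far[OF True] h norm_triangle_ineq4[of "\<eta> - z" h] norm_triangle_ineq2[of "\<eta> - z" h]
        by (simp add: algebra_simps)
      then show ?thesis
        unfolding norm_divide using B[OF \<eta>] B0 d(1) by (intro frac_le) auto
    qed (use K(2) \<eta> B0 d in auto)
  qed simp
  have int2: "integrable circ (\<lambda>\<eta>. w \<eta> / (\<eta> - z)\<^sup>2)"
  proof (rule integrable_arc_bounded)
    fix \<eta> :: complex assume \<eta>: "norm \<eta> = 1"
    show "norm (w \<eta> / (\<eta> - z)\<^sup>2) \<le> B / d\<^sup>2"
    proof (cases "\<eta> \<in> K")
      case True
      then show ?thesis
        unfolding norm_divide norm_power using B[OF \<eta>] B0 d(1) far[OF True] by (intro frac_le power_mono) auto
    qed (use K(2) \<eta> B0 d in auto)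
  qed simp
  let ?D = "\<integral>\<eta>. w \<eta> / (\<eta> - z)\<^sup>2 \<partial>circ"
  define q where "q h = ((\<integral>\<eta>. w \<eta> / (\<eta> - (z + h)) \<partial>circ) - (\<integral>\<eta>. w \<eta> / (\<eta> - z) \<partial>circ)) / h" for h
  have bound: "norm (q h - ?D) \<le> norm h * (2 * pi * (B / (d / 2 * d\<^sup>2)))"
    if h: "h \<noteq> 0" "norm h < d / 2" for h
  proof -
    have i0: "integrable circ (\<lambda>\<eta>. w \<eta> / (\<eta> - z))"
      using int1[of 0] d by simp
    have "q h - ?D
        = (\<integral>\<eta>. (w \<eta> / (\<eta> - (z + h)) - w \<eta> / (\<eta> - z)) / h - w \<eta> / (\<eta> - z)\<^sup>2 \<partial>circ)"
      unfolding q_def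
      by (simp add: Bochner_Integration.integral_diff Bochner_Integration.integrable_diff int1[OF h(2)] i0 int2
          del: diff_add_eq_diff_diff_swap)
    also have "norm \<dots> \<le> 2 * pi * (norm h * (B / (d / 2 * d\<^sup>2)))"
    proof (rule norm_integral_arc_le)
      fix \<eta> :: complex assume \<eta>: "norm \<eta> = 1"
      show "norm ((w \<eta> / (\<eta> - (z + h)) - w \<eta> / (\<eta> - z)) / h - w \<eta> / (\<eta> - z)\<^sup>2) \<le> norm h * (B / (d / 2 * d\<^sup>2))"
      proof (cases "\<eta> \<in> K")
        case True
        have 1: "d / 2 \<le> norm (\<eta> - (z + h))"
          using far[OF True] h(2) norm_triangle_ineq2[of "\<eta> - z" h]
          by (simp add: algebra_simps)
        have nz: "\<eta> - z \<noteq> 0" "\<eta> - (z + h) \<noteq> 0"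
          using 1 far[OF True] d by auto
        define p where "p = \<eta> - z"
        have p: "\<eta> - (z + h) = p - h" by (simp add: p_def)
        have "(w \<eta> / (p - h) - w \<eta> / p) / h - w \<eta> / p\<^sup>2 = h * (w \<eta> / ((p - h) * p\<^sup>2))"
          using nz h(1) unfolding p p_def[symmetric]
          by (simp add: field_simps power2_eq_square)
        then have "norm ((w \<eta> / (\<eta> - (z + h)) - w \<eta> / (\<eta> - z)) / h - w \<eta> / (\<eta> - z)\<^sup>2)
            = norm h * (norm (w \<eta>) / (norm (\<eta> - (z + h)) * (norm (\<eta> - z))\<^sup>2))"
          unfolding p p_def[symmetric] by (simp add: norm_mult norm_divide norm_power)
        also have "\<dots> \<le> norm h * (B / (d / 2 * d\<^sup>2))"
          using 1 far[OF True] d B[OF \<eta>] B0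
          by (intro mult_left_mono frac_le mult_mono power_mono) auto
        finally show ?thesis .
      qed (use K(2) \<eta> B0 d in auto)
    qed measurable
    finally show ?thesis by (simp add: mult_ac)
  qed
  have "((\<lambda>h. q h - ?D) \<longlongrightarrow> 0) (at 0)"
  proof (rule Lim_null_comparison)
    show "eventually (\<lambda>h. norm (q h - ?D) \<le> norm h * (2 * pi * (B / (d / 2 * d\<^sup>2)))) (at 0)"
      unfolding eventually_at using bound d(1) by (intro exI[of _ "d / 2"]) auto
    show "((\<lambda>h::complex. norm h * (2 * pi * (B / (d / 2 * d\<^sup>2)))) \<longlongrightarrow> 0) (at 0)"
      using d(1) by (auto intro!: tendsto_eq_intros)
  qed
  then have "(q \<longlongrightarrow> ?D) (at 0)"
    by (rule LIM_zero_cancel)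
  then show ?thesis unfolding DERIV_def q_def .
qed

lemma not_removable_W1a_if_dini_finite:
  assumes K: "compact K" "K \<subseteq> sphere 0 1" and pos: "emeasure circ K > 0"
    and dini: "dini (indicat_real K) < \<infinity>"
  shows "\<not> removable_W1a K"
proof -
  have [measurable]: "K \<in> sets borel" using K(1) by (simp add: borel_compact)
  have clK: "closed K" using K(1) compact_imp_closed by blast
  define M where "M = measure circ K"
  define m where "m = (\<integral>\<eta>. of_real (indicator K \<eta>) * \<eta> \<partial>circ :: complex)"
  have M0: "M > 0"
    using pos by (simp add: M_def circ.emeasure_eq_measure)
  \<comment> \<open>The density of the transform is w = v * \<eta>, that is M \<eta> - m on
    \<open>K\<close>. Splitting off \<eta> writes the derivative as an integral of v against \<eta>
    / (\<eta> - z)^2, and f 0 as the plain integral of v. The first factor is Lipschitz, so v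
    inherits a finite Dini integral from \<open>K\<close>.\<close>
  define v where "v \<eta> = (of_real M - m * cnj \<eta>) * of_real (indicator K \<eta>)" for \<eta>
  have [measurable]: "v \<in> borel_measurable borel"
    unfolding v_def by measurable
  define B where "B = M + norm m"
  have g_le: "norm (of_real M - m * cnj x) \<le> B" if "norm x = 1" for x
    using norm_triangle_ineq4[of "of_real M" "m * cnj x"] that M0 by (simp add: B_def norm_mult)
  have v_le: "norm (v x) \<le> B" if "norm x = 1" for x
    using g_le[OF that] M0 by (auto simp: v_def norm_mult indicator_def B_def)
  have dini_v: "dini v < \<infinity>"
    unfolding v_def
  proof (rule dini_mult_lipschitz_finite[OF _ _ g_le])
    show "norm (of_real M - m * cnj x - (of_real M - m * cnj y)) \<le> norm m * norm (x - y)" for x y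
    proof -
      have "of_real M - m * cnj x - (of_real M - m * cnj y) = m * cnj (y - x)"
        by (simp add: algebra_simps)
      then show ?thesis by (simp only: norm_mult complex_mod_cnj norm_minus_commute order_refl)
    qed
  qed (use dini in \<open>auto split: split_indicator\<close>)
  define w where "w \<eta> = v \<eta> * \<eta>" for \<eta>
  have [measurable]: "w \<in> borel_measurable borel"
    unfolding w_def by measurable
  have w_le: "norm (w x) \<le> B" if "norm x = 1" for x
    using v_le[OF that] that by (simp add: w_def norm_mult)
  have int_m: "integrable circ (\<lambda>\<eta>. of_real (indicator K \<eta>) * \<eta> :: complex)"
    by (rule integrable_arc_bounded[where B=1]) (auto simp: norm_mult indicator_def)
  have int_cm: "integrable circ (\<lambda>\<eta>. cnj (of_real (indicator K \<eta>) * \<eta>))"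
    by (rule integrable_arc_bounded[where B=1]) (auto simp: norm_mult indicator_def)
  have int_h: "integrable circ (\<lambda>\<eta>. of_real (indicator K \<eta>) :: complex)"
    by (rule integrable_arc_bounded[where B=1]) (auto simp: norm_mult indicator_def)
  have I_h: "(\<integral>\<eta>. of_real (indicator K \<eta>) \<partial>circ) = complex_of_real M"
    by (subst integral_complex_of_real) (simp add: M_def)
  have I_w: "(\<integral>\<eta>. w \<eta> \<partial>circ) = 0"
  proof -
    have "(\<integral>\<eta>. w \<eta> \<partial>circ) = (\<integral>\<eta>. of_real M * (of_real (indicator K \<eta>) * \<eta>) - m * of_real (indicator K \<eta>) \<partial>circ)"
    proof (rule integral_arc_cong)
      fix \<eta> :: complex assume "norm \<eta> = 1"
      then have "cnj \<eta> * \<eta> = 1" using complex_norm_square[of \<eta>] by (simp add: mult.commute)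
      then show "w \<eta> = of_real M * (of_real (indicator K \<eta>) * \<eta>) - m * of_real (indicator K \<eta>)"
        by (simp add: w_def v_def algebra_simps)
    qed measurable
    also have "\<dots> = of_real M * m - m * of_real M"
      using int_m int_h by (subst Bochner_Integration.integral_diff) (auto simp: I_h simp flip: m_def M_def)
    finally show ?thesis by simp
  qed
  have I_v: "(\<integral>\<eta>. v \<eta> \<partial>circ) \<noteq> 0"
  proof -
    have "(\<integral>\<eta>. v \<eta> \<partial>circ) = (\<integral>\<eta>. of_real M * of_real (indicator K \<eta>) - m * cnj (of_real (indicator K \<eta>) * \<eta>) \<partial>circ)"
      by (intro Bochner_Integration.integral_cong refl) (simp add: v_def algebra_simps)
    also have "\<dots> = of_real M * of_real M - m * cnj m"
      using int_cm int_h Bochner_Integration.integral_cnj[of circ "\<lambda>\<eta>. of_real (indicator K \<eta>) * \<eta>"]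
      by (subst Bochner_Integration.integral_diff) (auto simp: I_h simp flip: m_def M_def)
    also have "\<dots> = of_real (M\<^sup>2 - (norm m)\<^sup>2)"
      using complex_norm_square[of m] by (simp add: power2_eq_square)
    also have "\<dots> \<noteq> 0"
    proof -
      have "norm m \<noteq> M"
        unfolding m_def M_def by (rule norm_first_moment_neq) (use M0 M_def in auto)
      then have "M\<^sup>2 \<noteq> (norm m)\<^sup>2" using M0 by (simp add: power2_eq_iff_nonneg)
      then show ?thesis by (simp only: of_real_eq_0_iff)
    qed
    finally show ?thesis .
  qed
  define f where "f z = (\<integral>\<eta>. w \<eta> / (\<eta> - z) \<partial>circ)" for z
  define D where "D z = (\<integral>\<eta>. w \<eta> / (\<eta> - z)\<^sup>2 \<partial>circ)" for z
  have [measurable]: "D \<in> borel_measurable borel"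
    unfolding D_def by measurable
  have f_deriv: "(f has_field_derivative D z) (at z)" if "z \<notin> K" for z
    unfolding f_def D_def
    by (rule cauchy_transform_has_field_derivative[OF _ w_le clK _ that]) (auto simp: w_def v_def)
  \<comment> \<open>Because w has integral 0, w / z^2 can be subtracted under the integral, which
    gains one power of |z|. The 10 comes from |2 z - \<eta>| \<le> (5/2) |z| and |\<eta> - z| \<ge>
    |z| / 2.\<close>
  have D_far: "norm (D z) \<le> 2 * pi * (B * (10 / norm z ^ 3))" if z: "2 \<le> norm z" for z
  proof -
    have far: "norm z / 2 \<le> norm (\<eta> - z)" if "norm \<eta> = 1" for \<eta>
      using norm_triangle_ineq2[of z \<eta>] that z by (simp add: norm_minus_commute)
    have int: "integrable circ (\<lambda>\<eta>. w \<eta> / (\<eta> - z)\<^sup>2)" "integrable circ w"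
    proof -
      show "integrable circ (\<lambda>\<eta>. w \<eta> / (\<eta> - z)\<^sup>2)"
      proof (rule integrable_arc_bounded)
        fix \<eta> :: complex assume \<eta>: "norm \<eta> = 1"
        show "norm (w \<eta> / (\<eta> - z)\<^sup>2) \<le> B / (norm z / 2)\<^sup>2"
          unfolding norm_divide norm_power using w_le[OF \<eta>] far[OF \<eta>] z M0
          by (intro frac_le power_mono) (auto simp: B_def)
      qed simp
      show "integrable circ w"
        by (rule integrable_arc_bounded[OF _ w_le]) auto
    qed
    have "D z = (\<integral>\<eta>. w \<eta> / (\<eta> - z)\<^sup>2 - w \<eta> / z\<^sup>2 \<partial>circ)"
      unfolding D_def using int I_w by (subst Bochner_Integration.integral_diff) auto
    also have "norm \<dots> \<le> 2 * pi * (B * (10 / norm z ^ 3))"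
    proof (rule norm_integral_arc_le)
      fix \<eta> :: complex assume \<eta>: "norm \<eta> = 1"
      have nz: "\<eta> - z \<noteq> 0" "z \<noteq> 0" using far[OF \<eta>] z by auto
      have "w \<eta> / (\<eta> - z)\<^sup>2 - w \<eta> / z\<^sup>2 = w \<eta> * (\<eta> * (2 * z - \<eta>) / ((\<eta> - z)\<^sup>2 * z\<^sup>2))"
      proof -
        define p where "p = \<eta> - z"
        have "w \<eta> / p\<^sup>2 - w \<eta> / z\<^sup>2 = w \<eta> * ((z\<^sup>2 - p\<^sup>2) / (p\<^sup>2 * z\<^sup>2))"
          using nz by (simp add: p_def[symmetric] divide_simps) (simp add: algebra_simps)
        moreover have "z\<^sup>2 - p\<^sup>2 = \<eta> * (2 * z - \<eta>)"
          by (simp add: p_def power2_eq_square algebra_simps)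
        ultimately show ?thesis by (simp add: p_def)
      qed
      then have "norm (w \<eta> / (\<eta> - z)\<^sup>2 - w \<eta> / z\<^sup>2) = norm (w \<eta>) * (norm (2 * z - \<eta>) / ((norm (\<eta> - z))\<^sup>2 * (norm z)\<^sup>2))"
        using \<eta> by (simp add: norm_mult norm_divide norm_power)
      also have "\<dots> \<le> B * ((5/2 * norm z) / ((norm z / 2)\<^sup>2 * (norm z)\<^sup>2))"
      proof (rule mult_mono[OF w_le[OF \<eta>] frac_le])
        show "norm (2 * z - \<eta>) \<le> 5/2 * norm z"
          using norm_triangle_ineq4[of "2 * z" \<eta>] \<eta> z by (simp add: norm_mult)
        show "(norm z / 2)\<^sup>2 * (norm z)\<^sup>2 \<le> (norm (\<eta> - z))\<^sup>2 * (norm z)\<^sup>2"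
          using far[OF \<eta>] by (intro mult_right_mono power_mono) auto
      qed (use z M0 nz in \<open>auto simp: B_def intro!: mult_pos_pos\<close>)
      also have "(5/2 * norm z) / ((norm z / 2)\<^sup>2 * (norm z)\<^sup>2) = 10 / norm z ^ 3"
        using nz by (simp add: field_simps power2_eq_square power3_eq_cube)
      finally show "norm (w \<eta> / (\<eta> - z)\<^sup>2 - w \<eta> / z\<^sup>2) \<le> B * (10 / norm z ^ 3)" .
    qed measurable
    finally show ?thesis .
  qed
  \<comment> \<open>Up to radius 2 the Dini estimate applies and the area factor r is at most 2;
    beyond it the decay r^-3 times r is integrable.\<close>
  have D_int: "(\<integral>\<^sup>+z. ennreal (norm (D z)) \<partial>lborel) < \<infinity>"
  proof -
    \<comment> \<open>One 2 pi is the length of the circle, the other comes from the pointwise bound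
      on \<open>D\<close>.\<close>
    define C where "C = 2 * pi * (2 * pi * (B * 10))"
    have C0: "C \<ge> 0" using M0 by (simp add: C_def B_def)
    let ?N = "\<lambda>r. \<integral>\<^sup>+\<zeta>. ennreal (norm (D (of_real r * \<zeta>))) \<partial>circ"
    have "(\<integral>\<^sup>+z. ennreal (norm (D z)) \<partial>lborel) \<le> 2 * (\<integral>\<^sup>+r\<in>{0<..}. ?N r * ennreal r \<partial>lborel)"
      by (rule nn_integral_complex_le_polar) simp
    also have "(\<integral>\<^sup>+r\<in>{0<..}. ?N r * ennreal r \<partial>lborel)
        \<le> (\<integral>\<^sup>+r. 2 * (?N r * indicator {0..2} r) + ennreal (C / r\<^sup>2) * indicator {2..} r \<partial>lborel)"
    proof (rule nn_integral_mono)
      fix r :: real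
      consider "r \<le> 0" | "0 < r" "r \<le> 2" | "2 < r" by linarith
      then show "?N r * ennreal r * indicator {0<..} r \<le> 2 * (?N r * indicator {0..2} r) + ennreal (C / r\<^sup>2) * indicator {2..} r"
      proof cases
        case 2
        then have "?N r * ennreal r \<le> ?N r * ennreal 2"
          by (intro mult_left_mono ennreal_leI) auto
        also have "\<dots> \<le> 2 * ?N r + ennreal (C / r\<^sup>2) * indicator {2..} r"
          by (simp add: mult.commute)
        finally show ?thesis using 2 by simp
      next
        case 3
        have "?N r \<le> (\<integral>\<^sup>+\<zeta>. ennreal (2 * pi * (B * (10 / r ^ 3))) \<partial>circ)"
        proof (rule nn_integral_arc_mono, rule ennreal_leI)
          fix \<zeta> :: complex assume "norm \<zeta> = 1"
          then show "norm (D (of_real r * \<zeta>)) \<le> 2 * pi * (B * (10 / r ^ 3))"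
            using D_far[of "of_real r * \<zeta>"] 3 by (simp add: norm_mult)
        qed
        also have "\<dots> = ennreal (C / r ^ 3)"
          using 3 M0 by (simp add: emeasure_arc_UNIV C_def B_def mult_ac flip: ennreal_mult)
        finally have "?N r * ennreal r \<le> ennreal (C / r ^ 3) * ennreal r"
          by (rule mult_right_mono) simp
        also have "\<dots> = ennreal (C / r\<^sup>2)"
          using 3 C0 by (simp add: power2_eq_square power3_eq_cube flip: ennreal_mult)
        finally show ?thesis using 3 by simp
      qed simp
    qed
    also have "\<dots> = 2 * (\<integral>\<^sup>+r\<in>{0..2}. ?N r \<partial>lborel) + (\<integral>\<^sup>+r. ennreal (C / r\<^sup>2) * indicator {2..} r \<partial>lborel)"
      by (subst nn_integral_add) (auto simp: nn_integral_cmult)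
    also have "(\<integral>\<^sup>+r. ennreal (C / r\<^sup>2) * indicator {2..} r \<partial>lborel) = ennreal (0 - (- C / 2))"
    proof (rule nn_integral_FTC_atLeast)
      show "((\<lambda>r. - C / r) has_real_derivative C / r\<^sup>2) (at r)" if "2 \<le> r" for r
        using that by (auto intro!: derivative_eq_intros simp: power2_eq_square)
      show "((\<lambda>r. - C / r) \<longlongrightarrow> 0) at_top"
      proof -
        have "((\<lambda>r. C / r) \<longlongrightarrow> 0) at_top"
          by (intro tendsto_divide_0[OF tendsto_const] filterlim_at_top_imp_at_infinity filterlim_ident)
        from tendsto_minus[OF this] show ?thesis by simp
      qed
    qed (use C0 in auto)
    also have "(\<integral>\<^sup>+r\<in>{0..2}. ?N r \<partial>lborel) \<le> ennreal (4 * pi) * dini v"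
      using nn_integral_cauchy_derivative_le_dini[OF _ v_le] by (simp add: D_def w_def)
    finally have "(\<integral>\<^sup>+z. ennreal (norm (D z)) \<partial>lborel) \<le> 2 * (2 * (ennreal (4 * pi) * dini v) + ennreal (0 - (- C / 2)))"
      by (simp add: mult_left_mono add_right_mono)
    also have "\<dots> < \<infinity>"
      using dini_v by (simp add: less_top[symmetric] ennreal_add_eq_top ennreal_mult_eq_top_iff)
    finally show ?thesis .
  qed
  have "f \<in> W1a (- K)"
    unfolding W1a_def
  proof (intro CollectI conjI)
    show "f holomorphic_on - K"
      using clK f_deriv by (auto simp: holomorphic_on_open open_Compl)
    have "(\<integral>\<^sup>+z\<in>- K. ennreal (norm (deriv f z)) \<partial>lborel) \<le> (\<integral>\<^sup>+z. ennreal (norm (D z)) \<partial>lborel)"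
      by (intro nn_integral_mono) (auto split: split_indicator simp: DERIV_imp_deriv[OF f_deriv])
    then show "(\<integral>\<^sup>+z\<in>- K. ennreal (norm (deriv f z)) \<partial>lborel) < \<infinity>"
      using D_int by (rule le_less_trans)
  qed
  \<comment> \<open>f tends to 0 along the positive real axis, whereas f 0 is the nonzero integral
    of v.\<close>
  moreover have "\<not> f constant_on - K"
  proof
    assume "f constant_on - K"
    then obtain c where c: "\<And>z. z \<notin> K \<Longrightarrow> f z = c"
      by (auto simp: constant_on_def)
    have "0 \<notin> K" using K(2) by auto
    have "f 0 = (\<integral>\<eta>. v \<eta> \<partial>circ)"
      unfolding f_def by (rule integral_arc_cong) (auto simp: w_def)
    then have "c \<noteq> 0" using c[OF \<open>0 \<notin> K\<close>] I_v by simp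
    have bound: "norm c \<le> 2 * pi * (B / (x - 1))" if x: "x > 1" for x :: real
    proof -
      have "of_real x \<notin> K" using K(2) x by auto
      then have "norm c = norm (f (of_real x))" using c by simp
      also have "\<dots> \<le> 2 * pi * (B / (x - 1))"
        unfolding f_def
      proof (rule norm_integral_arc_le)
        fix \<eta> :: complex assume \<eta>: "norm \<eta> = 1"
        have "x - 1 \<le> norm (\<eta> - of_real x)"
          using norm_triangle_ineq2[of "of_real x" \<eta>] \<eta> x by (simp add: norm_minus_commute)
        then show "norm (w \<eta> / (\<eta> - of_real x)) \<le> B / (x - 1)"
          unfolding norm_divide using w_le[OF \<eta>] x M0 by (intro frac_le) (auto simp: B_def)
      qed measurable
      finally show ?thesis .
    qed
    have B0: "B > 0" using M0 by (simp add: B_def add_pos_nonneg)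
    \<comment> \<open>Chosen so that |c| (x - 1) = 4 pi (B + 1), which exceeds the bound 2 pi
      B.\<close>
    define x where "x = 1 + 4 * pi * (B + 1) / norm c"
    have "x > 1" using B0 \<open>c \<noteq> 0\<close> by (simp add: x_def)
    then have "norm c * (x - 1) \<le> 2 * pi * B"
      using bound[of x] by (simp add: field_simps)
    moreover have "norm c * (x - 1) = pi * (4 * (B + 1))"
      using \<open>c \<noteq> 0\<close> by (simp add: x_def)
    moreover have "pi * (2 * B) < pi * (4 * (B + 1))"
      using B0 by (intro mult_strict_left_mono) auto
    ultimately show False by (simp add: mult.assoc mult.left_commute)
  qed
  ultimately show ?thesis by (auto simp: removable_W1a_def)
qed

section \<open>The pairing with the Bloch norm\<close>

text \<open>Integrability is not assumed: otherwise the Bochner integral is 0.\<close>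

lemma norm_integral_le_nn_integral:
  fixes f :: "'b \<Rightarrow> 'a :: {banach, second_countable_topology}"
  shows "ennreal (norm (integral\<^sup>L M f)) \<le> (\<integral>\<^sup>+x. ennreal (norm (f x)) \<partial>M)"
  by (cases "integrable M f") (auto simp: integral_norm_bound_ennreal not_integrable_integral_eq)

text \<open>This is Cauchy's formula for the derivative, rewritten with arc length: along the unit
  circle the contour differential is \<i> \<zeta> times arc length, so multiplying by -\<i> removes
  the extra factor.\<close>

lemma integral_arc_cauchy_derivative:
  assumes g: "g holomorphic_on UNIV" and a: "norm a < 1"
  shows "(\<integral>\<zeta>. g \<zeta> * (\<zeta> / (\<zeta> - a)\<^sup>2) \<partial>circ) = 2 * of_real pi * deriv g a"
proof -
  have cont: "continuous_on UNIV g"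
    using g by (rule holomorphic_on_imp_continuous_on)
  then have [measurable]: "g \<in> borel_measurable borel"
    by (rule borel_measurable_continuous_onI)
  have "bounded (g ` sphere 0 1)"
    by (rule compact_imp_bounded[OF compact_continuous_image[OF continuous_on_subset[OF cont]]]) auto
  then obtain C where "\<forall>x\<in>g ` sphere 0 1. norm x \<le> C"
    unfolding bounded_iff ..
  then have C: "norm (g \<zeta>) \<le> C" if "norm \<zeta> = 1" for \<zeta>
    using that by simp
  have bound: "norm (g \<zeta> * (\<zeta> / (\<zeta> - a)\<^sup>2)) \<le> C * (1 / (norm a - 1)\<^sup>2)" if "norm \<zeta> = 1" for \<zeta>
    unfolding norm_mult using norm_cauchy_kernel_le[OF that, of a] C[OF that] a
    by (intro mult_mono) (auto intro: order_trans[OF norm_ge_zero])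
  let ?I = "contour_integral (circlepath 0 1) (\<lambda>u. g u / (u - a)\<^sup>2)"
  have hol: "continuous_on (cball 0 1) g" "g holomorphic_on ball 0 1" "a \<in> ball 0 1"
    using cont g a by (auto intro: continuous_on_subset holomorphic_on_subset)
  have "deriv g a = 1 / (2 * of_real pi * \<i>) * ?I"
    by (rule DERIV_imp_deriv[OF Cauchy_derivative_integral_circlepath(2)[OF hol]])
  then have I: "?I = \<i> * (2 * of_real pi * deriv g a)"
    by (simp add: field_simps)
  have "((\<lambda>u. g u / (u - a)\<^sup>2) has_contour_integral ?I) (circlepath 0 1)"
    using Cauchy_derivative_integral_circlepath(1)[OF hol] by (rule has_contour_integral_integral)
  then have "((\<lambda>t. g (0 + of_real 1 * cis t) / (0 + of_real 1 * cis t - a)\<^sup>2 * of_real 1 * \<i> * cis t) has_integral ?I) {0..2*pi}"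
    unfolding circlepath_def by (subst (asm) has_contour_integral_part_circlepath_iff) auto
  then have "((\<lambda>t. - \<i> * (g (0 + of_real 1 * cis t) / (0 + of_real 1 * cis t - a)\<^sup>2 * of_real 1 * \<i> * cis t)) has_integral - \<i> * ?I) {0..2*pi}"
    by (rule has_integral_mult_right)
  moreover have "- \<i> * (x / y * of_real 1 * \<i> * z) = x * (z / y)" for x y z :: complex
  proof -
    have "- \<i> * (x / y * of_real 1 * \<i> * z) = - (\<i> * \<i>) * (x * (z / y))"
      by (simp only: divide_inverse of_real_1 mult_1_left mult_1_right mult_minus_left mult_minus_right mult_ac)
    then show ?thesis by simp
  qed
  ultimately have "((\<lambda>t. g (cis t) * (cis t / (cis t - a)\<^sup>2)) has_integral 2 * of_real pi * deriv g a) {0..2*pi}"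
    unfolding I by simp
  then show ?thesis
    by (intro has_integral_arc[OF _ bound]) auto
qed

text \<open>The Taylor remainder with kernel 1 - \<rho>, after substituting \<rho> = s^2.
  \<open>F\<close> is its primitive along the substituted path, with F 1 = Q(\<eta>) and F 0 = Q(0)
  + \<eta> Q'(0).\<close>

lemma poly_taylor_square:
  fixes Q :: "complex poly" and \<eta> :: complex
  shows "(\<integral>s. indicator {0..1} s *\<^sub>R (of_real (2 * s * (1 - s\<^sup>2)) * (\<eta>\<^sup>2 * poly (pderiv (pderiv Q)) (of_real (s\<^sup>2) * \<eta>))) \<partial>lborel)
    = poly Q \<eta> - poly Q 0 - \<eta> * poly (pderiv Q) 0"
proof -
  let ?f = "\<lambda>s. of_real (2 * s * (1 - s\<^sup>2)) * (\<eta>\<^sup>2 * poly (pderiv (pderiv Q)) (of_real (s\<^sup>2) * \<eta>))"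
  define F where "F w = poly Q (w\<^sup>2 * \<eta>) + (1 - w\<^sup>2) * (\<eta> * poly (pderiv Q) (w\<^sup>2 * \<eta>))" for w :: complex
  have F: "(F has_field_derivative 2 * w * (1 - w\<^sup>2) * (\<eta>\<^sup>2 * poly (pderiv (pderiv Q)) (w\<^sup>2 * \<eta>))) (at w)" for w
    unfolding F_def
    by (rule derivative_eq_intros refl DERIV_chain2[OF poly_DERIV])+ (simp add: algebra_simps power2_eq_square)
  have "(\<integral>s. indicator {0..1} s *\<^sub>R ?f s \<partial>lborel)
      = (F \<circ> of_real) 1 - (F \<circ> of_real) 0"
  proof (rule integral_FTC_atLeastAtMost)
    fix s :: real
    have "((\<lambda>s. complex_of_real s) has_vector_derivative 1) (at s)"
      by (auto intro!: derivative_eq_intros)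
    from field_vector_diff_chain_at[OF this F]
    have "(F \<circ> of_real has_vector_derivative ?f s) (at s)"
      by simp
    then show "(F \<circ> of_real has_vector_derivative ?f s) (at s within {0..1})"
      by (rule has_vector_derivative_at_within)
  qed (auto intro!: continuous_intros)
  then show ?thesis by (simp add: F_def)
qed

lemma poly_measurable [measurable]: "poly (Q :: complex poly) \<in> borel_measurable borel"
  by (intro borel_measurable_continuous_onI continuous_intros)

lemma poly_bounded_cball:
  fixes Q :: "complex poly"
  obtains C where "\<And>z. norm z \<le> 1 \<Longrightarrow> norm (poly Q z) \<le> C"
proof -
  have "bounded (poly Q ` cball 0 1)"
    by (intro compact_imp_bounded compact_continuous_image continuous_intros) auto
  then obtain C where "\<forall>x\<in>poly Q ` cball 0 1. norm x \<le> C"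
    unfolding bounded_iff ..
  then show thesis
    by (intro that[of C]) simp
qed

lemma Fubini_arc_bounded:
  fixes f :: "complex \<Rightarrow> complex \<Rightarrow> complex"
  assumes [measurable]: "case_prod f \<in> borel_measurable (borel \<Otimes>\<^sub>M borel)"
    and B: "\<And>x y. norm x = 1 \<Longrightarrow> norm y = 1 \<Longrightarrow> norm (f x y) \<le> B"
  shows "(\<integral>y. (\<integral>x. f x y \<partial>circ) \<partial>circ) = (\<integral>x. (\<integral>y. f x y \<partial>circ) \<partial>circ)"
proof (rule arc_pair.Fubini_integral, rule arc_pair.Fubini_integrable)
  show "integrable circ (\<lambda>x. \<integral>y. norm (case (x, y) of (x, y) \<Rightarrow> f x y) \<partial>circ)"
    using B by (intro integrable_arc_bounded[where B="2 * pi * B"] norm_integral_arc_le) auto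
  show "AE x in circ. integrable circ (\<lambda>y. case (x, y) of (x, y) \<Rightarrow> f x y)"
    using AE_arc_norm by eventually_elim (use B in \<open>auto intro!: integrable_arc_bounded[where B=B]\<close>)
qed measurable

lemma Fubini_Icc_arc_bounded:
  fixes f :: "real \<Rightarrow> complex \<Rightarrow> complex"
  assumes [measurable]: "case_prod f \<in> borel_measurable (borel \<Otimes>\<^sub>M borel)"
    and B: "\<And>s y. s \<in> {0..1} \<Longrightarrow> norm y = 1 \<Longrightarrow> norm (f s y) \<le> B" "B \<ge> 0"
  shows "(\<integral>y. (\<integral>s. indicator {0..1} s *\<^sub>R f s y \<partial>lborel) \<partial>circ) = (\<integral>s. (\<integral>y. indicator {0..1} s *\<^sub>R f s y \<partial>circ) \<partial>lborel)"
proof (rule lborel_arc.Fubini_integral, rule lborel_arc.Fubini_integrable)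
  have "integrable lborel (\<lambda>s. indicator {0..1} s *\<^sub>R (\<integral>y. norm (f s y) \<partial>circ))"
  proof (rule integrableI_bounded_set_indicator[where B="2 * pi * B"])
    show "AE s in lborel. s \<in> {0..1} \<longrightarrow> norm (\<integral>y. norm (f s y) \<partial>circ) \<le> 2 * pi * B"
      using B by (intro AE_I2 impI norm_integral_arc_le) auto
  qed auto
  then show "integrable lborel (\<lambda>s. \<integral>y. norm (case (s, y) of (s, y) \<Rightarrow> indicator {0..1} s *\<^sub>R f s y) \<partial>circ)"
    by simp
  show "AE s in lborel. integrable circ (\<lambda>y. case (s, y) of (s, y) \<Rightarrow> indicator {0..1} s *\<^sub>R f s y)"
    using B by (intro AE_I2) (auto intro!: integrable_arc_bounded[where B=B] split: split_indicator)
qed measurable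

text \<open>The constant depends on \<open>h\<close> only. The first-order Taylor part of Q is
  bounded directly; the remainder becomes an integral over s and \<zeta> of Q'(s \<zeta>) against
  the conjugate of the Cauchy-type integral \<open>H\<close>, which the Dini estimate controls.
  Allowing any upper bound \<open>N\<close> avoids suprema.\<close>

lemma pairing_le_bloch:
  fixes h :: "complex \<Rightarrow> real"
  assumes [measurable]: "h \<in> borel_measurable borel" and h: "\<And>x. norm x = 1 \<Longrightarrow> \<bar>h x\<bar> \<le> 1"
    and dini: "dini h < \<infinity>"
  obtains C where "\<And>Q N. (\<And>z. norm z < 1 \<Longrightarrow> (1 - norm z) * norm (poly (pderiv Q) z) \<le> N) \<Longrightarrow>
    norm (\<integral>\<eta>. poly Q \<eta> * of_real (h \<eta>) \<partial>circ) \<le> C * (norm (poly Q 0) + N)"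
proof -
  \<comment> \<open>As \<open>h\<close> is real, conjugating v gives \<eta> * h. This \<eta> and the
    one left by the conjugated kernel form the \<eta>^2 of the Taylor remainder.\<close>
  define v where "v \<eta> = cnj \<eta> * of_real (h \<eta>)" for \<eta>
  have [measurable]: "v \<in> borel_measurable borel"
    unfolding v_def by measurable
  have v_le: "norm (v x) \<le> 1" if "norm x = 1" for x
    using that h by (auto simp: v_def norm_mult)
  have dini_v: "dini v < \<infinity>"
    unfolding v_def
  proof (rule dini_mult_lipschitz_finite[where B=1 and L=1])
    show "norm (cnj x - cnj y) \<le> 1 * norm (x - y)" for x y
      by (simp flip: complex_cnj_diff)
  qed (use dini h in auto)
  define H where "H s \<zeta> = (\<integral>\<eta>. v \<eta> * (\<eta> / (\<eta> - of_real s * \<zeta>)\<^sup>2) \<partial>circ)" for s \<zeta>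
  define N1 where "N1 s = (\<integral>\<^sup>+\<zeta>. ennreal (norm (H s \<zeta>)) \<partial>circ)" for s
  have [measurable]: "(\<lambda>(s, \<zeta>). H s \<zeta>) \<in> borel_measurable (borel \<Otimes>\<^sub>M borel)"
    unfolding H_def by measurable
  have [measurable]: "N1 \<in> borel_measurable borel"
    unfolding N1_def by measurable
  define J where "J = (\<integral>\<^sup>+s\<in>{0..2}. N1 s \<partial>lborel)"
  have J: "J < \<infinity>"
  proof -
    have "J \<le> ennreal (4 * pi) * dini v"
      unfolding J_def N1_def H_def by (rule nn_integral_cauchy_derivative_le_dini[OF _ v_le]) auto
    also have "\<dots> < \<infinity>" using dini_v by (simp add: ennreal_mult_less_top)
    finally show ?thesis .
  qed
  show thesis
  proof (rule that)
    fix Q :: "complex poly" and N :: real assume N: "\<And>z. norm z < 1 \<Longrightarrow> (1 - norm z) * norm (poly (pderiv Q) z) \<le> N"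
    define q where "q = pderiv Q"
    define X where "X s = (\<integral>\<eta>. of_real (h \<eta>) * (\<eta>\<^sup>2 * poly (pderiv q) (of_real (s\<^sup>2) * \<eta>)) \<partial>circ)" for s :: real
    have N': "norm (poly q 0) \<le> N" using N[of 0] by (simp add: q_def)
    then have N0: "N \<ge> 0" using norm_ge_zero order_trans by blast
    have X_bound: "ennreal (norm (of_real (2 * s * (1 - s\<^sup>2)) * X s)) \<le> ennreal N * N1 s"
      if s: "0 \<le> s" "s \<le> 1" for s
    \<comment> \<open>At both endpoints the Taylor weight 2 s (1 - s^2) vanishes; strictly between
      them the pole s \<eta> lies inside the disc.\<close>
    proof (cases "s = 0 \<or> s = 1")
      case False
      then have s: "0 < s" "s < 1" using that by auto
      obtain C where C: "\<And>z. norm z \<le> 1 \<Longrightarrow> norm (poly q z) \<le> C"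
        by (rule poly_bounded_cball[of q]) blast
      have C0: "C \<ge> 0" using C[of 0] norm_ge_zero[of "poly q 0"] by (simp del: norm_ge_zero)
      \<comment> \<open>Cauchy's formula for the dilated polynomial q(s \<zeta>) at the point s
        \<eta> produces q' at s^2 \<eta>, with a factor 2 pi s. This is where the radius s^2 is
        shared between the polynomial and the kernel.\<close>
      define k where "k \<eta> \<zeta> = of_real (h \<eta>) * \<eta>\<^sup>2 * (poly q (of_real s * \<zeta>) * (\<zeta> / (\<zeta> - of_real s * \<eta>)\<^sup>2))" for \<eta> \<zeta>
      have k_meas: "case_prod k \<in> borel_measurable (borel \<Otimes>\<^sub>M borel)"
        unfolding k_def split_beta' by measurable
      have k_le: "norm (k \<eta> \<zeta>) \<le> C * (1 / (s - 1)\<^sup>2)" if "norm \<eta> = 1" "norm \<zeta> = 1" for \<eta> \<zeta>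
      proof -
        have "norm (k \<eta> \<zeta>) \<le> 1 * norm (poly q (of_real s * \<zeta>)) * norm (\<zeta> / (\<zeta> - of_real s * \<eta>)\<^sup>2)"
          unfolding k_def using that
          by (simp add: norm_mult norm_power norm_divide h divide_right_mono mult_left_le_one_le)
        also have "\<dots> \<le> 1 * C * (1 / (norm (of_real s * \<eta>) - 1)\<^sup>2)"
          using that s C0 by (intro mult_mono C norm_cauchy_kernel_le) (auto simp: norm_mult)
        finally show ?thesis using that s by (simp add: norm_mult)
      qed
      have "of_real (2 * pi * s) * X s = (\<integral>\<eta>. (\<integral>\<zeta>. k \<eta> \<zeta> \<partial>circ) \<partial>circ)"
        unfolding X_def integral_mult_right_zero[symmetric]
      proof (rule integral_arc_cong)
        show "(\<lambda>\<eta>. \<integral>\<zeta>. k \<eta> \<zeta> \<partial>circ) \<in> borel_measurable borel"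
          using k_meas by measurable
        fix \<eta> :: complex assume \<eta>: "norm \<eta> = 1"
        have "(\<integral>\<zeta>. poly q (of_real s * \<zeta>) * (\<zeta> / (\<zeta> - of_real s * \<eta>)\<^sup>2) \<partial>circ)
            = 2 * of_real pi * deriv (\<lambda>\<zeta>. poly q (of_real s * \<zeta>)) (of_real s * \<eta>)"
          using \<eta> s by (intro integral_arc_cauchy_derivative) (auto intro!: holomorphic_intros simp: norm_mult)
        also have "deriv (\<lambda>\<zeta>. poly q (of_real s * \<zeta>)) (of_real s * \<eta>) = of_real s * poly (pderiv q) (of_real s * (of_real s * \<eta>))"
          by (rule DERIV_imp_deriv) (rule derivative_eq_intros refl DERIV_chain2[OF poly_DERIV] | simp)+
        finally show "of_real (2 * pi * s) * (of_real (h \<eta>) * (\<eta>\<^sup>2 * poly (pderiv q) (of_real (s\<^sup>2) * \<eta>))) = (\<integral>\<zeta>. k \<eta> \<zeta> \<partial>circ)"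
          unfolding k_def integral_mult_right_zero by (simp add: power2_eq_square mult_ac)
      qed measurable
      also have "\<dots> = (\<integral>\<zeta>. (\<integral>\<eta>. k \<eta> \<zeta> \<partial>circ) \<partial>circ)"
        by (rule Fubini_arc_bounded[OF k_meas k_le, symmetric])
      also have "\<dots> = (\<integral>\<zeta>. poly q (of_real s * \<zeta>) * inverse \<zeta> * cnj (H s \<zeta>) \<partial>circ)"
      proof (rule integral_arc_cong)
        show "(\<lambda>\<zeta>. \<integral>\<eta>. k \<eta> \<zeta> \<partial>circ) \<in> borel_measurable borel"
          using k_meas by measurable
        fix \<zeta> :: complex assume \<zeta>: "norm \<zeta> = 1"
        have "cnj (H s \<zeta>) = (\<integral>\<eta>. cnj (v \<eta> * (\<eta> / (\<eta> - of_real s * \<zeta>)\<^sup>2)) \<partial>circ)"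
          unfolding H_def by (rule Bochner_Integration.integral_cnj[symmetric])
        then have "poly q (of_real s * \<zeta>) * inverse \<zeta> * cnj (H s \<zeta>)
            = (\<integral>\<eta>. poly q (of_real s * \<zeta>) * inverse \<zeta> * cnj (v \<eta> * (\<eta> / (\<eta> - of_real s * \<zeta>)\<^sup>2)) \<partial>circ)"
          by (simp only: integral_mult_right_zero)
        also have "\<dots> = (\<integral>\<eta>. k \<eta> \<zeta> \<partial>circ)"
        proof (rule integral_arc_cong)
          show "(\<lambda>\<eta>. k \<eta> \<zeta>) \<in> borel_measurable borel"
            unfolding k_def by measurable
          fix \<eta> :: complex assume \<eta>: "norm \<eta> = 1"
          have cnj: "cnj \<eta> = inverse \<eta>" "cnj \<zeta> = inverse \<zeta>"
            using \<eta> \<zeta> complex_norm_square[of \<eta>] complex_norm_square[of \<zeta>]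
            by (simp_all add: inverse_unique)
          have nz: "\<eta> \<noteq> 0" "\<zeta> \<noteq> 0" using \<eta> \<zeta> by auto
          have "\<zeta> - of_real s * \<eta> \<noteq> 0"
          proof
            assume "\<zeta> - of_real s * \<eta> = 0"
            then have "norm \<zeta> = norm (of_real s * \<eta>)" by simp
            then show False using \<eta> \<zeta> s by (simp add: norm_mult)
          qed
          moreover have "inverse \<eta> - of_real s * inverse \<zeta> = (\<zeta> - of_real s * \<eta>) / (\<eta> * \<zeta>)"
            using nz by (simp add: field_simps)
          \<comment> \<open>Conjugation on the circle is inversion, so it exchanges the roles of
            \<zeta> and \<eta> in the kernel: the pole s \<zeta> becomes a pole s \<eta>.\<close>
          ultimately have E: "inverse \<zeta> * (inverse \<eta> / (inverse \<eta> - of_real s * inverse \<zeta>)\<^sup>2) = \<eta> * (\<zeta> / (\<zeta> - of_real s * \<eta>)\<^sup>2)"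
            using nz by (simp add: power_divide power2_eq_square) (simp add: field_simps)
          have "cnj (v \<eta> * (\<eta> / (\<eta> - of_real s * \<zeta>)\<^sup>2))
              = \<eta> * of_real (h \<eta>) * (inverse \<eta> / (inverse \<eta> - of_real s * inverse \<zeta>)\<^sup>2)"
            by (simp add: v_def flip: cnj)
          then have "poly q (of_real s * \<zeta>) * inverse \<zeta> * cnj (v \<eta> * (\<eta> / (\<eta> - of_real s * \<zeta>)\<^sup>2))
              = poly q (of_real s * \<zeta>) * \<eta> * of_real (h \<eta>)
                * (inverse \<zeta> * (inverse \<eta> / (inverse \<eta> - of_real s * inverse \<zeta>)\<^sup>2))"
            by (simp only: mult_ac)
          also have "\<dots> = k \<eta> \<zeta>"
            unfolding E k_def by (simp only: power2_eq_square mult_ac)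
          finally show "poly q (of_real s * \<zeta>) * inverse \<zeta> * cnj (v \<eta> * (\<eta> / (\<eta> - of_real s * \<zeta>)\<^sup>2)) = k \<eta> \<zeta>" .
        qed measurable
        finally show "(\<integral>\<eta>. k \<eta> \<zeta> \<partial>circ) = poly q (of_real s * \<zeta>) * inverse \<zeta> * cnj (H s \<zeta>)" ..
      qed measurable
      finally have "ennreal (norm (of_real (2 * pi * s) * X s))
          \<le> (\<integral>\<^sup>+\<zeta>. ennreal (norm (poly q (of_real s * \<zeta>) * inverse \<zeta> * cnj (H s \<zeta>))) \<partial>circ)"
        by (simp only: norm_integral_le_nn_integral)
      also have "\<dots> \<le> (\<integral>\<^sup>+\<zeta>. ennreal (N / (1 - s)) * ennreal (norm (H s \<zeta>)) \<partial>circ)"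
      proof (rule nn_integral_arc_mono)
        fix \<zeta> :: complex assume \<zeta>: "norm \<zeta> = 1"
        have "norm (poly q (of_real s * \<zeta>)) \<le> N / (1 - s)"
          using N[of "of_real s * \<zeta>"] \<zeta> s by (simp add: norm_mult q_def field_simps)
        from mult_right_mono[OF this norm_ge_zero[of "H s \<zeta>"]]
        show "ennreal (norm (poly q (of_real s * \<zeta>) * inverse \<zeta> * cnj (H s \<zeta>))) \<le> ennreal (N / (1 - s)) * ennreal (norm (H s \<zeta>))"
          using \<zeta> N0 s by (simp add: norm_mult norm_inverse ennreal_leI mult_right_mono flip: ennreal_mult)
      qed
      also have "\<dots> = ennreal (N / (1 - s)) * N1 s"
        unfolding N1_def by (rule nn_integral_cmult) measurable
      finally have le: "ennreal (norm (of_real (2 * pi * s) * X s)) \<le> ennreal (N / (1 - s)) * N1 s" .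
      have "norm (of_real (2 * s * (1 - s\<^sup>2)) * X s) = (1 - s\<^sup>2) / pi * norm (of_real (2 * pi * s) * X s)"
        unfolding norm_mult norm_of_real using s by (simp add: abs_mult power_le_one)
      then have "ennreal (norm (of_real (2 * s * (1 - s\<^sup>2)) * X s)) = ennreal ((1 - s\<^sup>2) / pi) * ennreal (norm (of_real (2 * pi * s) * X s))"
        using s by (subst ennreal_mult[symmetric]) (auto simp: power_le_one)
      also have "\<dots> \<le> ennreal ((1 - s\<^sup>2) / pi) * (ennreal (N / (1 - s)) * N1 s)"
        by (intro mult_left_mono le) simp
      also have "\<dots> = ennreal ((1 - s\<^sup>2) / pi * (N / (1 - s))) * N1 s"
        using s N0 by (subst ennreal_mult) (auto simp: power_le_one mult.assoc)
      also have "\<dots> \<le> ennreal N * N1 s"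
      proof (intro mult_right_mono ennreal_leI)
        \<comment> \<open>The Bloch growth 1 / (1 - s) is absorbed by the Taylor weight; what
          remains is at most 2 / pi.\<close>
        have "(1 - s\<^sup>2) / pi * (N / (1 - s)) = (1 + s) / pi * N"
          using s by (simp add: power2_eq_square field_simps)
        also have "\<dots> \<le> 1 * N"
          using s N0 pi_gt3 by (intro mult_right_mono) (auto simp: field_simps)
        finally show "(1 - s\<^sup>2) / pi * (N / (1 - s)) \<le> N" by simp
      qed simp
      finally show ?thesis .
    qed auto
    let ?w = "\<lambda>\<eta>. complex_of_real (h \<eta>)"
    define T where "T = (\<integral>s. indicator {0..1} s *\<^sub>R (of_real (2 * s * (1 - s\<^sup>2)) * X s) \<partial>lborel)"
    have T_le: "norm T \<le> N * enn2real J"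
    proof -
      have "ennreal (norm T) \<le> (\<integral>\<^sup>+s. ennreal (norm (indicator {0..1} s *\<^sub>R (of_real (2 * s * (1 - s\<^sup>2)) * X s))) \<partial>lborel)"
        unfolding T_def by (rule norm_integral_le_nn_integral)
      also have "\<dots> \<le> (\<integral>\<^sup>+s. ennreal N * (N1 s * indicator {0..2} s) \<partial>lborel)"
      proof (rule nn_integral_mono)
        fix s :: real
        show "ennreal (norm (indicator {0..1} s *\<^sub>R (of_real (2 * s * (1 - s\<^sup>2)) * X s))) \<le> ennreal N * (N1 s * indicator {0..2} s)"
          using X_bound[of s] by (cases "s \<in> {0..1}") auto
      qed
      also have "\<dots> = ennreal N * J"
        unfolding J_def by (rule nn_integral_cmult) measurable
      also have "\<dots> = ennreal (N * enn2real J)"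
        using J N0 by (simp add: ennreal_mult ennreal_enn2real_if less_top)
      finally show ?thesis using N0 by (simp add: ennreal_le_iff)
    qed
    have T_eq: "T = (\<integral>\<eta>. ?w \<eta> * (poly Q \<eta> - poly Q 0 - \<eta> * poly q 0) \<partial>circ)"
    proof -
      obtain C where C: "\<And>z. norm z \<le> 1 \<Longrightarrow> norm (poly (pderiv q) z) \<le> C"
        by (rule poly_bounded_cball[of "pderiv q"]) blast
      have C0: "C \<ge> 0" using C[of 0] norm_ge_zero[of "poly (pderiv q) 0"] by (simp del: norm_ge_zero)
      define f where "f s \<eta> = ?w \<eta> * (of_real (2 * s * (1 - s\<^sup>2)) * (\<eta>\<^sup>2 * poly (pderiv q) (of_real (s\<^sup>2) * \<eta>)))" for s \<eta>
      have f_meas: "case_prod f \<in> borel_measurable (borel \<Otimes>\<^sub>M borel)"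
        unfolding f_def split_beta' by measurable
      have f_le: "norm (f s \<eta>) \<le> 2 * C" if "s \<in> {0..1}" "norm \<eta> = 1" for s \<eta>
      proof -
        have s2: "s\<^sup>2 \<le> 1" using that(1) by (simp add: power_le_one)
        have "norm (f s \<eta>) \<le> 1 * (\<bar>2 * s * (1 - s\<^sup>2)\<bar> * (1 * norm (poly (pderiv q) (of_real (s\<^sup>2) * \<eta>))))"
          unfolding f_def norm_mult norm_power norm_of_real using that(2)
          by (intro mult_mono) (auto simp: h)
        also have "\<dots> \<le> 1 * (2 * (1 * C))"
        proof (intro mult_mono order_refl C)
          show "\<bar>2 * s * (1 - s\<^sup>2)\<bar> \<le> 2"
            using that(1) s2 mult_le_one[of s "1 - s\<^sup>2"] by (simp add: abs_mult)
          show "norm (of_real (s\<^sup>2) * \<eta>) \<le> 1"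
            using that s2 by (simp add: norm_mult norm_power)
        qed (use C0 in auto)
        finally show ?thesis by simp
      qed
      have "T = (\<integral>s. (\<integral>\<eta>. indicator {0..1} s *\<^sub>R f s \<eta> \<partial>circ) \<partial>lborel)"
        unfolding T_def X_def f_def
      proof (intro Bochner_Integration.integral_cong refl)
        fix s :: real
        let ?c = "of_real (2 * s * (1 - s\<^sup>2)) :: complex" and ?g = "\<lambda>\<eta>. \<eta>\<^sup>2 * poly (pderiv q) (of_real (s\<^sup>2) * \<eta>)"
        have "(\<integral>\<eta>. indicator {0..1} s *\<^sub>R (?w \<eta> * (?c * ?g \<eta>)) \<partial>circ) = indicator {0..1} s *\<^sub>R (\<integral>\<eta>. ?c * (?w \<eta> * ?g \<eta>) \<partial>circ)"
          by (simp only: integral_scaleR_right mult.left_commute)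
        then show "indicator {0..1} s *\<^sub>R (?c * (\<integral>\<eta>. ?w \<eta> * ?g \<eta> \<partial>circ)) = (\<integral>\<eta>. indicator {0..1} s *\<^sub>R (?w \<eta> * (?c * ?g \<eta>)) \<partial>circ)"
          by (simp only: integral_mult_right_zero)
      qed
      also have "\<dots> = (\<integral>\<eta>. (\<integral>s. indicator {0..1} s *\<^sub>R f s \<eta> \<partial>lborel) \<partial>circ)"
        by (rule Fubini_Icc_arc_bounded[OF f_meas f_le, symmetric]) (use C0 in auto)
      also have "\<dots> = (\<integral>\<eta>. ?w \<eta> * (poly Q \<eta> - poly Q 0 - \<eta> * poly q 0) \<partial>circ)"
      proof (intro Bochner_Integration.integral_cong refl)
        fix \<eta>
        show "(\<integral>s. indicator {0..1} s *\<^sub>R f s \<eta> \<partial>lborel) = ?w \<eta> * (poly Q \<eta> - poly Q 0 - \<eta> * poly q 0)"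
          unfolding f_def q_def
          by (simp only: mult_scaleR_right[where x="?w \<eta>", symmetric] integral_mult_right_zero poly_taylor_square)
      qed
      finally show ?thesis .
    qed
    obtain CQ where CQ: "\<And>z. norm z \<le> 1 \<Longrightarrow> norm (poly Q z) \<le> CQ"
      by (rule poly_bounded_cball[of Q]) blast
    have int: "integrable circ (\<lambda>\<eta>. poly Q \<eta> * ?w \<eta>)" "integrable circ (\<lambda>\<eta>. ?w \<eta> * (poly Q 0 + \<eta> * poly q 0))"
    proof -
      show "integrable circ (\<lambda>\<eta>. poly Q \<eta> * ?w \<eta>)"
      proof (rule integrable_arc_bounded)
        fix \<eta> :: complex assume "norm \<eta> = 1"
        then show "norm (poly Q \<eta> * ?w \<eta>) \<le> CQ"
          using mult_mono[OF CQ[of \<eta>] h[of \<eta>]] order_trans[OF norm_ge_zero CQ[of \<eta>]] by (simp add: norm_mult)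
      qed measurable
      show "integrable circ (\<lambda>\<eta>. ?w \<eta> * (poly Q 0 + \<eta> * poly q 0))"
      proof (rule integrable_arc_bounded)
        fix \<eta> :: complex assume "norm \<eta> = 1"
        then show "norm (?w \<eta> * (poly Q 0 + \<eta> * poly q 0)) \<le> norm (poly Q 0) + norm (poly q 0)"
          using norm_triangle_ineq[of "poly Q 0" "\<eta> * poly q 0"] mult_mono[OF h[of \<eta>] order_refl[of "norm (poly Q 0 + \<eta> * poly q 0)"]]
          by (simp add: norm_mult)
      qed measurable
    qed
    have "(\<integral>\<eta>. poly Q \<eta> * ?w \<eta> \<partial>circ) = (\<integral>\<eta>. ?w \<eta> * (poly Q 0 + \<eta> * poly q 0) \<partial>circ) + T"
    proof -
      have "T = (\<integral>\<eta>. poly Q \<eta> * ?w \<eta> - ?w \<eta> * (poly Q 0 + \<eta> * poly q 0) \<partial>circ)"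
        unfolding T_eq by (intro Bochner_Integration.integral_cong refl) (simp add: algebra_simps)
      then show ?thesis
        by (simp add: Bochner_Integration.integral_diff[OF int])
    qed
    \<comment> \<open>The first-order part is bounded pointwise, using |Q'(0)| \<le> N, and
      integrated over length 2 pi; the remainder \<open>T\<close> costs the factor
      \<open>J\<close>.\<close>
    also have "norm \<dots> \<le> 2 * pi * (norm (poly Q 0) + N) + N * enn2real J"
    proof (rule order_trans[OF norm_triangle_ineq add_mono[OF norm_integral_arc_le T_le]])
      fix \<eta> :: complex assume "norm \<eta> = 1"
      then show "norm (?w \<eta> * (poly Q 0 + \<eta> * poly q 0)) \<le> norm (poly Q 0) + N"
        using norm_triangle_ineq[of "poly Q 0" "\<eta> * poly q 0"] mult_mono[OF h[of \<eta>] order_refl[of "norm (poly Q 0 + \<eta> * poly q 0)"]] N'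
        by (simp add: norm_mult)
    qed auto
    also have "\<dots> \<le> (2 * pi + enn2real J) * (norm (poly Q 0) + N)"
      by (simp add: algebra_simps)
    finally show "norm (\<integral>\<eta>. poly Q \<eta> * ?w \<eta> \<partial>circ) \<le> (2 * pi + enn2real J) * (norm (poly Q 0) + N)" .
  qed
qed

section \<open>Lebesgue measure on the circle\<close>

lemma circle_lebesgue_eq: "circle_lebesgue = completion (restrict_space circ (sphere 0 1))"
proof -
  let ?M = "distr (restrict_space lborel {0..<2*pi}) (restrict_space borel (sphere 0 1)) cis"
  have sph: "sphere (0::complex) 1 \<in> sets borel" by simp
  have cis: "cis \<in> restrict_space lborel {0..<2*pi} \<rightarrow>\<^sub>M restrict_space borel (sphere 0 1)"
    by (intro measurable_restrict_space2 measurable_restrict_space1) auto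
  have "?M = restrict_space circ (sphere 0 1)"
  proof (rule measure_eqI)
    fix A assume "A \<in> sets ?M"
    then have A: "A \<in> sets (restrict_space borel (sphere 0 1))" by simp
    then have A': "A \<in> sets borel" "A \<subseteq> sphere 0 1"
      using sph by (auto simp: sets_restrict_space_iff)
    have "emeasure ?M A
        = emeasure (restrict_space lborel {0..<2*pi}) (cis -` A \<inter> space (restrict_space lborel {0..<2*pi}))"
      by (rule emeasure_distr[OF cis A])
    also have "\<dots> = emeasure circ A"
      unfolding circ_def by (rule emeasure_distr[symmetric]) (auto simp: A' measurable_restrict_space1)
    also have "\<dots> = emeasure (restrict_space circ (sphere 0 1)) A"
      using A' sph by (subst emeasure_restrict_space) auto
    finally show "emeasure ?M A
        = emeasure (restrict_space circ (sphere 0 1)) A" .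
  qed (simp add: sets_restrict_space)
  then show ?thesis by (simp add: circle_lebesgue_def)
qed

lemma null_sets_circle_lebesgueI:
  assumes "Z \<in> sets borel" "Z \<subseteq> sphere 0 1" "emeasure circ Z = 0" "X \<subseteq> Z"
  shows "X \<in> null_sets circle_lebesgue"
proof -
  have sph: "sphere (0::complex) 1 \<in> sets borel" by simp
  have "Z \<in> null_sets (restrict_space circ (sphere 0 1))"
    using assms sph by (auto simp: null_sets_def sets_restrict_space_iff emeasure_restrict_space)
  then show ?thesis
    unfolding circle_lebesgue_eq using assms(4) null_sets_completion_subset null_sets_completionI by blast
qed

text \<open>X agrees with the Borel set \<open>D\<close> off the null set \<open>Z\<close>.
  Completeness makes the discrepancy measurable, so X need not be Borel.\<close>

lemma circle_lebesgue_sandwich: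
  assumes D: "D \<in> sets borel" "D \<subseteq> sphere 0 1"
    and Z: "Z \<in> sets borel" "Z \<subseteq> sphere 0 1" "emeasure circ Z = 0"
    and X: "D - Z \<subseteq> X" "X \<subseteq> D \<union> Z"
  shows "X \<in> sets circle_lebesgue" "emeasure circle_lebesgue X = emeasure circ D"
proof -
  have sph: "sphere (0::complex) 1 \<in> sets borel" by simp
  have eq: "X = (D - Z) \<union> (X \<inter> Z)" using X by auto
  have null: "X \<inter> Z \<in> null_sets circle_lebesgue"
    by (rule null_sets_circle_lebesgueI[OF Z]) auto
  have DZ: "D - Z \<in> sets (restrict_space circ (sphere 0 1))"
    using D Z sph by (auto simp: sets_restrict_space_iff)
  then have DZ': "D - Z \<in> sets circle_lebesgue"
    unfolding circle_lebesgue_eq by (rule sets_completionI_sets)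
  show "X \<in> sets circle_lebesgue"
    using DZ' null by (subst eq) auto
  have "emeasure circle_lebesgue X = emeasure circle_lebesgue (D - Z)"
    by (subst eq, rule emeasure_Un_null_set[OF DZ' null])
  also have "\<dots> = emeasure (restrict_space circ (sphere 0 1)) (D - Z)"
    unfolding circle_lebesgue_eq using DZ by simp
  also have "\<dots> = emeasure circ (D - Z)"
    using D Z sph by (subst emeasure_restrict_space) auto
  also have "\<dots> = emeasure circ D"
    using D Z by (intro emeasure_Diff_null_set) (auto simp: null_sets_def)
  finally show "emeasure circle_lebesgue X = emeasure circ D" .
qed

text \<open>The core \<open>B\<close> is chosen inside \<open>E\<close>, so that functions supported
  on \<open>B\<close> vanish outside \<open>E\<close> at every point, and the defect is covered by a
  Borel null set that can itself be rotated.\<close>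

lemma circle_lebesgue_borel_core:
  assumes "E \<in> sets circle_lebesgue"
  obtains B Z where "B \<in> sets borel" "B \<subseteq> E" "E \<subseteq> sphere 0 1" "Z \<in> sets borel" "Z \<subseteq> sphere 0 1"
    "emeasure circ Z = 0" "E - B \<subseteq> Z"
proof -
  have sph: "sphere (0::complex) 1 \<in> sets borel" by simp
  obtain S N N' where *: "E = S \<union> N" "N \<subseteq> N'" "N' \<in> null_sets (restrict_space circ (sphere 0 1))"
    "S \<in> sets (restrict_space circ (sphere 0 1))"
    using sets_completionE[OF assms[unfolded circle_lebesgue_eq]] by metis
  have 1: "S \<in> sets borel" "S \<subseteq> sphere 0 1" "N' \<in> sets borel" "N' \<subseteq> sphere 0 1"
    using * sph by (auto simp: sets_restrict_space_iff null_sets_def)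
  moreover have "emeasure circ N' = 0"
    using *(3) 1 sph by (auto simp: null_sets_def emeasure_restrict_space)
  ultimately show thesis
    using * by (intro that[of S N']) auto
qed

section \<open>From translates of \<open>E\<close> to the Dini integral\<close>

lemma osc_inverse:
  assumes [measurable]: "v \<in> borel_measurable borel" and \<xi>: "norm \<xi> = 1"
  shows "osc v (inverse \<xi>) = osc v \<xi>"
proof -
  have "\<xi> \<noteq> 0" using \<xi> by auto
  then have "osc v (inverse \<xi>) = (\<integral>\<^sup>+\<zeta>. ennreal (norm (v \<zeta> - v (\<xi> * \<zeta>))) \<partial>circ)"
    unfolding osc_def
    by (subst nn_integral_arc_rotate[OF _ \<xi>, symmetric]) (auto simp flip: mult.assoc)
  then show ?thesis by (simp add: osc_def norm_minus_commute)
qed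

text \<open>Membership in the translate is membership in \<open>E\<close> after rotating by -t.
  Replacing \<open>E\<close> by \<open>B\<close> changes the symmetric difference only on
  \<open>Z\<close> and a rotated copy of it, and the oscillation at -t equals that at t.\<close>

lemma emeasure_sym_diff_translate:
  assumes E: "E \<in> sets circle_lebesgue"
    and B: "B \<in> sets borel" "B \<subseteq> E" "E \<subseteq> sphere 0 1"
    and Z: "Z \<in> sets borel" "Z \<subseteq> sphere 0 1" "emeasure circ Z = 0" "E - B \<subseteq> Z"
  shows "emeasure circle_lebesgue (sym_diff (circle_translate E t) E) = osc (indicat_real B) (cis t)"
proof -
  note [measurable] = B(1) Z(1)
  have mem: "\<zeta> \<in> circle_translate E t \<longleftrightarrow> cis (-t) * \<zeta> \<in> E" for \<zeta>
  proof
    assume "\<zeta> \<in> circle_translate E t"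
    then obtain s where "\<zeta> = cis (s + t)" "cis s \<in> E" by (auto simp: circle_translate_def)
    then show "cis (-t) * \<zeta> \<in> E" by (simp add: cis_mult)
  next
    assume *: "cis (-t) * \<zeta> \<in> E"
    then have "norm (cis (-t) * \<zeta>) = 1" using B(3) by auto
    then obtain s where s: "cis (-t) * \<zeta> = cis s"
      using complex_unimodular_polar[of "cis (-t) * \<zeta>"] by (metis cis.code)
    have "\<zeta> = cis t * (cis (-t) * \<zeta>)" by (simp add: cis_mult flip: mult.assoc)
    also have "\<dots> = cis (s + t)" by (simp add: s cis_mult add.commute)
    finally show "\<zeta> \<in> circle_translate E t"
      using * s by (auto simp: circle_translate_def)
  qed
  define D where "D = {\<zeta>. (cis (-t) * \<zeta> \<in> B) \<noteq> (\<zeta> \<in> B)}"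
  define Y where "Y = Z \<union> {\<zeta>. cis (-t) * \<zeta> \<in> Z}"
  have D: "D \<in> sets borel" unfolding D_def by measurable
  have Y: "Y \<in> sets borel" unfolding Y_def by measurable
  have sub: "{\<zeta>. cis (-t) * \<zeta> \<in> X} \<subseteq> sphere 0 1" if "X \<subseteq> sphere 0 1" for X
    using that by (auto simp: norm_mult dest!: subsetD)
  have "emeasure circle_lebesgue (sym_diff (circle_translate E t) E) = emeasure circ D"
  proof (rule circle_lebesgue_sandwich(2)[OF D _ Y])
    show "D \<subseteq> sphere 0 1" using sub[of B] B by (auto simp: D_def)
    show "Y \<subseteq> sphere 0 1" using sub[of Z] Z by (auto simp: Y_def)
    have "emeasure circ {\<zeta>. cis (-t) * \<zeta> \<in> Z} = (\<integral>\<^sup>+\<zeta>. indicator Z (cis (-t) * \<zeta>) \<partial>circ)"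
    proof -
      have "{\<zeta>. cis (-t) * \<zeta> \<in> Z} \<in> sets circ" by measurable
      then have "emeasure circ {\<zeta>. cis (-t) * \<zeta> \<in> Z} = (\<integral>\<^sup>+\<zeta>. indicator {\<zeta>. cis (-t) * \<zeta> \<in> Z} \<zeta> \<partial>circ)"
        by (rule nn_integral_indicator[symmetric])
      also have "\<dots> = (\<integral>\<^sup>+\<zeta>. indicator Z (cis (-t) * \<zeta>) \<partial>circ)"
        by (intro nn_integral_cong) (simp split: split_indicator)
      finally show ?thesis .
    qed
    also have "\<dots> = emeasure circ Z"
      by (subst nn_integral_arc_rotate) auto
    finally have "emeasure circ {\<zeta>. cis (-t) * \<zeta> \<in> Z} = 0" using Z by simp
    then show "emeasure circ Y = 0"
      unfolding Y_def using Z emeasure_subadditive[of Z circ "{\<zeta>. cis (-t) * \<zeta> \<in> Z}"] by simp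
    show "D - Y \<subseteq> sym_diff (circle_translate E t) E" "sym_diff (circle_translate E t) E \<subseteq> D \<union> Y"
      using B(2) Z(4) by (auto simp: D_def Y_def mem)
  qed
  also have "emeasure circ D = osc (indicat_real B) (cis (-t))"
  proof -
    have "emeasure circ D = (\<integral>\<^sup>+\<zeta>. indicator D \<zeta> \<partial>circ)"
      using D by simp
    also have "\<dots> = osc (indicat_real B) (cis (-t))"
      unfolding osc_def by (intro nn_integral_cong) (auto simp: D_def split: split_indicator)
    finally show ?thesis .
  qed
  also have "\<dots> = osc (indicat_real B) (cis t)"
    using osc_inverse[of "indicat_real B" "cis t"] by simp
  finally show ?thesis .
qed

text \<open>Up to 1 the mean value theorem applies with cosine at least cos (pi / 3) = 1/2. Beyond 1
  monotonicity gives sin x \<ge> sin 1 \<ge> 1/2, while x / 4 stays below 1/2.\<close>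

lemma sin_ge_quarter:
  assumes "0 \<le> x" "x \<le> pi / 2"
  shows "x / 4 \<le> sin x"
proof -
  have small: "y / 2 \<le> sin y" if "0 \<le> y" "y \<le> 1" for y :: real
  proof (cases "y = 0")
    case False
    then have "y > 0" using that by simp
    then obtain z where z: "0 < z" "z < y" "sin y - sin 0 = (y - 0) * cos z"
      using MVT2[of 0 y sin cos] by (auto intro: DERIV_sin)
    have "cos (pi / 3) \<le> cos z"
      using z that pi_gt3 by (intro cos_monotone_0_pi_le) auto
    then have "1 / 2 \<le> cos z" by (simp add: cos_60)
    then show ?thesis using z mult_left_mono[of "1/2" "cos z" y] \<open>y > 0\<close> by simp
  qed simp
  show ?thesis
  proof (cases "x \<le> 1")
    case True
    then show ?thesis using small[of x] assms by simp
  next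
    case False
    then have "sin 1 \<le> sin x" using assms by (intro sin_monotone_2pi_le) auto
    then show ?thesis using small[of 1] assms pi_less_4 by simp
  qed
qed

text \<open>Reflection in the real axis reduces the circle to angles in (0, pi], where the chord is
  at least \<theta> / 4. On (0, 1] the hypothesis bounds the integral; on the rest the quotient is
  bounded.\<close>

lemma dini_finite_if_integrable_modulus:
  fixes v :: "complex \<Rightarrow> 'a :: {real_normed_vector, second_countable_topology}"
  assumes [measurable]: "v \<in> borel_measurable borel" and v: "\<And>\<zeta>. norm \<zeta> = 1 \<Longrightarrow> norm (v \<zeta>) \<le> 1"
    and fin: "(\<integral>\<^sup>+t\<in>{0<..1}. osc v (cis t) / ennreal t \<partial>lborel) < \<infinity>"
  shows "dini v < \<infinity>"
proof -
  define F where "F \<theta> = osc v (cis \<theta>) / ennreal (norm (cis \<theta> - 1))" for \<theta>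
  have [measurable]: "F \<in> borel_measurable borel"
    unfolding F_def by measurable
  have osc_le: "osc v (cis \<theta>) \<le> ennreal (4 * pi)" for \<theta>
  proof -
    have "osc v (cis \<theta>) \<le> 2 * (\<integral>\<^sup>+\<zeta>. ennreal (norm (v \<zeta>)) \<partial>circ)"
      by (rule osc_le_norm) auto
    also have "\<dots> \<le> 2 * (\<integral>\<^sup>+\<zeta>. 1 \<partial>circ)"
      using v by (intro mult_left_mono nn_integral_arc_mono) auto
    also have "\<dots> = ennreal (4 * pi)"
      using ennreal_mult[of 2 "2 * pi"] by (simp add: emeasure_arc_UNIV)
    finally show ?thesis .
  qed
  have F_neg: "F (2 * pi - \<theta>) = F \<theta>" for \<theta>
  proof -
    have "cis (2 * pi - \<theta>) = cis (-\<theta>)"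
      by (simp add: complex_eq_iff cos_diff sin_diff)
    also have "\<dots> = inverse (cis \<theta>)" by simp
    finally have eq: "cis (2 * pi - \<theta>) = inverse (cis \<theta>)" .
    have "inverse (cis \<theta>) - 1 = - (inverse (cis \<theta>) * (cis \<theta> - 1))"
      by (simp add: algebra_simps cis_mult)
    then have "norm (inverse (cis \<theta>) - 1) = norm (cis \<theta> - 1)"
      by (simp only: norm_minus_cancel norm_mult norm_inverse norm_cis) simp
    then show ?thesis
      unfolding F_def eq by (simp only: osc_inverse[OF assms(1) norm_cis])
  qed
  have F_half: "(\<integral>\<^sup>+\<theta>\<in>{0<..pi}. F \<theta> \<partial>lborel) < \<infinity>"
  proof -
    have "(\<integral>\<^sup>+\<theta>\<in>{0<..pi}. F \<theta> \<partial>lborel)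
        \<le> (\<integral>\<^sup>+\<theta>. 4 * (osc v (cis \<theta>) / ennreal \<theta> * indicator {0<..1} \<theta>) + ennreal (16 * pi) * indicator {0..pi} \<theta> \<partial>lborel)"
    proof (rule nn_integral_mono)
      fix \<theta> :: real
      show "F \<theta> * indicator {0<..pi} \<theta> \<le> 4 * (osc v (cis \<theta>) / ennreal \<theta> * indicator {0<..1} \<theta>) + ennreal (16 * pi) * indicator {0..pi} \<theta>"
      proof (cases "\<theta> \<in> {0<..pi}")
        case True
        then have "\<theta> / 4 \<le> norm (cis \<theta> - 1)"
          using sin_ge_quarter[of "\<theta> / 2"] by (simp add: norm_cis_minus_1)
        then have "inverse (norm (cis \<theta> - 1)) \<le> 4 * inverse \<theta>"
          using True le_imp_inverse_le[of "\<theta> / 4" "norm (cis \<theta> - 1)"] by (simp add: inverse_eq_divide)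
        moreover have "norm (cis \<theta> - 1) > 0"
          using True \<open>\<theta> / 4 \<le> norm (cis \<theta> - 1)\<close> by (auto intro: less_le_trans[of _ "\<theta> / 4"])
        ultimately have "F \<theta> \<le> osc v (cis \<theta>) * ennreal (4 * inverse \<theta>)"
          unfolding F_def divide_ennreal_def by (subst inverse_ennreal) (auto intro!: mult_left_mono ennreal_leI)
        also have "\<dots> = 4 * (osc v (cis \<theta>) * ennreal (inverse \<theta>))"
          using True by (subst ennreal_mult) (auto simp: mult_ac)
        finally have F_le: "F \<theta> \<le> 4 * (osc v (cis \<theta>) * ennreal (inverse \<theta>))" .
        show ?thesis
        proof (cases "\<theta> \<le> 1")
          case True
          then show ?thesis
            using F_le \<open>\<theta> \<in> {0<..pi}\<close> by (auto simp: divide_ennreal_def inverse_ennreal intro: order_trans)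
        next
          case False
          \<comment> \<open>For \<theta> > 1 the oscillation is at most twice the L1 norm, hence at
            most 4 pi; the remaining 4 comes from the chord.\<close>
          then have "4 * (osc v (cis \<theta>) * ennreal (inverse \<theta>)) \<le> 4 * (ennreal (4 * pi) * ennreal 1)"
            by (intro mult_left_mono mult_mono osc_le ennreal_leI) (auto simp: inverse_le_1_iff)
          also have "\<dots> = ennreal (16 * pi)"
            using ennreal_mult[of 4 "4 * pi"] by simp
          finally show ?thesis using F_le False \<open>\<theta> \<in> {0<..pi}\<close> by (auto intro: order_trans)
        qed
      qed simp
    qed
    also have "\<dots> = 4 * (\<integral>\<^sup>+t\<in>{0<..1}. osc v (cis t) / ennreal t \<partial>lborel) + ennreal (16 * pi) * ennreal pi"
      by (subst nn_integral_add) (auto simp: nn_integral_cmult nn_integral_cmult_indicator)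
    also have "\<dots> < \<infinity>"
      using fin by (simp add: less_top[symmetric] ennreal_add_eq_top ennreal_mult_eq_top_iff)
    finally show ?thesis .
  qed
  have "dini v = (\<integral>\<^sup>+\<theta>\<in>{0..<2*pi}. F \<theta> \<partial>lborel)"
    unfolding dini_def F_def by (rule nn_integral_arc) simp
  \<comment> \<open>The angle 0 is left out, where F is 0 / 0 = 0, and the angle pi is counted
    twice.\<close>
  also have "\<dots> \<le> (\<integral>\<^sup>+\<theta>. F \<theta> * indicator {0<..pi} \<theta> + F \<theta> * indicator {pi..<2*pi} \<theta> \<partial>lborel)"
  proof (rule nn_integral_mono)
    fix \<theta>
    show "F \<theta> * indicator {0..<2*pi} \<theta> \<le> F \<theta> * indicator {0<..pi} \<theta> + F \<theta> * indicator {pi..<2*pi} \<theta>"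
      by (cases "\<theta> = 0") (auto simp: F_def split: split_indicator)
  qed
  also have "\<dots> = (\<integral>\<^sup>+\<theta>\<in>{0<..pi}. F \<theta> \<partial>lborel) + (\<integral>\<^sup>+\<theta>\<in>{pi..<2*pi}. F \<theta> \<partial>lborel)"
    by (rule nn_integral_add) auto
  also have "(\<integral>\<^sup>+\<theta>\<in>{pi..<2*pi}. F \<theta> \<partial>lborel) = (\<integral>\<^sup>+\<theta>\<in>{0<..pi}. F \<theta> \<partial>lborel)"
    by (subst nn_integral_real_affine[where c="-1" and t="2 * pi"])
       (auto intro!: nn_integral_cong split: split_indicator simp: F_neg)
  finally show ?thesis
    using F_half by (auto simp: less_top[symmetric] ennreal_add_eq_top top_unique)
qed

section \<open>Rigidity\<close>

text \<open>The vanishing limit handles an annulus next to the circle, and continuity of the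
  derivative handles the remaining closed disc. This makes the supremum in \<open>bloch_norm\<close>
  a genuine one.\<close>

lemma little_bloch_bdd_above:
  assumes g: "g \<in> little_bloch"
  shows "bdd_above ((\<lambda>z. (1 - norm z) * norm (deriv g z)) ` ball 0 1)"
proof -
  have hol: "g holomorphic_on ball 0 1"
    and lim: "((\<lambda>z. (1 - norm z) *\<^sub>R deriv g z) \<longlongrightarrow> 0) (filtercomap norm (at_left 1))"
    using g by (auto simp: little_bloch_def)
  have "eventually (\<lambda>z. norm ((1 - norm z) *\<^sub>R deriv g z) < 1) (filtercomap norm (at_left 1))"
    using tendstoD[OF lim, of 1] by simp
  then obtain P where P: "eventually P (at_left (1::real))"
    "\<And>z. P (norm z) \<Longrightarrow> norm ((1 - norm z) *\<^sub>R deriv g z) < 1"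
    unfolding eventually_filtercomap by blast
  then obtain b where b: "b < 1" "\<And>y. b < y \<Longrightarrow> y < 1 \<Longrightarrow> P y"
    unfolding eventually_at_left_field by blast
  have "deriv g holomorphic_on ball 0 1"
    using hol by (rule holomorphic_deriv) simp
  then have "continuous_on (cball 0 b) (deriv g)"
    using b(1) by (intro holomorphic_on_imp_continuous_on) (auto elim!: holomorphic_on_subset)
  then have "bounded (deriv g ` cball 0 b)"
    by (intro compact_imp_bounded compact_continuous_image) auto
  then obtain C where "\<forall>x\<in>deriv g ` cball 0 b. norm x \<le> C"
    unfolding bounded_iff ..
  then have C: "norm (deriv g z) \<le> C" if "norm z \<le> b" for z
    using that by simp
  show ?thesis
  proof (rule bdd_aboveI2)
    fix z :: complex assume z: "z \<in> ball 0 1"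
    show "(1 - norm z) * norm (deriv g z) \<le> max C 1"
    proof (cases "norm z \<le> b")
      case True
      then have "(1 - norm z) * norm (deriv g z) \<le> 1 * C"
        using C z by (intro mult_mono) auto
      then show ?thesis by simp
    next
      case False
      then have "norm ((1 - norm z) *\<^sub>R deriv g z) < 1"
        using z by (intro P b) auto
      then show ?thesis using z by simp
    qed
  qed
qed

lemma bloch_norm_ge:
  assumes g: "g \<in> little_bloch"
  shows "norm (g 0) \<le> bloch_norm g" "norm z < 1 \<Longrightarrow> (1 - norm z) * norm (deriv g z) \<le> bloch_norm g"
proof -
  have le: "(1 - norm z) * norm (deriv g z) \<le> (SUP z\<in>ball 0 1. (1 - norm z) * norm (deriv g z))"
    if "norm z < 1" for z
    using little_bloch_bdd_above[OF g] that by (intro cSUP_upper) auto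
  have "0 \<le> (1 - norm (0::complex)) * norm (deriv g 0)" by simp
  also note le[of 0]
  finally show "norm (g 0) \<le> bloch_norm g" by (simp add: bloch_norm_def)
  show "(1 - norm z) * norm (deriv g z) \<le> bloch_norm g" if "norm z < 1"
    unfolding bloch_norm_def using le[OF that] norm_ge_zero[of "g 0"] by linarith
qed

lemma deriv_diff_on_ball:
  assumes "f holomorphic_on ball 0 1" "g holomorphic_on ball 0 1" "norm z < 1"
  shows "deriv (\<lambda>z. f z - g z) z = deriv f z - deriv g z"
  using assms by (intro deriv_diff) (auto intro: holomorphic_on_imp_differentiable_at)

lemma little_bloch_diff:
  assumes f: "f \<in> little_bloch" and g: "g \<in> little_bloch"
  shows "(\<lambda>z. f z - g z) \<in> little_bloch"
proof -
  have hol: "f holomorphic_on ball 0 1" "g holomorphic_on ball 0 1"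
    using f g by (auto simp: little_bloch_def)
  have "((\<lambda>z. (1 - norm z) *\<^sub>R deriv f z - (1 - norm z) *\<^sub>R deriv g z) \<longlongrightarrow> 0 - 0) (filtercomap norm (at_left 1))"
    using f g by (intro tendsto_diff) (auto simp: little_bloch_def)
  moreover have "eventually (\<lambda>z. norm z < 1) (filtercomap (norm :: complex \<Rightarrow> real) (at_left 1))"
    by (auto simp: eventually_filtercomap eventually_at_filter intro!: exI[of _ "\<lambda>x. x < 1"])
  then have "eventually (\<lambda>z. (1 - norm z) *\<^sub>R deriv f z - (1 - norm z) *\<^sub>R deriv g z
      = (1 - norm z) *\<^sub>R deriv (\<lambda>z. f z - g z) z) (filtercomap norm (at_left 1))"
    by eventually_elim (simp add: deriv_diff_on_ball[OF hol] scaleR_diff_right)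
  ultimately have "((\<lambda>z. (1 - norm z) *\<^sub>R deriv (\<lambda>z. f z - g z) z) \<longlongrightarrow> 0) (filtercomap norm (at_left 1))"
    by (simp add: tendsto_cong)
  then show ?thesis
    using hol by (auto simp: little_bloch_def intro: holomorphic_intros)
qed

section \<open>Polynomial approximation in the closure\<close>

lemma topspace_little_bloch_topology_subset: "topspace little_bloch_topology \<subseteq> little_bloch"
  unfolding little_bloch_topology_def topology_generated_by_topspace by auto

lemma topspace_weak_star_topology_subset: "topspace (weak_star_topology E) \<subseteq> Linfty E"
  unfolding weak_star_topology_def topology_generated_by_topspace by auto

lemma P_little_bloch_approx:
  assumes fg: "(f, g) \<in> P_little_bloch E" and h: "integrable (circle_lebesgue_on E) h" and \<epsilon>: "\<epsilon> > 0"
  obtains Q where "poly Q \<in> little_bloch" "poly Q \<in> Linfty E" "bloch_norm (\<lambda>z. poly Q z - f z) < \<epsilon>"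
    "norm ((LINT \<zeta>|circle_lebesgue_on E. poly Q \<zeta> * h \<zeta>) - (LINT \<zeta>|circle_lebesgue_on E. g \<zeta> * h \<zeta>)) < \<epsilon>"
proof -
  have clos: "(f, g) \<in> topspace (prod_topology little_bloch_topology (weak_star_topology E))"
    "\<And>T. (f, g) \<in> T \<Longrightarrow> openin (prod_topology little_bloch_topology (weak_star_topology E)) T \<Longrightarrow>
       \<exists>Q. (poly Q, poly Q) \<in> T"
    using fg unfolding P_little_bloch_def in_closure_of by auto
  have f: "f \<in> little_bloch" and g: "g \<in> Linfty E"
    using clos(1) topspace_little_bloch_topology_subset topspace_weak_star_topology_subset by auto
  define U where "U = {k \<in> little_bloch. bloch_norm (\<lambda>z. k z - f z) < \<epsilon>}"
  define V where "V = {k \<in> Linfty E. (LINT \<zeta>|circle_lebesgue_on E. k \<zeta> * h \<zeta>) \<in> ball (LINT \<zeta>|circle_lebesgue_on E. g \<zeta> * h \<zeta>) \<epsilon>}"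
  have "openin little_bloch_topology U"
    unfolding little_bloch_topology_def U_def using f \<epsilon> by (intro topology_generated_by_Basis) blast
  moreover have "openin (weak_star_topology E) V"
    unfolding weak_star_topology_def
  proof (rule topology_generated_by_Basis)
    show "V \<in> {{g \<in> Linfty E. (LINT \<zeta>|circle_lebesgue_on E. g \<zeta> * h \<zeta>) \<in> U} | h U.
        integrable (circle_lebesgue_on E) h \<and> open U}"
      unfolding V_def using h by blast
  qed
  ultimately have "openin (prod_topology little_bloch_topology (weak_star_topology E)) (U \<times> V)"
    by (simp add: openin_prod_Times_iff)
  moreover have "f \<in> U"
    using f \<epsilon> by (simp add: U_def bloch_norm_def)
  moreover have "g \<in> V"
    using g \<epsilon> by (simp add: V_def)
  ultimately obtain Q where "poly Q \<in> U" "poly Q \<in> V"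
    using clos(2)[of "U \<times> V"] by auto
  then show thesis
    by (intro that[of Q]) (auto simp: U_def V_def dist_norm norm_minus_commute)
qed

lemma integrable_Linfty_mult:
  assumes g: "g \<in> Linfty E" and h: "integrable (circle_lebesgue_on E) h"
  shows "integrable (circle_lebesgue_on E) (\<lambda>\<zeta>. g \<zeta> * h \<zeta>)"
proof -
  obtain C where C: "AE \<zeta> in circle_lebesgue_on E. norm (g \<zeta>) \<le> C"
    and [measurable]: "g \<in> borel_measurable (circle_lebesgue_on E)"
    using g by (auto simp: Linfty_def)
  have [measurable]: "h \<in> borel_measurable (circle_lebesgue_on E)"
    using h by simp
  show ?thesis
  proof (rule Bochner_Integration.integrable_bound)
    show "integrable (circle_lebesgue_on E) (\<lambda>\<zeta>. C * norm (h \<zeta>))"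
      using h by simp
    show "AE \<zeta> in circle_lebesgue_on E. norm (g \<zeta> * h \<zeta>) \<le> norm (C * norm (h \<zeta>))"
      using C
    proof eventually_elim
      case (elim \<zeta>)
      then have "norm (g \<zeta>) * norm (h \<zeta>) \<le> C * norm (h \<zeta>)" by (intro mult_right_mono) auto
      then show ?case by (simp add: norm_mult)
    qed
  qed simp
qed

text \<open>Approximants Q1 and Q2 of the two pairs have a difference of small Bloch norm, as the
  first components agree on the disc. The bound \<open>C\<close> applies to this difference because
  it is a polynomial; it could not be applied to f_1 - f_2, which carries no information on the
  circle.\<close>

lemma P_little_bloch_pairing_eq:
  assumes 1: "(f\<^sub>1, g\<^sub>1) \<in> P_little_bloch E" and 2: "(f\<^sub>2, g\<^sub>2) \<in> P_little_bloch E"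
    and eq: "\<And>z. z \<in> ball 0 1 \<Longrightarrow> f\<^sub>1 z = f\<^sub>2 z"
    and h: "integrable (circle_lebesgue_on E) h"
    and C: "\<And>Q N. (\<And>z. norm z < 1 \<Longrightarrow> (1 - norm z) * norm (poly (pderiv Q) z) \<le> N) \<Longrightarrow>
      norm (LINT \<zeta>|circle_lebesgue_on E. poly Q \<zeta> * h \<zeta>) \<le> C * (norm (poly Q 0) + N)"
  shows "(LINT \<zeta>|circle_lebesgue_on E. g\<^sub>1 \<zeta> * h \<zeta>) = (LINT \<zeta>|circle_lebesgue_on E. g\<^sub>2 \<zeta> * h \<zeta>)"
proof -
  let ?L = "\<lambda>g. LINT \<zeta>|circle_lebesgue_on E. g \<zeta> * h \<zeta>"
  have f: "f\<^sub>1 \<in> little_bloch" "f\<^sub>2 \<in> little_bloch"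
    using 1 2 topspace_little_bloch_topology_subset unfolding P_little_bloch_def in_closure_of by auto
  have f_deriv: "deriv f\<^sub>1 z = deriv f\<^sub>2 z" if "norm z < 1" for z
    using that eq by (intro deriv_cong_ev eventually_nhds_in_open[THEN eventually_mono, of "ball 0 1"]) auto
  have hol: "f\<^sub>1 holomorphic_on ball 0 1" "f\<^sub>2 holomorphic_on ball 0 1"
    using f by (auto simp: little_bloch_def)
  \<comment> \<open>Each weak-star approximation costs \<epsilon>. The value at 0 and the derivative
    bound of Q1 - Q2 are each at most 2 \<epsilon>.\<close>
  have small: "norm (?L g\<^sub>1 - ?L g\<^sub>2) \<le> (2 + 4 * \<bar>C\<bar>) * \<epsilon>" if \<epsilon>: "\<epsilon> > 0" for \<epsilon>
  proof -
    obtain Q1 where Q1: "poly Q1 \<in> little_bloch" "poly Q1 \<in> Linfty E" "bloch_norm (\<lambda>z. poly Q1 z - f\<^sub>1 z) < \<epsilon>"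
      "norm (?L (poly Q1) - ?L g\<^sub>1) < \<epsilon>"
      by (rule P_little_bloch_approx[OF 1 h \<epsilon>])
    obtain Q2 where Q2: "poly Q2 \<in> little_bloch" "poly Q2 \<in> Linfty E" "bloch_norm (\<lambda>z. poly Q2 z - f\<^sub>2 z) < \<epsilon>"
      "norm (?L (poly Q2) - ?L g\<^sub>2) < \<epsilon>"
      by (rule P_little_bloch_approx[OF 2 h \<epsilon>])
    note ge1 = bloch_norm_ge[OF little_bloch_diff[OF Q1(1) f(1)]]
    note ge2 = bloch_norm_ge[OF little_bloch_diff[OF Q2(1) f(2)]]
    define R where "R = Q1 - Q2"
    have poly_deriv: "deriv (poly Q) z = poly (pderiv Q) z" for Q :: "complex poly" and z
      by (rule DERIV_imp_deriv) (rule poly_DERIV)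
    have poly_hol: "poly Q holomorphic_on ball 0 1" for Q :: "complex poly"
      by (intro holomorphic_intros)
    have "poly R 0 = (poly Q1 0 - f\<^sub>1 0) - (poly Q2 0 - f\<^sub>2 0)"
      using eq[of 0] by (simp add: R_def)
    then have R0: "norm (poly R 0) \<le> 2 * \<epsilon>"
      using norm_triangle_ineq4[of "poly Q1 0 - f\<^sub>1 0" "poly Q2 0 - f\<^sub>2 0"] ge1(1) ge2(1) Q1(3) Q2(3) by simp
    have R': "(1 - norm z) * norm (poly (pderiv R) z) \<le> 2 * \<epsilon>" if z: "norm z < 1" for z
    proof -
      have "poly (pderiv R) z = deriv (\<lambda>z. poly Q1 z - f\<^sub>1 z) z - deriv (\<lambda>z. poly Q2 z - f\<^sub>2 z) z"
        using z f_deriv[OF z] by (simp add: deriv_diff_on_ball[OF poly_hol] hol poly_deriv R_def pderiv_diff)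
      then have "norm (poly (pderiv R) z) \<le> norm (deriv (\<lambda>z. poly Q1 z - f\<^sub>1 z) z) + norm (deriv (\<lambda>z. poly Q2 z - f\<^sub>2 z) z)"
        by (simp add: norm_triangle_ineq4)
      then have "(1 - norm z) * norm (poly (pderiv R) z)
          \<le> (1 - norm z) * (norm (deriv (\<lambda>z. poly Q1 z - f\<^sub>1 z) z) + norm (deriv (\<lambda>z. poly Q2 z - f\<^sub>2 z) z))"
        using z by (intro mult_left_mono) auto
      also have "\<dots> \<le> 2 * \<epsilon>"
        using ge1(2)[OF z] ge2(2)[OF z] Q1(3) Q2(3) by (simp add: distrib_left)
      finally show ?thesis .
    qed
    have "norm (?L (poly R)) \<le> C * (norm (poly R 0) + 2 * \<epsilon>)"
      using R' by (rule C[of R "2 * \<epsilon>"])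
    also have "\<dots> \<le> \<bar>C\<bar> * (4 * \<epsilon>)"
      using R0 \<epsilon> by (intro mult_mono) auto
    finally have LR: "norm (?L (poly R)) \<le> \<bar>C\<bar> * (4 * \<epsilon>)" .
    have "?L (poly R) = ?L (poly Q1) - ?L (poly Q2)"
      by (simp add: R_def left_diff_distrib Bochner_Integration.integral_diff integrable_Linfty_mult Q1 Q2 h)
    then have "norm (?L g\<^sub>1 - ?L g\<^sub>2) = norm (?L (poly R) - (?L (poly Q1) - ?L g\<^sub>1) + (?L (poly Q2) - ?L g\<^sub>2))"
      by simp
    also have "\<dots> \<le> norm (?L (poly R)) + norm (?L (poly Q1) - ?L g\<^sub>1) + norm (?L (poly Q2) - ?L g\<^sub>2)"
      by (rule order_trans[OF norm_triangle_ineq add_right_mono[OF norm_triangle_ineq4]])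
    also have "\<dots> \<le> \<bar>C\<bar> * (4 * \<epsilon>) + \<epsilon> + \<epsilon>"
      using LR Q1(4) Q2(4) by linarith
    finally show ?thesis by (simp add: algebra_simps)
  qed
  have "norm (?L g\<^sub>1 - ?L g\<^sub>2) \<le> 0 + e" if e: "e > 0" for e
    using small[of "e / (2 + 4 * \<bar>C\<bar>)"] e by (simp add: add_pos_nonneg)
  then have "norm (?L g\<^sub>1 - ?L g\<^sub>2) \<le> 0"
    by (rule field_le_epsilon)
  then show ?thesis by simp
qed

text \<open>Tents are Lipschitz and, for growing n, decrease to the indicator of the closed set.
  Closed sets are stable under intersection and generate the Borel sets, so all Borel integrals of r
  vanish.\<close>

lemma AE_eq_0_if_tent_integrals_0:
  fixes r :: "complex \<Rightarrow> real"
  assumes r: "integrable circ r"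
    and tent: "\<And>F n. closed F \<Longrightarrow> F \<noteq> {} \<Longrightarrow> (\<integral>\<zeta>. max 0 (1 - real n * infdist \<zeta> F) * r \<zeta> \<partial>circ) = 0"
  shows "AE \<zeta> in circ. r \<zeta> = 0"
proof (rule density_unique_real[OF r])
  let ?t = "\<lambda>F n \<zeta>. max 0 (1 - real n * infdist \<zeta> F)"
  have [measurable]: "r \<in> borel_measurable borel"
    using borel_measurable_integrable[OF r] by simp
  have set_int: "set_integrable circ A r" if "A \<in> sets borel" for A
    unfolding set_integrable_def using that r by (intro integrable_mult_indicator) auto
  have closed: "(LINT \<zeta>:F|circ. r \<zeta>) = 0" if F: "closed F" for F
  \<comment> \<open>By convention \<open>infdist\<close> to the empty set is 0, so its tents would
    be constantly 1 and would not converge to its indicator.\<close>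
  proof (cases "F = {}")
    case False
    have [measurable]: "F \<in> sets borel" using F by simp
    have [measurable]: "(\<lambda>\<zeta>. infdist \<zeta> F) \<in> borel_measurable borel"
      by (intro borel_measurable_continuous_onI continuous_intros)
    have "(\<lambda>n. \<integral>\<zeta>. ?t F n \<zeta> * r \<zeta> \<partial>circ) \<longlonglongrightarrow> (\<integral>\<zeta>. indicator F \<zeta> * r \<zeta> \<partial>circ)"
    proof (rule integral_dominated_convergence[where w="\<lambda>\<zeta>. \<bar>r \<zeta>\<bar>"])
      show "AE \<zeta> in circ. (\<lambda>n. ?t F n \<zeta> * r \<zeta>) \<longlonglongrightarrow> indicator F \<zeta> * r \<zeta>"
      proof (intro AE_I2 tendsto_mult tendsto_const)
        fix \<zeta>
        show "(\<lambda>n. ?t F n \<zeta>) \<longlonglongrightarrow> indicator F \<zeta>"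
        proof (cases "\<zeta> \<in> F")
          case False
          then have pos: "infdist \<zeta> F > 0"
            using F \<open>F \<noteq> {}\<close> in_closed_iff_infdist_zero[of F \<zeta>] infdist_nonneg[of \<zeta> F] by auto
          obtain n0 :: nat where n0: "1 / infdist \<zeta> F \<le> real n0"
            using real_arch_simple by blast
          have "?t F n \<zeta> = 0" if "n \<ge> n0" for n
          proof -
            have "1 / infdist \<zeta> F \<le> real n" using n0 that by linarith
            then show ?thesis using pos by (simp add: field_simps)
          qed
          then have "eventually (\<lambda>n. ?t F n \<zeta> = 0) sequentially"
            by (auto simp: eventually_sequentially)
          then show ?thesis using False by (simp add: tendsto_eventually)
        qed simp
      qed
      show "AE \<zeta> in circ. norm (?t F n \<zeta> * r \<zeta>) \<le> \<bar>r \<zeta>\<bar>" for n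
        by (intro AE_I2) (auto simp: abs_mult infdist_nonneg intro!: mult_left_le_one_le)
    qed (use r in auto)
    then have "(\<integral>\<zeta>. indicator F \<zeta> * r \<zeta> \<partial>circ) = 0"
      using tent[OF F False] by (simp add: LIMSEQ_const_iff)
    then show ?thesis by (simp add: set_lebesgue_integral_def)
  qed (simp add: set_lebesgue_integral_def)
  \<comment> \<open>Dynkin induction from the closed sets; the complement step uses that the whole
    plane is closed.\<close>
  have all: "(LINT \<zeta>:A|circ. r \<zeta>) = 0" if "A \<in> sets borel" for A
  proof -
    have "Int_stable (Collect closed :: complex set set)" "Collect closed \<subseteq> Pow (UNIV :: complex set)"
      "A \<in> sigma_sets UNIV (Collect closed)"
      using that by (auto simp: Int_stable_def borel_eq_closed)
    then show ?thesis
    proof (induction rule: sigma_sets_induct_disjoint)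
      case (compl A)
      then have A: "A \<in> sets borel" by (simp add: borel_eq_closed)
      have "(LINT \<zeta>:UNIV - A|circ. r \<zeta>) = (\<integral>\<zeta>. indicator UNIV \<zeta> *\<^sub>R r \<zeta> - indicator A \<zeta> *\<^sub>R r \<zeta> \<partial>circ)"
        unfolding set_lebesgue_integral_def
        by (intro Bochner_Integration.integral_cong) (auto split: split_indicator)
      also have "\<dots> = (LINT \<zeta>:UNIV|circ. r \<zeta>) - (LINT \<zeta>:A|circ. r \<zeta>)"
        using set_int[of UNIV] set_int[OF A] unfolding set_lebesgue_integral_def set_integrable_def
        by (intro Bochner_Integration.integral_diff) auto
      finally show ?case using compl closed[of UNIV] by simp
    next
      case (union A)
      then have A: "A i \<in> sets borel" for i by (auto simp: borel_eq_closed)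
      have "(LINT \<zeta>:(\<Union>i. A i)|circ. r \<zeta>) = (\<Sum>i. LINT \<zeta>:A i|circ. r \<zeta>)"
        by (rule lebesgue_integral_countable_add)
           (use A union in \<open>auto simp: disjoint_family_on_def intro!: set_int\<close>)
      then show ?case using union by simp
    qed (auto simp: closed)
  qed
  show "(LINT \<zeta>:A|circ. r \<zeta>) = (LINT \<zeta>:A|circ. 0)" if "A \<in> sets circ" for A
    using all[of A] that by (simp add: set_lebesgue_integral_def)
qed simp

section \<open>Transfer between \<open>circ\<close> and the completed measure\<close>

lemma space_circle_lebesgue: "space circle_lebesgue = sphere 0 1"
  by (simp add: circle_lebesgue_eq space_restrict_space)

lemma measurable_circle_lebesgue:
  "F \<in> borel_measurable borel \<Longrightarrow> F \<in> borel_measurable circle_lebesgue"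
  unfolding circle_lebesgue_eq by (intro measurable_completion measurable_restrict_space1) simp

lemma AE_circle_lebesgue: "(AE \<zeta> in circ. P \<zeta>) \<Longrightarrow> (AE \<zeta> in circle_lebesgue. P \<zeta>)"
  unfolding circle_lebesgue_eq
  by (rule AE_completion, subst AE_restrict_space_iff) (auto elim!: eventually_mono)

lemma integral_circle_lebesgue:
  fixes F :: "complex \<Rightarrow> 'a :: {banach, second_countable_topology}"
  assumes [measurable]: "F \<in> borel_measurable borel"
  shows "(LINT \<zeta>|circle_lebesgue. F \<zeta>) = (LINT \<zeta>|circ. F \<zeta>)"
proof -
  have [measurable]: "sphere (0::complex) 1 \<in> sets borel" by simp
  have "(LINT \<zeta>|circle_lebesgue. F \<zeta>) = (LINT \<zeta>|restrict_space circ (sphere 0 1). F \<zeta>)"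
    unfolding circle_lebesgue_eq by (intro integral_completion measurable_restrict_space1) simp
  also have "\<dots> = (LINT \<zeta>|circ. indicator (sphere 0 1) \<zeta> *\<^sub>R F \<zeta>)"
    by (rule integral_restrict_space) simp
  also have "\<dots> = (LINT \<zeta>|circ. F \<zeta>)"
    by (rule integral_arc_cong) auto
  finally show ?thesis .
qed

lemma emeasure_circle_lebesgue_finite: "emeasure circle_lebesgue (sphere 0 1) < \<infinity>"
proof -
  have "emeasure circle_lebesgue (sphere 0 1) = emeasure circ (sphere 0 1)"
    by (rule circle_lebesgue_sandwich(2)[where Z="{}"]) auto
  then show ?thesis by (simp add: circ.emeasure_finite less_top[symmetric])
qed

interpretation circle_lebesgue: finite_measure circle_lebesgue
  by (rule finite_measureI) (use emeasure_circle_lebesgue_finite in \<open>simp add: space_circle_lebesgue\<close>)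

lemma rigidity_little_bloch_if_dini_finite:
  assumes E: "E \<in> sets circle_lebesgue"
    and B: "B \<in> sets borel" "B \<subseteq> E" "E \<subseteq> sphere 0 1"
    and Z: "Z \<in> sets borel" "Z \<subseteq> sphere 0 1" "emeasure circ Z = 0" "E - B \<subseteq> Z"
    and dini: "dini (indicat_real B) < \<infinity>"
  shows "rigidity_little_bloch E"
  unfolding rigidity_little_bloch_def
proof (clarify)
  fix f\<^sub>1 g\<^sub>1 f\<^sub>2 g\<^sub>2 :: "complex \<Rightarrow> complex"
  assume P: "(f\<^sub>1, g\<^sub>1) \<in> P_little_bloch E" "(f\<^sub>2, g\<^sub>2) \<in> P_little_bloch E"
    and f_eq: "\<forall>z\<in>ball 0 1. f\<^sub>1 z = f\<^sub>2 z"
  note [measurable] = B(1)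
  let ?CL = "circle_lebesgue" and ?EL = "circle_lebesgue_on E"
  have E_space: "E \<inter> space ?CL \<in> sets ?CL"
    using E by auto
  have ae_E: "AE \<zeta> in ?CL. \<zeta> \<in> E \<longrightarrow> \<zeta> \<in> B"
    by (rule AE_I'[OF null_sets_circle_lebesgueI[OF Z(1-3) Z(4)]]) auto
  have g_Linfty: "g\<^sub>1 \<in> Linfty E" "g\<^sub>2 \<in> Linfty E"
    using P topspace_weak_star_topology_subset unfolding P_little_bloch_def in_closure_of by auto
  \<comment> \<open>Extending the difference by 0 moves the question from \<open>E\<close> to the
    whole circle, where tests against arbitrary closed sets make sense.\<close>
  define G where "G \<zeta> = indicator E \<zeta> *\<^sub>R (g\<^sub>1 \<zeta> - g\<^sub>2 \<zeta>)" for \<zeta>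
  have G_meas [measurable]: "G \<in> borel_measurable ?CL"
    unfolding G_def using g_Linfty
    by (subst borel_measurable_restrict_space_iff[OF E_space, symmetric]) (auto simp: Linfty_def)
  obtain C where C: "AE \<zeta> in ?CL. norm (G \<zeta>) \<le> C"
  proof -
    obtain C1 C2 where "AE \<zeta> in ?EL. norm (g\<^sub>1 \<zeta>) \<le> C1" "AE \<zeta> in ?EL. norm (g\<^sub>2 \<zeta>) \<le> C2"
      using g_Linfty by (auto simp: Linfty_def)
    then have "AE \<zeta> in ?CL. \<zeta> \<in> E \<longrightarrow> norm (g\<^sub>1 \<zeta>) \<le> C1" "AE \<zeta> in ?CL. \<zeta> \<in> E \<longrightarrow> norm (g\<^sub>2 \<zeta>) \<le> C2"
      by (simp_all add: AE_restrict_space_iff[OF E_space])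
    then have "AE \<zeta> in ?CL. norm (G \<zeta>) \<le> \<bar>C1\<bar> + \<bar>C2\<bar>"
    proof eventually_elim
      case (elim \<zeta>)
      then show ?case
        using norm_triangle_ineq4[of "g\<^sub>1 \<zeta>" "g\<^sub>2 \<zeta>"] by (auto simp: G_def split: split_indicator)
    qed
    then show thesis by (rule that)
  qed
  have int_G: "integrable ?CL G"
    by (rule circle_lebesgue.integrable_const_bound[OF C]) simp
  have tent: "(LINT \<zeta>|?CL. max 0 (1 - real n * infdist \<zeta> F) *\<^sub>R G \<zeta>) = 0" if F: "closed F" "F \<noteq> {}" for F n
  proof -
    define t where "t \<zeta> = max 0 (1 - real n * infdist \<zeta> F)" for \<zeta>
    have t: "0 \<le> t \<zeta>" "t \<zeta> \<le> 1" for \<zeta>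
      by (auto simp: t_def infdist_nonneg)
    have [measurable]: "t \<in> borel_measurable borel"
      unfolding t_def by (intro borel_measurable_continuous_onI continuous_intros)
    have t_lip: "\<bar>t x - t y\<bar> \<le> real n * norm (x - y)" for x y
    proof -
      have "\<bar>t x - t y\<bar> \<le> \<bar>real n * infdist x F - real n * infdist y F\<bar>"
        by (auto simp: t_def max_def)
      also have "\<dots> = real n * \<bar>infdist x F - infdist y F\<bar>"
        by (simp add: abs_mult flip: right_diff_distrib)
      also have "\<dots> \<le> real n * norm (x - y)"
        using infdist_triangle_abs[of x F y] by (intro mult_left_mono) (auto simp: dist_norm)
      finally show ?thesis .
    qed
    \<comment> \<open>A Lipschitz tent times an indicator of finite Dini integral again has finite
      Dini integral, so the Bloch bound holds for \<open>k\<close>. Using \<open>B\<close> makes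
      \<open>k\<close> a Borel function.\<close>
    define k where "k \<zeta> = t \<zeta> * indicator B \<zeta>" for \<zeta>
    have [measurable]: "k \<in> borel_measurable borel"
      unfolding k_def by measurable
    have k: "\<bar>k \<zeta>\<bar> \<le> 1" for \<zeta>
      using t[of \<zeta>] by (auto simp: k_def split: split_indicator)
    have dini_k: "dini k < \<infinity>"
    proof -
      have "dini k = dini (\<lambda>\<zeta>. complex_of_real (k \<zeta>))"
        unfolding dini_def osc_def by (simp flip: of_real_diff)
      also have "\<dots> = dini (\<lambda>\<zeta>. complex_of_real (t \<zeta>) * of_real (indicator B \<zeta>))"
        by (simp add: k_def)
      also have "\<dots> < \<infinity>"
      proof (rule dini_mult_lipschitz_finite[where B=1 and L="real n"])
        show "norm (complex_of_real (t x) - complex_of_real (t y)) \<le> real n * norm (x - y)" for x y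
          using t_lip[of x y] by (simp flip: of_real_diff)
      qed (use t dini in \<open>auto split: split_indicator\<close>)
      finally show ?thesis .
    qed
    obtain C where C: "\<And>Q N. (\<And>z. norm z < 1 \<Longrightarrow> (1 - norm z) * norm (poly (pderiv Q) z) \<le> N) \<Longrightarrow>
        norm (\<integral>\<eta>. poly Q \<eta> * of_real (k \<eta>) \<partial>circ) \<le> C * (norm (poly Q 0) + N)"
      by (rule pairing_le_bloch[of k]) (use k dini_k in auto)
    have int_k: "integrable ?EL (\<lambda>\<zeta>. complex_of_real (k \<zeta>))"
    proof (subst integrable_restrict_space[OF E_space])
      show "integrable ?CL (\<lambda>\<zeta>. indicator E \<zeta> *\<^sub>R complex_of_real (k \<zeta>))"
      proof (rule circle_lebesgue.integrable_const_bound[where B=1])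
        show "(\<lambda>\<zeta>. indicator E \<zeta> *\<^sub>R complex_of_real (k \<zeta>)) \<in> borel_measurable ?CL"
          using E measurable_circle_lebesgue[of k] by simp
      qed (use k in \<open>auto split: split_indicator\<close>)
    qed
    have poly_int: "(LINT \<zeta>|?EL. poly Q \<zeta> * of_real (k \<zeta>)) = (\<integral>\<zeta>. poly Q \<zeta> * of_real (k \<zeta>) \<partial>circ)" for Q
    proof -
      have "(LINT \<zeta>|?EL. poly Q \<zeta> * of_real (k \<zeta>)) = (LINT \<zeta>|?CL. indicator E \<zeta> *\<^sub>R (poly Q \<zeta> * of_real (k \<zeta>)))"
        by (rule integral_restrict_space[OF E_space])
      also have "\<dots> = (LINT \<zeta>|?CL. poly Q \<zeta> * of_real (k \<zeta>))"
        using B(2) by (intro Bochner_Integration.integral_cong) (auto simp: k_def split: split_indicator)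
      also have "\<dots> = (\<integral>\<zeta>. poly Q \<zeta> * of_real (k \<zeta>) \<partial>circ)"
        by (rule integral_circle_lebesgue) simp
      finally show ?thesis .
    qed
    have "(LINT \<zeta>|?EL. g\<^sub>1 \<zeta> * of_real (k \<zeta>)) = (LINT \<zeta>|?EL. g\<^sub>2 \<zeta> * of_real (k \<zeta>))"
      by (rule P_little_bloch_pairing_eq[OF P _ int_k, of C]) (use f_eq C in \<open>auto simp: poly_int\<close>)
    then have "0 = (LINT \<zeta>|?EL. g\<^sub>1 \<zeta> * of_real (k \<zeta>) - g\<^sub>2 \<zeta> * of_real (k \<zeta>))"
      by (simp add: Bochner_Integration.integral_diff integrable_Linfty_mult g_Linfty int_k)
    also have "\<dots> = (LINT \<zeta>|?CL. indicator E \<zeta> *\<^sub>R (g\<^sub>1 \<zeta> * of_real (k \<zeta>) - g\<^sub>2 \<zeta> * of_real (k \<zeta>)))"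
      by (rule integral_restrict_space[OF E_space])
    also have "\<dots> = (LINT \<zeta>|?CL. of_real (k \<zeta>) * G \<zeta>)"
      by (intro Bochner_Integration.integral_cong) (auto simp: G_def algebra_simps)
    \<comment> \<open>The two integrands can differ only on \<open>E - B\<close>, which is null,
      since G vanishes off \<open>E\<close>.\<close>
    also have "\<dots> = (LINT \<zeta>|?CL. t \<zeta> *\<^sub>R G \<zeta>)"
    proof (rule integral_cong_AE)
      show "AE \<zeta> in ?CL. of_real (k \<zeta>) * G \<zeta> = t \<zeta> *\<^sub>R G \<zeta>"
        using ae_E by eventually_elim (auto simp: k_def G_def scaleR_conv_of_real split: split_indicator)
    qed (use measurable_circle_lebesgue[of k] measurable_circle_lebesgue[of t] in simp_all)
    finally show ?thesis by (simp add: t_def)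
  qed
  \<comment> \<open>Stated for a real functional so that real and imaginary part are treated by one
    argument.\<close>
  have zero: "AE \<zeta> in ?CL. \<phi> (G \<zeta>) = 0" if \<phi>: "bounded_linear \<phi>" for \<phi> :: "complex \<Rightarrow> real"
  proof -
    have sph: "sphere 0 1 \<inter> space circ \<in> sets circ" by simp
    have [measurable]: "\<phi> \<in> borel_measurable borel"
      using \<phi> by (intro borel_measurable_continuous_onI linear_continuous_on)
    have int_\<phi>G: "integrable ?CL (\<lambda>\<zeta>. \<phi> (G \<zeta>))"
      by (rule integrable_bounded_linear[OF \<phi> int_G])
    \<comment> \<open>\<phi> (G \<zeta>) is measurable only for the completion; a Borel
      representative, extended by 0 off the circle, brings the tent criterion for
      \<open>circ\<close> into play.\<close>
    obtain r0 where r0: "r0 \<in> borel_measurable (restrict_space circ (sphere 0 1))"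
      "AE \<zeta> in restrict_space circ (sphere 0 1). \<phi> (G \<zeta>) = r0 \<zeta>"
      using completion_ex_borel_measurable_real[of "\<lambda>\<zeta>. \<phi> (G \<zeta>)" "restrict_space circ (sphere 0 1)"]
        borel_measurable_integrable[OF int_\<phi>G] unfolding circle_lebesgue_eq by blast
    define r where "r \<zeta> = indicator (sphere 0 1) \<zeta> *\<^sub>R r0 \<zeta>" for \<zeta>
    have r_meas: "r \<in> borel_measurable circ"
      using r0(1) unfolding r_def borel_measurable_restrict_space_iff[OF sph] .
    then have [measurable]: "r \<in> borel_measurable borel" by simp
    have ae_r: "AE \<zeta> in ?CL. \<phi> (G \<zeta>) = r \<zeta>"
    proof -
      have "AE \<zeta> in restrict_space circ (sphere 0 1). \<phi> (G \<zeta>) = r \<zeta>"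
        using r0(2) unfolding AE_restrict_space_iff[OF sph] by eventually_elim (simp add: r_def)
      then show ?thesis unfolding circle_lebesgue_eq by (rule AE_completion)
    qed
    have int_r_CL: "integrable ?CL r"
    proof -
      have "integrable ?CL (\<lambda>\<zeta>. \<phi> (G \<zeta>)) = integrable ?CL r"
        by (rule integrable_cong_AE[OF _ _ ae_r])
           (use int_\<phi>G measurable_circle_lebesgue[of r] in auto)
      then show ?thesis using int_\<phi>G by simp
    qed
    have int_r: "integrable circ r"
    proof -
      have "integrable (restrict_space circ (sphere 0 1)) r"
        using int_r_CL r_meas unfolding circle_lebesgue_eq
        by (subst (asm) integrable_completion) (auto intro: measurable_restrict_space1)
      then have "integrable circ (\<lambda>\<zeta>. indicator (sphere 0 1) \<zeta> *\<^sub>R r \<zeta>)"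
        by (simp add: integrable_restrict_space[OF sph])
      moreover have "(\<lambda>\<zeta>. indicator (sphere 0 1) \<zeta> *\<^sub>R r \<zeta>) = r"
        by (auto simp: r_def split: split_indicator)
      ultimately show ?thesis by simp
    qed
    have "AE \<zeta> in circ. r \<zeta> = 0"
    proof (rule AE_eq_0_if_tent_integrals_0[OF int_r])
      fix F :: "complex set" and n assume F: "closed F" "F \<noteq> {}"
      define t where "t \<zeta> = max 0 (1 - real n * infdist \<zeta> F)" for \<zeta>
      have t: "0 \<le> t \<zeta>" "t \<zeta> \<le> 1" for \<zeta>
        by (auto simp: t_def infdist_nonneg)
      have [measurable]: "t \<in> borel_measurable borel"
        unfolding t_def by (intro borel_measurable_continuous_onI continuous_intros)
      have t_CL[measurable]: "t \<in> borel_measurable ?CL"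
        by (rule measurable_circle_lebesgue) simp
      have r_CL[measurable]: "r \<in> borel_measurable ?CL"
        by (rule measurable_circle_lebesgue) simp
      have int_tG: "integrable ?CL (\<lambda>\<zeta>. t \<zeta> *\<^sub>R G \<zeta>)"
        by (rule Bochner_Integration.integrable_bound[OF int_G])
           (use t in \<open>auto intro!: mult_left_le_one_le\<close>)
      have "(\<integral>\<zeta>. t \<zeta> * r \<zeta> \<partial>circ) = (LINT \<zeta>|?CL. t \<zeta> * r \<zeta>)"
        by (rule integral_circle_lebesgue[symmetric]) simp
      also have "\<dots> = (LINT \<zeta>|?CL. \<phi> (t \<zeta> *\<^sub>R G \<zeta>))"
      proof (rule integral_cong_AE)
        show "AE \<zeta> in ?CL. t \<zeta> * r \<zeta> = \<phi> (t \<zeta> *\<^sub>R G \<zeta>)"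
          using ae_r by eventually_elim (simp add: linear_simps(5)[OF \<phi>])
      qed simp_all
      also have "\<dots> = \<phi> (LINT \<zeta>|?CL. t \<zeta> *\<^sub>R G \<zeta>)"
        by (rule integral_bounded_linear[OF \<phi> int_tG])
      also have "\<dots> = 0"
        using tent[OF F, of n] linear_0[OF bounded_linear.linear[OF \<phi>]] by (simp add: t_def)
      finally show "(\<integral>\<zeta>. max 0 (1 - real n * infdist \<zeta> F) * r \<zeta> \<partial>circ) = 0"
        by (simp add: t_def)
    qed
    then have "AE \<zeta> in ?CL. r \<zeta> = 0" by (rule AE_circle_lebesgue)
    then show ?thesis using ae_r by eventually_elim simp
  qed
  have "AE \<zeta> in ?CL. \<zeta> \<in> E \<longrightarrow> g\<^sub>1 \<zeta> = g\<^sub>2 \<zeta>"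
    using zero[OF bounded_linear_Re] zero[OF bounded_linear_Im]
    by eventually_elim (auto simp: G_def complex_eq_iff)
  then show "AE \<zeta> in ?EL. g\<^sub>1 \<zeta> = g\<^sub>2 \<zeta>"
    by (simp add: AE_restrict_space_iff[OF E_space])
qed

theorem proposition2p6:
  fixes E :: "complex set"
  assumes "E \<in> sets circle_lebesgue"
    and "emeasure circle_lebesgue E > 0"
    and "(\<integral>\<^sup>+t\<in>{0<..1}. emeasure circle_lebesgue (sym_diff (circle_translate E t) E) / ennreal t
            \<partial>lborel) < \<infinity>"
  shows "(\<exists>K. K \<subseteq> sphere 0 1 \<and> compact K \<and> almost_contained K E \<and> \<not> removable_W1a K) \<and>
         rigidity_little_bloch E"
proof -
  obtain B Z where B: "B \<in> sets borel" "B \<subseteq> E" "E \<subseteq> sphere 0 1"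
    and Z: "Z \<in> sets borel" "Z \<subseteq> sphere 0 1" "emeasure circ Z = 0" "E - B \<subseteq> Z"
    by (rule circle_lebesgue_borel_core[OF assms(1)])
  note [measurable] = B(1)
  have B_sph: "B \<subseteq> sphere 0 1" using B by blast
  have emeasure_E: "emeasure circle_lebesgue E = emeasure circ B"
    by (rule circle_lebesgue_sandwich(2)[OF B(1) B_sph Z(1-3)]) (use B Z in auto)
  have dini: "dini (indicat_real B) < \<infinity>"
  proof (rule dini_finite_if_integrable_modulus)
    show "(\<integral>\<^sup>+t\<in>{0<..1}. osc (indicat_real B) (cis t) / ennreal t \<partial>lborel) < \<infinity>"
      using assms(3) by (simp add: emeasure_sym_diff_translate[OF assms(1) B Z])
  qed (auto split: split_indicator)
  \<comment> \<open>Losing at most half of \<open>B\<close> leaves \<open>K\<close> with positive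
    length.\<close>
  define \<epsilon> where "\<epsilon> = measure circ B / 2"
  have eB: "emeasure circ B = ennreal (measure circ B)"
    by (rule circ.emeasure_eq_measure)
  have \<epsilon>: "\<epsilon> > 0"
    using assms(2) by (simp add: \<epsilon>_def emeasure_E eB)
  obtain K where K: "compact K" "K \<subseteq> sphere 0 1" "emeasure circ (K - B) = 0"
    "emeasure circ (B - K) \<le> ennreal \<epsilon>" "dini (indicat_real K) < \<infinity>"
    by (rule compact_almost_subset_dini[OF B(1) B_sph dini \<epsilon>])
  have [measurable]: "K \<in> sets borel" using K(1) by (simp add: borel_compact)
  have "emeasure circ K > 0"
  proof (rule ccontr)
    assume "\<not> emeasure circ K > 0"
    then have "emeasure circ K = 0" by simp
    then have "emeasure circ B \<le> emeasure circ (B - K)"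
      using emeasure_subadditive[of "B - K" circ K] emeasure_mono[of B "(B - K) \<union> K" circ] by auto
    also have "\<dots> \<le> ennreal \<epsilon>" by (rule K(4))
    finally show False using \<epsilon> by (simp add: eB \<epsilon>_def)
  qed
  then have "\<not> removable_W1a K"
    by (rule not_removable_W1a_if_dini_finite[OF K(1,2) _ K(5)])
  moreover have "almost_contained K E"
    unfolding almost_contained_def
    by (rule null_sets_circle_lebesgueI[OF _ _ K(3)]) (use K(2) B in auto)
  moreover have "rigidity_little_bloch E"
    by (rule rigidity_little_bloch_if_dini_finite[OF assms(1) B Z dini])
  ultimately show ?thesis
    using K(1,2) by blast
qed

end
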